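(* Let $0<\epsilon,p<1$, let $\rho$ be either the uniform or the Chebyshev measure on $\mathbb{X}=[-1,1]^N$, and let $\{\psi_\nu\}_{\nu\in\mathbb{N}_0^N}$ be the tensorized Legendre or Chebyshev polynomials, respectively. For $n\ge3$ let $\{\mathbf{x}_t^{(i)}\}_{i=1}^n$ be $n$ data points sampled i.i.d. from $\rho$ and $\mathbf{y}_t^{(i)}=\mathbf{x}_{t+\tau}^{(i)}$. Then there exist sets $S_1,\dots,S_l\subseteq\mathbb{N}_0^N$ of cardinality $|S_i|\le\lceil n/\log(n/\epsilon)\rceil$ for all $i\in\{1,\dots,l\}$ such that, with probability at least $1-l\epsilon$, the following holds. If $\mathcal{K}^\tau[\phi_i]$ admits a holomorphic extension to a Bernstein polyellipse $\mathcal{E}_{\vec\rho}\subset\mathbb{C}^N$ for all $i\in\{1,\dots,l\}$, then the EDMD approximation $\mathcal{K}_{mn}^\tau$ of the Koopman operator $\mathcal{K}^\tau$ with expansion dictionary $\vec\psi=\{\psi_\nu\}_{\nu\in\bigcup_{i=1}^lS_i}$ is unique and satisfies, for all $i\in\{1,\dots,l\}$, $$\|\mathcal{K}_{mn}^\tau[\phi_i]-\mathcal{K}^\tau[\phi_i]\|_{L^2_\rho(\mathbb{X})}\le C(\vec\rho,p)\left(\frac{n}{\log(n/\epsilon)}\right)^{\frac12-\frac1p},$$ where $C(\vec\rho,p)$ is a constant that depends on $\vec\rho$ and $p$ only.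
   Context: The state space is $\mathbb{X}=[-1,1]^N$, with states $\mathbf{x}_t$ of a dynamical system, and $\tau>0$. The Koopman operator acts on observables $\varphi:\mathbb{X}\to\mathbb{C}$ by $\mathcal{K}^\tau[\varphi](\mathbf{x})=\mathbb{E}[\varphi(\mathbf{x}_{t+\tau})\mid\mathbf{x}_t=\mathbf{x}]$. Data are pairs $(\mathbf{x}_t^{(i)},\mathbf{y}_t^{(i)})$, where $\mathbf{y}_t^{(i)}=\mathbf{x}_{t+\tau}^{(i)}$ is the state reached from $\mathbf{x}_t^{(i)}$ after time $\tau$. The feature dictionary is $\vec\phi=(\phi_1,\dots,\phi_l)$ with $\phi_i\in L^2_\rho(\mathbb{X})$ possibly complex valued. EDMD (Extended Dynamic Mode Decomposition): given an expansion dictionary $\vec\psi=(\psi_1,\dots,\psi_m)$ of functions in $L^2_\rho(\mathbb{X})$ (here $m$ is the number of dictionary elements, $m=|\bigcup_iS_i|$), let $\Psi_n=(\psi_i(\mathbf{x}_t^{(j)}))_{i,j}\in\mathbb{C}^{m\times n}$ and $\Phi_n^\tau=(\phi_i(\mathbf{y}_t^{(j)}))_{i,j}\in\mathbb{C}^{l\times n}$, and let $K_{mn}^\tau\in\mathbb{C}^{l\times m}$ be a solution of $\min_{K\in\mathbb{C}^{l\times m}}\|\Phi_n^\tau-K\Psi_n\|_F^2$ ($\|\cdot\|_F$ the Frobenius norm). The EDMD approximation of the Koopman operator is $\mathcal{K}_{mn}^\tau[\varphi]=\mathbf{c}\cdot K_{mn}^\tau\vec\psi$ for $\varphi=\mathbf{c}\cdot\vec\phi$,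 $\mathbf{c}\in\mathbb{C}^l$; in particular $\mathcal{K}_{mn}^\tau[\phi_i]=\sum_{k=1}^m(K_{mn}^\tau)_{ik}\psi_k$. The uniform measure is the uniform probability measure on $[-1,1]^N$, and the Chebyshev measure is the product probability measure $\prod_{k=1}^N\frac{dx_k}{\pi\sqrt{1-x_k^2}}$. The tensorized Legendre (resp. Chebyshev) polynomials are the products $\psi_\nu(\mathbf{x})=\prod_{k=1}^NP_{\nu_k}(x_k)$, $\nu\in\mathbb{N}_0^N$, of univariate Legendre (resp. first-kind Chebyshev) polynomials $P_j$ of degree $j$, orthogonal with respect to the corresponding measure. The Bernstein ellipse with parameter $r>1$ is $\mathcal{E}_r=\{(z+z^{-1})/2:z\in\mathbb{C},\ 1\le|z|\le r\}$. For $\vec\rho=(\rho_1,\dots,\rho_N)$ with all $\rho_k>1$, the Bernstein polyellipse is $\mathcal{E}_{\vec\rho}=\mathcal{E}_{\rho_1}\times\cdots\times\mathcal{E}_{\rho_N}\subset\mathbb{C}^N$. (The numbers $\rho_k$ are unrelated to the measure $\rho$.)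
   Formalization: The bound carries the factor sup over the polyellipse of the extension of K[φ_i] (without it, scaling φ_i refutes the claim), and φ_i(x_{t+τ}) = K[φ_i](x_t) is assumed almost surely, as for deterministic dynamics, since noisy observables violate the rate. *)

theory Defs
  imports "HOL-Probability.Probability" "HOL-Computational_Algebra.Polynomial"
begin

section \<open>State space and reference measures\<close>

definition cube :: "(real ^ 'N) set" where
  "cube = {x. \<forall>k. -1 \<le> x $ k \<and> x $ k \<le> 1}"

text \<open>Measures on the state space are Borel measures on the ambient space that give full
  mass to the cube; functions on the cube are identified with (arbitrary Borel extensions of)
  themselves to the ambient space.\<close>

definition uniform_cube :: "(real ^ 'N) measure" where
  "uniform_cube = uniform_measure lborel cube"

text \<open>The density is the product of the univariate densities; at the null set where some
  coordinate is $\pm 1$ it takes the value 0.\<close>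

definition chebyshev_measure :: "(real ^ 'N) measure" where
  "chebyshev_measure = density lborel
     (\<lambda>x. ennreal (indicator cube x * (\<Prod>k\<in>UNIV. 1 / (pi * sqrt (1 - (x $ k)\<^sup>2)))))"

definition L2 :: "'a measure \<Rightarrow> ('a \<Rightarrow> complex) set" where
  "L2 M = {f \<in> borel_measurable M. integrable M (\<lambda>x. (cmod (f x))\<^sup>2)}"

text \<open>Only meaningful for members of L2, since the integral of a non-integrable function is 0.\<close>

definition L2_norm :: "'a measure \<Rightarrow> ('a \<Rightarrow> complex) \<Rightarrow> real" where
  "L2_norm M f = sqrt (LINT x|M. (cmod (f x))\<^sup>2)"

section \<open>Tensorized orthogonal polynomials\<close>

text \<open>Rodrigues' formula.\<close>

definition legendre_poly :: "nat \<Rightarrow> real poly" where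
  "legendre_poly j = smult (1 / (2 ^ j * fact j)) ((pderiv ^^ j) ([:-1, 0, 1:] ^ j))"

fun chebyshev_poly :: "nat \<Rightarrow> real poly" where
  "chebyshev_poly 0 = 1"
| "chebyshev_poly (Suc 0) = [:0, 1:]"
| "chebyshev_poly (Suc (Suc j)) = [:0, 2:] * chebyshev_poly (Suc j) - chebyshev_poly j"

definition tensor_poly :: "(nat \<Rightarrow> real poly) \<Rightarrow> nat ^ 'N \<Rightarrow> real ^ 'N \<Rightarrow> complex" where
  "tensor_poly P \<nu> x = complex_of_real (\<Prod>k\<in>UNIV. poly (P (\<nu> $ k)) (x $ k))"

section \<open>Dynamics, Koopman operator and data\<close>

text \<open>For a fixed lag \<open>\<tau>\<close>, the measure \<open>\<kappa> x\<close> is the conditional law of the state at time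
  \<open>t + \<tau>\<close> given that the state at time \<open>t\<close> is \<open>x\<close>.\<close>

definition transition_kernel :: "(real ^ 'N \<Rightarrow> (real ^ 'N) measure) \<Rightarrow> bool" where
  "transition_kernel \<kappa> \<longleftrightarrow>
     \<kappa> \<in> borel \<rightarrow>\<^sub>M prob_algebra borel \<and> (\<forall>x\<in>cube. AE y in \<kappa> x. y \<in> cube)"

definition koopman ::
    "(real ^ 'N \<Rightarrow> (real ^ 'N) measure) \<Rightarrow> (real ^ 'N \<Rightarrow> complex) \<Rightarrow> real ^ 'N \<Rightarrow> complex" where
  "koopman \<kappa> \<phi> x = (LINT y|\<kappa> x. \<phi> y)"

text \<open>The observable, evaluated at the state reached after time \<open>\<tau>\<close>, almost surely coincides
  with its conditional expectation given the initial state. This holds for every observable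
  of a deterministic system (lemma \<open>noise_free_deterministic\<close>).\<close>

definition noise_free ::
    "(real ^ 'N) measure \<Rightarrow> (real ^ 'N \<Rightarrow> (real ^ 'N) measure) \<Rightarrow> (real ^ 'N \<Rightarrow> complex) \<Rightarrow> bool" where
  "noise_free \<rho> \<kappa> \<phi> \<longleftrightarrow> (AE x in \<rho>. AE y in \<kappa> x. \<phi> y = koopman \<kappa> \<phi> x)"

lemma koopman_deterministic:
  assumes "\<phi> \<in> borel_measurable borel"
  shows "koopman (\<lambda>x. return borel (T x)) \<phi> x = \<phi> (T x)"
  using assms by (simp add: koopman_def integral_return)

lemma transition_kernel_deterministic:
  assumes "T \<in> borel \<rightarrow>\<^sub>M borel" and "T ` cube \<subseteq> cube"
  shows "transition_kernel (\<lambda>x. return borel (T x))"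
proof -
  have [measurable]: "Measurable.pred borel (\<lambda>y::real ^ 'a. y \<in> cube)"
    unfolding cube_def by measurable
  show ?thesis
    unfolding transition_kernel_def
    using assms by (auto intro!: measurable_compose[OF _ return_measurable]
        measurable_prob_algebraI prob_space_return simp: AE_return)
qed

lemma noise_free_deterministic:
  assumes "\<phi> \<in> borel_measurable borel"
  shows "noise_free \<rho> (\<lambda>x. return borel (T x)) \<phi>"
proof -
  have "Measurable.pred borel (\<lambda>y. \<phi> y = c)" for c
    using assms by measurable
  then show ?thesis
    unfolding noise_free_def koopman_deterministic[OF assms] by (simp add: AE_return)
qed

text \<open>Joint law of an initial state drawn from \<open>\<rho>\<close> and the state reached from it, and the
  law of \<open>n\<close> independent such pairs.\<close>

definition pair_law ::
    "(real ^ 'N) measure \<Rightarrow> (real ^ 'N \<Rightarrow> (real ^ 'N) measure) \<Rightarrow> ((real ^ 'N) \<times> (real ^ 'N)) measure" where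
  "pair_law \<rho> \<kappa> = \<rho> \<bind> (\<lambda>x. \<kappa> x \<bind> (\<lambda>y. return borel (x, y)))"

definition data_law ::
    "nat \<Rightarrow> (real ^ 'N) measure \<Rightarrow> (real ^ 'N \<Rightarrow> (real ^ 'N) measure) \<Rightarrow>
     (nat \<Rightarrow> (real ^ 'N) \<times> (real ^ 'N)) measure" where
  "data_law n \<rho> \<kappa> = Pi\<^sub>M {..<n} (\<lambda>_. pair_law \<rho> \<kappa>)"

section \<open>Extended dynamic mode decomposition\<close>

text \<open>Matrices are functions of a row and a column index. The columns of the EDMD matrix are
  indexed by the dictionary's (finite) multi-index set \<open>I\<close> itself, so that no enumeration of
  \<open>I\<close> is needed; extensionality makes equality of matrices equality of entries.\<close>

definition coeff_matrices :: "nat \<Rightarrow> 'i set \<Rightarrow> (nat \<Rightarrow> 'i \<Rightarrow> complex) set" where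
  "coeff_matrices l I = {..<l} \<rightarrow>\<^sub>E (I \<rightarrow>\<^sub>E UNIV)"

definition frobenius_norm :: "nat \<Rightarrow> nat \<Rightarrow> (nat \<Rightarrow> nat \<Rightarrow> complex) \<Rightarrow> real" where
  "frobenius_norm l n A = sqrt (\<Sum>i<l. \<Sum>j<n. (cmod (A i j))\<^sup>2)"

definition edmd_matrix ::
    "nat \<Rightarrow> nat \<Rightarrow> (nat \<Rightarrow> 'a \<Rightarrow> complex) \<Rightarrow> 'i set \<Rightarrow> ('i \<Rightarrow> 'a \<Rightarrow> complex) \<Rightarrow> (nat \<Rightarrow> 'a \<times> 'a) \<Rightarrow>
     (nat \<Rightarrow> 'i \<Rightarrow> complex) \<Rightarrow> bool" where
  "edmd_matrix l n \<phi> I \<psi> \<omega> K \<longleftrightarrow>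
     is_arg_min
       (\<lambda>K. (frobenius_norm l n (\<lambda>i j. \<phi> i (snd (\<omega> j)) - (\<Sum>\<nu>\<in>I. K i \<nu> * \<psi> \<nu> (fst (\<omega> j)))))\<^sup>2)
       (\<lambda>K. K \<in> coeff_matrices l I) K"

text \<open>The image of the observable with coefficient vector \<open>c\<close> in the feature dictionary.\<close>

definition edmd_koopman ::
    "nat \<Rightarrow> 'i set \<Rightarrow> ('i \<Rightarrow> 'a \<Rightarrow> complex) \<Rightarrow> (nat \<Rightarrow> 'i \<Rightarrow> complex) \<Rightarrow> (nat \<Rightarrow> complex) \<Rightarrow>
     'a \<Rightarrow> complex" where
  "edmd_koopman l I \<psi> K c x = (\<Sum>i<l. c i * (\<Sum>\<nu>\<in>I. K i \<nu> * \<psi> \<nu> x))"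

definition unit_coeff :: "nat \<Rightarrow> nat \<Rightarrow> complex" where
  "unit_coeff i = (\<lambda>j. if j = i then 1 else 0)"

section \<open>Holomorphic extensions to Bernstein polyellipses\<close>

definition bernstein_ellipse :: "real \<Rightarrow> complex set" where
  "bernstein_ellipse r = {(z + inverse z) / 2 | z. 1 \<le> cmod z \<and> cmod z \<le> r}"

definition bernstein_polyellipse :: "real ^ 'N \<Rightarrow> (complex ^ 'N) set" where
  "bernstein_polyellipse r = {z. \<forall>k. z $ k \<in> bernstein_ellipse (r $ k)}"

text \<open>Holomorphy in several variables: complex Frechet differentiability on a neighbourhood
  of each point of the set.\<close>

definition holomorphic_several :: "(complex ^ 'N \<Rightarrow> complex) \<Rightarrow> (complex ^ 'N) set \<Rightarrow> bool" where
  "holomorphic_several F A \<longleftrightarrow>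
     (\<exists>U. open U \<and> A \<subseteq> U \<and>
        (\<forall>z\<in>U. \<exists>D. (F has_derivative D) (at z) \<and> (\<forall>c v. D (c *s v) = c * D v)))"

definition complexify :: "real ^ 'N \<Rightarrow> complex ^ 'N" where
  "complexify x = (\<chi> k. complex_of_real (x $ k))"

text \<open>The extended function is an element of an \<open>L\<^sup>2\<close> space, hence agreement almost everywhere.\<close>

definition holomorphic_extension ::
    "(real ^ 'N) measure \<Rightarrow> real ^ 'N \<Rightarrow> (real ^ 'N \<Rightarrow> complex) \<Rightarrow> (complex ^ 'N \<Rightarrow> complex) \<Rightarrow> bool" where
  "holomorphic_extension \<rho> r f F \<longleftrightarrow>
     holomorphic_several F (bernstein_polyellipse r) \<and> (AE x in \<rho>. F (complexify x) = f x)"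

definition polyellipse_sup_norm :: "real ^ 'N \<Rightarrow> (complex ^ 'N \<Rightarrow> complex) \<Rightarrow> real" where
  "polyellipse_sup_norm r F = (SUP z\<in>bernstein_polyellipse r. cmod (F z))"

end

theory Submission
  imports Defs "HOL-Complex_Analysis.Cauchy_Integral_Formula"
begin

text \<open>
  Holomorphy on a polyellipse gives approximation by polynomials of coordinate degree below \<open>d\<close>
  at a geometric rate in \<open>d\<close>, whereas the claimed rate is only algebraic in
  $m = n / \log (n / \epsilon)$. So a full tensor grid with \<open>d\<close> a small power of $m$ serves as every
  $S_i$, independently of the observables, and powers of \<open>d\<close> may be lost freely. This slack replaces
  orthogonality and matrix concentration by an elementary argument: cut the cube into so many cells
  that a polynomial of the space varies on a cell by at most half of its maximum. By Hoeffding's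
  inequality all cells receive a fixed fraction of the samples, so the empirical norm controls the
  supremum norm on the polynomial space. Hence least squares is uniquely solvable and
  quasi-optimal in the supremum norm. Approximating polynomials are built by tensorised
  interpolation at Chebyshev nodes, which needs holomorphy in one variable at a time only.
\<close>

section \<open>Approximation on a Bernstein ellipse\<close>

text \<open>The order of choices shapes the argument: index sets and event are fixed before
  \<open>r\<close> and \<open>F\<close>, and the constant \<open>C r p\<close> before
  \<open>n\<close>, \<epsilon> and the observables. Hence the grid size may depend only on m = n /
  ln (n / \<epsilon>) and N. The numbers are forced as follows. On polynomials of coordinate degree
  below d, a bound B gives the Lipschitz constant 2 d^3 B for the l1 distance. A cell of side 2 / M
  then allows a variation of 4 N d^3 B / M, so M = 8 N d^3 yields the half. Each cell has mass at
  least q = (1 / (2 M)) ^ N under both measures, and Hoeffding bounds the failure of one cell by exp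
  (- n q^2 / 2). Asking this to be at most \<epsilon> / n amounts to m >= 2 / q^2 = 2 (16 N d^3) ^
  (2 N). So d is of order m ^ (1 / (6 N)), and R ^ (- d) still beats every power of m. If m is too
  small even for d = 1, the dictionary is empty, the approximation is 0, and the constant absorbs
  the error.\<close>

text \<open>Cauchy's formula on the annulus, with the kernel expanded in powers of u / w on the
  outer and of w / u on the inner circle and cut after \<open>d\<close> terms. The remainders are at
  most B r / (r - 1) / r ^ d and B / (r - 1) / r ^ d, which add up to the bound.\<close>

lemma annulus_laurent_approx:
  fixes g :: "complex \<Rightarrow> complex"
  assumes r: "r > 1" and S: "open S" and hol: "g holomorphic_on S"
    and sub: "{w. 1 / r \<le> cmod w \<and> cmod w \<le> r} \<subseteq> S"
    and bd: "\<And>w. 1 / r \<le> cmod w \<Longrightarrow> cmod w \<le> r \<Longrightarrow> cmod (g w) \<le> B"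
  obtains \<alpha> \<beta> where "\<And>u. cmod u = 1 \<Longrightarrow>
    cmod (g u - ((\<Sum>k<d. \<alpha> k * u ^ k) + (\<Sum>k<d. \<beta> k * inverse u ^ Suc k))) \<le> B * (r + 1) / (r - 1) / r ^ d"
proof -
  define Co where "Co = circlepath 0 r"
  define Ci where "Ci = circlepath 0 (1 / r)"
  define \<alpha> where "\<alpha> k = contour_integral Co (\<lambda>w. g w / w ^ Suc k) / (2 * of_real pi * \<i>)" for k
  define \<beta> where "\<beta> k = contour_integral Ci (\<lambda>w. g w * w ^ k) / (2 * of_real pi * \<i>)" for k
  have r0: "r > 0" "1 / r > 0" "1 / r < 1" "1 / r < r"
    using r by (auto simp: divide_simps mult_less_cancel_left1 less_1_mult)
  have B0: "B \<ge> 0"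
    using bd[of 1] r r0 by (smt (verit) norm_ge_zero norm_one)
  have imo: "path_image Co = {w. cmod w = r}" and imi: "path_image Ci = {w. cmod w = 1 / r}"
    using r0 r by (auto simp: Co_def Ci_def simp del: inverse_eq_divide)
  have vp[simp]: "valid_path Co" "valid_path Ci"
    by (auto simp: Co_def Ci_def)
  have ims: "path_image Co \<subseteq> S" "path_image Ci \<subseteq> S"
    using sub r0 by (auto simp: imo imi)
  have cg: "continuous_on S g"
    using hol holomorphic_on_imp_continuous_on by blast
  have hom: "homotopic_loops S Co Ci"
  proof (rule homotopic_loops_linear)
    fix t :: real assume "t \<in> {0..1}"
    show "closed_segment (Co t) (Ci t) \<subseteq> S"
    proof
      fix w assume "w \<in> closed_segment (Co t) (Ci t)"
      then obtain s where s: "0 \<le> s" "s \<le> 1" "w = (1 - s) *\<^sub>R Co t + s *\<^sub>R Ci t"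
        by (auto simp: closed_segment_def)
      have "w = of_real ((1 - s) * r + s * (1 / r)) * exp (2 * of_real pi * \<i> * of_real t)"
        unfolding s(3) Co_def Ci_def circlepath
        by (simp add: scaleR_conv_of_real algebra_simps)
      moreover have "cmod (exp (2 * of_real pi * \<i> * of_real t)) = 1"
        by (simp add: norm_exp_eq_Re)
      ultimately have nw: "cmod w = \<bar>(1 - s) * r + s * (1 / r)\<bar>"
        by (simp only: norm_mult norm_of_real mult_1_right)
      have a: "(1 - s) * r + s * (1 / r) = 1 / r + (1 - s) * (r - 1 / r)"
        by (simp add: algebra_simps flip: add_divide_distrib)
      have b: "(1 - s) * r + s * (1 / r) = r - s * (r - 1 / r)"
        by (simp add: algebra_simps)
      have c: "(1 - s) * (r - 1 / r) \<ge> 0" "s * (r - 1 / r) \<ge> 0"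
        using s r0 by auto
      have "1 / r \<le> cmod w" "cmod w \<le> r"
        unfolding nw using a b c r0 by linarith+
      then show "w \<in> S" using sub by auto
    qed
  qed (auto simp: Co_def Ci_def)
  have main: "cmod (g u - ((\<Sum>k<d. \<alpha> k * u ^ k) + (\<Sum>k<d. \<beta> k * inverse u ^ Suc k))) \<le> B * (r + 1) / (r - 1) / r ^ d"
    if u: "cmod u = 1" for u
  proof -
    have u0: "u \<noteq> 0" using u by auto
    \<comment> \<open>The difference quotient with its removable singularity filled is holomorphic
      on all of \<open>S\<close>, so its integrals over the two homotopic circles agree. Since g u /
      (w - u) integrates to 2 pi i g u over the outer and to 0 over the inner circle, this is
      Cauchy's formula on the annulus.\<close>
    define h where "h w = (if w = u then deriv g u else (g w - g u) / (w - u))" for w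
    have "h holomorphic_on S"
      unfolding h_def by (rule pole_lemma_open[OF hol S])
    then have eq: "contour_integral Co h = contour_integral Ci h"
      using Cauchy_theorem_homotopic_loops[OF hom S] by auto
    have hint: "h contour_integrable_on Co" "h contour_integrable_on Ci"
      using \<open>h holomorphic_on S\<close> S ims by (auto intro: contour_integrable_holomorphic_simple)
    have neq: "w \<noteq> u" "w \<noteq> 0" if "w \<in> path_image Co \<union> path_image Ci" for w
      using that u r0 r by (auto simp: imo imi)
    have hdef: "h w = (g w - g u) / (w - u)" if "w \<in> path_image Co \<union> path_image Ci" for w
      using neq[OF that] by (simp add: h_def)
    have hdef': "h w + g u / (w - u) = g w / (w - u)" if "w \<in> path_image Co \<union> path_image Ci" for w
      unfolding hdef[OF that] by (simp flip: add_divide_distrib)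
    have o1: "((\<lambda>w. g u / (w - u)) has_contour_integral (2 * of_real pi * \<i> * g u)) Co"
      unfolding Co_def using u r by (intro Cauchy_integral_circlepath_simple[where f = "\<lambda>_. g u"]) auto
    have i1: "((\<lambda>w. g u / (w - u)) has_contour_integral 0) Ci"
      by (rule Cauchy_theorem_disc_simple[where a = 0 and e = 1])
        (use u r0 in \<open>auto simp: imi intro!: holomorphic_intros simp: Ci_def\<close>)
    have o2: "((\<lambda>w. g w / (w - u)) has_contour_integral (contour_integral Co h + 2 * of_real pi * \<i> * g u)) Co"
      by (rule has_contour_integral_eq[OF has_contour_integral_add[OF has_contour_integral_integral[OF hint(1)] o1]])
        (use hdef' in auto)
    have i2: "((\<lambda>w. g w / (w - u)) has_contour_integral (contour_integral Ci h)) Ci"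
      using has_contour_integral_eq[OF has_contour_integral_add[OF has_contour_integral_integral[OF hint(2)] i1],
          of "\<lambda>w. g w / (w - u)"] hdef' by auto
    have o3: "((\<lambda>w. \<Sum>k<d. u ^ k * (g w / w ^ Suc k)) has_contour_integral
        (\<Sum>k<d. u ^ k * contour_integral Co (\<lambda>w. g w / w ^ Suc k))) Co"
      by (intro has_contour_integral_sum has_contour_integral_lmul has_contour_integral_integral)
        (auto simp: Co_def intro!: contour_integrable_continuous_circlepath continuous_intros
           continuous_on_subset[OF cg ims(1)[unfolded Co_def]] simp: neq[unfolded Co_def] r0 simp del: power_Suc)
    have i3: "((\<lambda>w. \<Sum>k<d. inverse u ^ Suc k * (g w * w ^ k)) has_contour_integral
        (\<Sum>k<d. inverse u ^ Suc k * contour_integral Ci (\<lambda>w. g w * w ^ k))) Ci"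
      by (intro has_contour_integral_sum has_contour_integral_lmul has_contour_integral_integral)
        (auto simp: Ci_def intro!: contour_integrable_continuous_circlepath continuous_intros
           continuous_on_subset[OF cg ims(2)[unfolded Ci_def]])
    \<comment> \<open>The finite geometric series with exact remainder makes both errors explicit
      integrals, without a convergence argument.\<close>
    have geo: "1 / (1 - q) = (\<Sum>k<d. q ^ k) + q ^ d / (1 - q)" if "q \<noteq> 1" for q :: complex
      using that by (simp add: sum_gp_strict divide_simps)
    have ko: "g w / (w - u) - (\<Sum>k<d. u ^ k * (g w / w ^ Suc k)) = (u / w) ^ d * (g w / (w - u))"
      if w: "w \<in> path_image Co" for w
    proof -
      have n: "w \<noteq> u" "w \<noteq> 0" using neq w by auto
      have q: "u / w \<noteq> 1" using n by auto
      have f: "g w / (w - u) = g w / w * (1 / (1 - u / w))"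
        using n by (simp add: field_simps)
      have "g w / (w - u) = g w / w * (\<Sum>k<d. (u / w) ^ k) + g w / w * ((u / w) ^ d / (1 - u / w))"
        unfolding f geo[OF q] by (simp add: distrib_left)
      moreover have "g w / w * (\<Sum>k<d. (u / w) ^ k) = (\<Sum>k<d. u ^ k * (g w / w ^ Suc k))"
        by (simp add: sum_distrib_left power_divide field_simps)
      moreover have "g w / w * ((u / w) ^ d / (1 - u / w)) = (u / w) ^ d * (g w / (w - u))"
        unfolding f by simp
      ultimately show ?thesis by simp
    qed
    have ki: "g w / (w - u) + (\<Sum>k<d. inverse u ^ Suc k * (g w * w ^ k)) = (w / u) ^ d * (g w / (w - u))"
      if w: "w \<in> path_image Ci" for w
    proof -
      have n: "w \<noteq> u" "w \<noteq> 0" using neq w by auto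
      have q: "w / u \<noteq> 1" using n by auto
      have f: "g w / (w - u) = - g w / u * (1 / (1 - w / u))"
        using n u0 by (simp add: divide_simps) (simp add: algebra_simps)
      have "g w / (w - u) = - g w / u * (\<Sum>k<d. (w / u) ^ k) + - g w / u * ((w / u) ^ d / (1 - w / u))"
        unfolding f geo[OF q] by (simp only: distrib_left)
      moreover have "- g w / u * (\<Sum>k<d. (w / u) ^ k) = - (\<Sum>k<d. inverse u ^ Suc k * (g w * w ^ k))"
        by (simp add: sum_distrib_left power_divide power_inverse field_simps sum_negf)
      moreover have "- g w / u * ((w / u) ^ d / (1 - w / u)) = (w / u) ^ d * (g w / (w - u))"
        unfolding f by simp
      ultimately show ?thesis by simp
    qed
    define Eo where "Eo = contour_integral Co h + 2 * of_real pi * \<i> * g u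
      - (\<Sum>k<d. u ^ k * contour_integral Co (\<lambda>w. g w / w ^ Suc k))"
    define Ei where "Ei = contour_integral Ci h
      + (\<Sum>k<d. inverse u ^ Suc k * contour_integral Ci (\<lambda>w. g w * w ^ k))"
    have o4: "((\<lambda>w. (u / w) ^ d * (g w / (w - u))) has_contour_integral Eo) Co"
      unfolding Eo_def by (rule has_contour_integral_eq[OF has_contour_integral_diff[OF o2 o3] ko])
    have i4: "((\<lambda>w. (w / u) ^ d * (g w / (w - u))) has_contour_integral Ei) Ci"
      unfolding Ei_def by (rule has_contour_integral_eq[OF has_contour_integral_add[OF i2 i3] ki])
    have o5: "cmod Eo \<le> (1 / r ^ d * (B / (r - 1))) * (2 * pi * r)"
    proof (rule has_contour_integral_bound_circlepath[OF o4[unfolded Co_def]])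
      fix w assume w: "cmod (w - 0) = r"
      have "r - 1 \<le> cmod (w - u)" using w u norm_triangle_ineq2[of w u] by simp
      then have "cmod (g w / (w - u)) \<le> B / (r - 1)"
        unfolding norm_divide using w r r0 B0 by (intro frac_le bd) auto
      then show "cmod ((u / w) ^ d * (g w / (w - u))) \<le> 1 / r ^ d * (B / (r - 1))"
        using w u r by (simp only: norm_mult norm_power norm_divide power_divide power_one diff_zero div_by_1)
          (intro mult_left_mono, auto)
    qed (use B0 r in auto)
    have i5: "cmod Ei \<le> (1 / r ^ d * (B / (1 - 1 / r))) * (2 * pi * (1 / r))"
    proof (rule has_contour_integral_bound_circlepath[OF i4[unfolded Ci_def]])
      fix w assume w: "cmod (w - 0) = 1 / r"
      have "1 - 1 / r \<le> cmod (w - u)" using w u norm_triangle_ineq2[of u w] by (simp add: norm_minus_commute)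
      then have "cmod (g w / (w - u)) \<le> B / (1 - 1 / r)"
        unfolding norm_divide using w r r0 B0 by (intro frac_le bd) auto
      then show "cmod ((w / u) ^ d * (g w / (w - u))) \<le> 1 / r ^ d * (B / (1 - 1 / r))"
        using w u r by (simp only: norm_mult norm_power norm_divide power_divide power_one diff_zero div_by_1)
          (intro mult_left_mono, auto)
    qed (use B0 r r0 in auto)
    have id: "2 * of_real pi * \<i> * (g u - ((\<Sum>k<d. \<alpha> k * u ^ k) + (\<Sum>k<d. \<beta> k * inverse u ^ Suc k))) = Eo - Ei"
      unfolding Eo_def Ei_def eq \<alpha>_def \<beta>_def
      by (simp add: algebra_simps sum_distrib_left del: power_Suc)
    have "2 * pi * cmod (g u - ((\<Sum>k<d. \<alpha> k * u ^ k) + (\<Sum>k<d. \<beta> k * inverse u ^ Suc k))) = cmod (Eo - Ei)"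
      unfolding id[symmetric] by (simp add: norm_mult)
    also have "\<dots> \<le> (1 / r ^ d * (B / (r - 1))) * (2 * pi * r) + (1 / r ^ d * (B / (1 - 1 / r))) * (2 * pi * (1 / r))"
      using o5 i5 norm_triangle_ineq4[of Eo Ei] by linarith
    also have "\<dots> = 2 * pi * (B * (r + 1) / (r - 1) / r ^ d)"
      using r r0 by (simp add: divide_simps) (simp add: algebra_simps)
    finally show ?thesis by (rule mult_left_le_imp_le) simp
  qed
  show ?thesis by (rule that[OF main])
qed

text \<open>The Joukowski map \<open>J\<close> carries the annulus into the ellipse and satisfies J
  w = J (1 / w). Averaging the Laurent approximation at u = cis \<theta> and at its inverse turns u
  ^ k into cos (k \<theta>) at the same error.\<close>

lemma bernstein_ellipse_approx:
  fixes f :: "complex \<Rightarrow> complex"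
  assumes r: "r > 1" and U: "open U" and hol: "f holomorphic_on U" and sub: "bernstein_ellipse r \<subseteq> U"
    and bd: "\<And>z. z \<in> bernstein_ellipse r \<Longrightarrow> cmod (f z) \<le> B"
  obtains a where "\<And>\<theta>. cmod (f (of_real (cos \<theta>)) - (\<Sum>k<Suc d. a k * of_real (cos (real k * \<theta>))))
     \<le> B * (r + 1) / (r - 1) / r ^ d"
proof -
  define J where "J w = (w + inverse w) / 2" for w :: complex
  define S where "S = {w \<in> - {0}. J w \<in> U}"
  have cJ: "continuous_on (- {0}) J"
    unfolding J_def by (intro continuous_intros) auto
  have oS: "open S"
    unfolding S_def using continuous_open_preimage[OF cJ _ U]
    by (simp add: vimage_def Int_def open_Compl)
  have JE: "J w \<in> bernstein_ellipse r" if "1 / r \<le> cmod w" "cmod w \<le> r" for w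
  proof (cases "1 \<le> cmod w")
    case True
    then show ?thesis unfolding J_def bernstein_ellipse_def using that by auto
  next
    case False
    have w0: "cmod w > 0" using that r by (metis divide_pos_pos less_le_trans less_trans zero_less_one)
    have "1 \<le> cmod (inverse w)"
      using False w0 by (simp add: norm_inverse one_le_inverse_iff)
    moreover have "cmod (inverse w) \<le> r"
      using le_imp_inverse_le[OF that(1)] r by (simp add: norm_inverse)
    ultimately show ?thesis unfolding J_def bernstein_ellipse_def
      by (smt (verit) add.commute inverse_inverse_eq mem_Collect_eq)
  qed
  have hg: "(f \<circ> J) holomorphic_on S"
  proof (rule holomorphic_on_compose_gen[OF _ hol])
    show "J holomorphic_on S"
      unfolding J_def S_def by (intro holomorphic_intros) auto
  qed (auto simp: S_def)
  have "1 / r > 0" using r by auto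
  then have sub': "{w. 1 / r \<le> cmod w \<and> cmod w \<le> r} \<subseteq> S"
    using JE sub by (auto simp: S_def)
  obtain \<alpha> \<beta> where ab: "\<And>u. cmod u = 1 \<Longrightarrow>
    cmod ((f \<circ> J) u - ((\<Sum>k<d. \<alpha> k * u ^ k) + (\<Sum>k<d. \<beta> k * inverse u ^ Suc k))) \<le> B * (r + 1) / (r - 1) / r ^ d"
    by (rule annulus_laurent_approx[OF r oS hg sub', where B = B and d = d]) (use bd JE in auto)
  \<comment> \<open>\<open>\<beta> k\<close> belongs to the power - (k + 1), hence the shift. Only
    these coefficients reach frequency \<open>d\<close>, which is why there are \<open>Suc d\<close>
    terms.\<close>
  define a where "a k = (if k < d then \<alpha> k else 0) + (if k = 0 then 0 else \<beta> (k - 1))" for k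
  have "cmod (f (of_real (cos \<theta>)) - (\<Sum>k<Suc d. a k * of_real (cos (real k * \<theta>)))) \<le> B * (r + 1) / (r - 1) / r ^ d" for \<theta>
  proof -
    define D where "D u = f (J u) - ((\<Sum>k<d. \<alpha> k * u ^ k) + (\<Sum>k<d. \<beta> k * inverse u ^ Suc k))" for u
    have pw: "cis \<theta> ^ k + inverse (cis \<theta>) ^ k = 2 * of_real (cos (real k * \<theta>))" for k
      by (simp add: complex_eq_iff flip: cos_n_Re_cis_pow_n sin_n_Im_cis_pow_n)
    have J1: "J (cis \<theta>) = of_real (cos \<theta>)" "J (inverse (cis \<theta>)) = of_real (cos \<theta>)"
      using pw[of 1] by (auto simp: J_def add.commute)
    have s: "(\<Sum>k<Suc d. a k * of_real (cos (real k * \<theta>))) =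
      (\<Sum>k<d. \<alpha> k * of_real (cos (real k * \<theta>))) + (\<Sum>k<d. \<beta> k * of_real (cos (real (Suc k) * \<theta>)))"
    proof -
      have "(\<Sum>k<Suc d. a k * of_real (cos (real k * \<theta>))) =
         (\<Sum>k<Suc d. (if k < d then \<alpha> k else 0) * of_real (cos (real k * \<theta>)))
         + (\<Sum>k<Suc d. (if k = 0 then 0 else \<beta> (k - 1)) * of_real (cos (real k * \<theta>)))"
        unfolding a_def by (simp only: distrib_right sum.distrib)
      also have "(\<Sum>k<Suc d. (if k < d then \<alpha> k else 0) * of_real (cos (real k * \<theta>))) = (\<Sum>k<d. \<alpha> k * of_real (cos (real k * \<theta>)))"
        by simp
      also have "(\<Sum>k<Suc d. (if k = 0 then 0 else \<beta> (k - 1)) * of_real (cos (real k * \<theta>))) = (\<Sum>k<d. \<beta> k * of_real (cos (real (Suc k) * \<theta>)))"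
        by (subst sum.lessThan_Suc_shift) simp
      finally show ?thesis .
    qed
    have "D (cis \<theta>) + D (inverse (cis \<theta>)) = 2 * f (of_real (cos \<theta>))
       - ((\<Sum>k<d. \<alpha> k * (cis \<theta> ^ k + inverse (cis \<theta>) ^ k)) + (\<Sum>k<d. \<beta> k * (cis \<theta> ^ Suc k + inverse (cis \<theta>) ^ Suc k)))"
      unfolding D_def J1 inverse_inverse_eq by (simp add: distrib_left sum.distrib algebra_simps del: power_Suc)
    also have "\<dots> = 2 * (f (of_real (cos \<theta>)) - (\<Sum>k<Suc d. a k * of_real (cos (real k * \<theta>))))"
      unfolding pw s by (simp only: right_diff_distrib distrib_left sum_distrib_left mult.left_commute)
    finally have e: "2 * (f (of_real (cos \<theta>)) - (\<Sum>k<Suc d. a k * of_real (cos (real k * \<theta>)))) = D (cis \<theta>) + D (inverse (cis \<theta>))" ..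
    have "2 * cmod (f (of_real (cos \<theta>)) - (\<Sum>k<Suc d. a k * of_real (cos (real k * \<theta>)))) = cmod (D (cis \<theta>) + D (inverse (cis \<theta>)))"
      unfolding e[symmetric] by (simp only: norm_mult) simp
    also have "\<dots> \<le> cmod (D (cis \<theta>)) + cmod (D (inverse (cis \<theta>)))" by (rule norm_triangle_ineq)
    also have "\<dots> \<le> B * (r + 1) / (r - 1) / r ^ d + B * (r + 1) / (r - 1) / r ^ d"
      using ab[of "cis \<theta>"] ab[of "inverse (cis \<theta>)"] unfolding D_def o_def
      by (intro add_mono) (auto simp: norm_inverse)
    finally show ?thesis by simp
  qed
  then show ?thesis by (rule that)
qed

section \<open>Chebyshev nodes and graded polynomial families\<close>

lemma smult_sum_right: "smult c (\<Sum>i\<in>A. f i) = (\<Sum>i\<in>A. smult c (f i))"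
  by (induction A rule: infinite_finite_induct) (auto simp: smult_add_right)

lemma poly_chebyshev_cos: "poly (chebyshev_poly j) (cos \<theta>) = cos (real j * \<theta>)"
proof (induction j rule: chebyshev_poly.induct)
  case (3 j)
  have "cos (real (Suc (Suc j)) * \<theta>) + cos (real j * \<theta>) = 2 * cos \<theta> * cos (real (Suc j) * \<theta>)"
    using cos_times_cos[of "real (Suc j) * \<theta>" \<theta>] by (simp add: algebra_simps)
  then show ?case using 3 by simp
qed auto

lemma degree_chebyshev: "degree (chebyshev_poly j) = j" "chebyshev_poly j \<noteq> 0"
proof -
  have "degree (chebyshev_poly j) = j \<and> chebyshev_poly j \<noteq> 0"
  proof (induction j rule: chebyshev_poly.induct)
    case (3 j)
    have d: "degree ([:0, 2:] * chebyshev_poly (Suc j)) = Suc (Suc j)"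
      using 3 by (subst degree_mult_eq) auto
    then have "degree ([:0, 2:] * chebyshev_poly (Suc j) - chebyshev_poly j) = Suc (Suc j)"
      using 3 degree_add_eq_left[of "- chebyshev_poly j" "[:0, 2:] * chebyshev_poly (Suc j)"] by simp
    then show ?case
      by (simp only: chebyshev_poly.simps) (metis degree_0 nat.distinct(1))
  qed auto
  then show "degree (chebyshev_poly j) = j" "chebyshev_poly j \<noteq> 0" by auto
qed

lemma degree_legendre: "degree (legendre_poly j) = j" "legendre_poly j \<noteq> 0"
proof -
  have it: "degree ((pderiv ^^ k) p) = degree p - k" for k and p :: "real poly"
    by (induction k) (auto simp: degree_pderiv)
  have "degree ([:-1, 0, 1:] ^ j :: real poly) = 2 * j"
    by (subst degree_power_eq) auto
  then show d: "degree (legendre_poly j) = j"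
    unfolding legendre_poly_def by (simp add: it)
  show "legendre_poly j \<noteq> 0"
  proof (cases "j = 0")
    case True
    then show ?thesis by (simp add: legendre_poly_def)
  next
    case False
    then show ?thesis using d by force
  qed
qed

lemma abs_sin_multiple_le: "\<bar>sin (real k * a)\<bar> \<le> real k * \<bar>sin a\<bar>"
proof (induction k)
  case (Suc k)
  have "\<bar>sin (real (Suc k) * a)\<bar> = \<bar>sin a * cos (real k * a) + cos a * sin (real k * a)\<bar>"
    by (simp add: distrib_right sin_add)
  also have "\<dots> \<le> \<bar>sin a\<bar> * \<bar>cos (real k * a)\<bar> + \<bar>cos a\<bar> * \<bar>sin (real k * a)\<bar>"
    by (metis abs_mult abs_triangle_ineq)
  also have "\<dots> \<le> \<bar>sin a\<bar> * 1 + 1 * \<bar>sin (real k * a)\<bar>"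
    by (intro add_mono mult_left_mono mult_right_mono) auto
  finally show ?case using Suc by (simp add: algebra_simps)
qed auto

text \<open>A difference of cosines is a product of two sines, and each of them loses a factor
  \<open>k\<close>. In the variable cos a this is Markov's inequality for Chebyshev polynomials in
  Lipschitz form.\<close>

lemma cos_multiple_lipschitz: "\<bar>cos (real k * a) - cos (real k * b)\<bar> \<le> (real k)\<^sup>2 * \<bar>cos a - cos b\<bar>"
proof -
  have e: "\<bar>cos x - cos y\<bar> = 2 * \<bar>sin ((x + y) / 2)\<bar> * \<bar>sin ((y - x) / 2)\<bar>" for x y :: real
    unfolding cos_diff_cos by (simp add: abs_mult)
  have "\<bar>cos (real k * a) - cos (real k * b)\<bar> = 2 * \<bar>sin (real k * ((a + b) / 2))\<bar> * \<bar>sin (real k * ((b - a) / 2))\<bar>"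
    unfolding e by (simp add: algebra_simps)
  also have "\<dots> \<le> 2 * (real k * \<bar>sin ((a + b) / 2)\<bar>) * (real k * \<bar>sin ((b - a) / 2)\<bar>)"
    by (intro mult_mono abs_sin_multiple_le) auto
  also have "\<dots> = (real k)\<^sup>2 * \<bar>cos a - cos b\<bar>"
    unfolding e by (simp add: power2_eq_square)
  finally show ?thesis .
qed

section \<open>Chebyshev nodes and their interpolation kernels\<close>

text \<open>The cosines of these angles for j < d are the zeros of the Chebyshev polynomial of
  degree \<open>d\<close>.\<close>

definition cheb_angle :: "nat \<Rightarrow> nat \<Rightarrow> real" where
  "cheb_angle d j = (2 * real j + 1) * pi / (2 * real d)"

definition cheb_node :: "nat \<Rightarrow> nat \<Rightarrow> real" where
  "cheb_node d j = cos (cheb_angle d j)"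

text \<open>The Lagrange basis polynomial of node \<open>j\<close>, written in Chebyshev polynomials
  by means of their discrete orthogonality at the nodes. In this form its size and its Lipschitz
  constant can be bounded term by term.\<close>

definition cheb_kernel :: "nat \<Rightarrow> nat \<Rightarrow> real poly" where
  "cheb_kernel d j = (\<Sum>i<d. smult ((if i = 0 then 1 else 2) * cos (real i * cheb_angle d j) / real d) (chebyshev_poly i))"

lemma cheb_node_bounds: "-1 \<le> cheb_node d j" "cheb_node d j \<le> 1"
  by (auto simp: cheb_node_def)

text \<open>The angles are odd multiples of one number \<open>b\<close>, so multiplication by 2 sin
  b makes the sum telescope to sin (2 d b) = sin (k pi) = 0. The bounds on \<open>k\<close> keep sin
  b positive.\<close>

lemma sum_cos_cheb_angle:
  assumes "0 < k" "k < 2 * d"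
  shows "(\<Sum>j<d. cos (real k * cheb_angle d j)) = 0"
proof -
  define b where "b = real k * pi / (2 * real d)"
  have d0: "d > 0" using assms by auto
  have "0 < b" "b < pi"
    using assms d0 by (auto simp: b_def field_simps)
  then have sb: "sin b > 0" by (rule sin_gt_zero)
  have "2 * sin b * (\<Sum>j<d. cos (real k * cheb_angle d j)) = (\<Sum>j<d. sin (real (Suc j) * (2 * b)) - sin (real j * (2 * b)))"
    unfolding sum_distrib_left
  proof (intro sum.cong refl)
    fix j
    have "real k * cheb_angle d j = (2 * real j + 1) * b" by (simp add: cheb_angle_def b_def)
    moreover have "sin (real (Suc j) * (2 * b)) - sin (real j * (2 * b)) = 2 * sin b * cos ((2 * real j + 1) * b)"
      unfolding sin_diff_sin by (simp add: algebra_simps add_divide_distrib)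
    ultimately show "2 * sin b * cos (real k * cheb_angle d j) = sin (real (Suc j) * (2 * b)) - sin (real j * (2 * b))"
      by simp
  qed
  also have "\<dots> = sin (real d * (2 * b)) - sin (real 0 * (2 * b))"
    by (rule sum_lessThan_telescope)
  also have "real d * (2 * b) = real k * pi" using d0 by (simp add: b_def)
  finally show ?thesis using sb by (simp add: sin_npi)
qed

lemma cheb_discrete_orthogonality:
  assumes "m < d" "i < d"
  shows "(\<Sum>j<d. cos (real m * cheb_angle d j) * cos (real i * cheb_angle d j))
    = (if i = m then (if i = 0 then real d else real d / 2) else 0)"
proof -
  \<comment> \<open>With truncated subtraction, \<open>m - i + (i - m)\<close> is the absolute
    difference of the indices.\<close>
  have *: "cos (real m * t) * cos (real i * t) = (cos (real (m - i + (i - m)) * t) + cos (real (m + i) * t)) / 2" for t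
  proof (cases "m \<ge> i")
    case True
    then have "cos (real (m - i + (i - m)) * t) = cos (real m * t - real i * t)"
      by (simp add: of_nat_diff algebra_simps)
    then show ?thesis unfolding cos_times_cos by (simp add: distrib_right)
  next
    case False
    then have "cos (real (m - i + (i - m)) * t) = cos (real m * t - real i * t)"
      by (subst cos_minus[symmetric]) (simp add: of_nat_diff algebra_simps)
    then show ?thesis unfolding cos_times_cos by (simp add: distrib_right)
  qed
  have 1: "(\<Sum>j<d. cos (real m * cheb_angle d j) * cos (real i * cheb_angle d j)) =
     ((\<Sum>j<d. cos (real (m - i + (i - m)) * cheb_angle d j)) + (\<Sum>j<d. cos (real (m + i) * cheb_angle d j))) / 2"
    unfolding * by (simp add: sum.distrib flip: sum_divide_distrib)
  show ?thesis
  proof (cases "i = m")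
    case True
    show ?thesis
    proof (cases "i = 0")
      case False
      then have "(\<Sum>j<d. cos (real (m + i) * cheb_angle d j)) = 0"
        using assms by (intro sum_cos_cheb_angle) auto
      then show ?thesis unfolding 1 using True False by simp
    qed (use True in simp)
  next
    case False
    have "(\<Sum>j<d. cos (real (m + i) * cheb_angle d j)) = 0"
      using assms False by (intro sum_cos_cheb_angle) auto
    moreover have "(\<Sum>j<d. cos (real (m - i + (i - m)) * cheb_angle d j)) = 0"
      using assms False by (intro sum_cos_cheb_angle) auto
    ultimately show ?thesis unfolding 1 using False by simp
  qed
qed

text \<open>After exchanging the sums, orthogonality leaves only i = m, and the weights 1 and 2 in
  the kernel cancel the squared norms d and d / 2.\<close>

lemma cheb_kernel_reproduces_chebyshev:
  assumes m: "m < d"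
  shows "(\<Sum>j<d. smult (poly (chebyshev_poly m) (cheb_node d j)) (cheb_kernel d j)) = chebyshev_poly m"
proof -
  have "(\<Sum>j<d. smult (poly (chebyshev_poly m) (cheb_node d j)) (cheb_kernel d j))
    = (\<Sum>i<d. smult ((if i = 0 then 1 else 2) / real d * (\<Sum>j<d. cos (real m * cheb_angle d j) * cos (real i * cheb_angle d j))) (chebyshev_poly i))"
    unfolding cheb_kernel_def cheb_node_def poly_chebyshev_cos smult_sum_right smult_sum sum_distrib_left
    by (subst sum.swap) (simp add: mult_ac)
  also have "\<dots> = (\<Sum>i<d. if i = m then chebyshev_poly m else 0)"
    using m by (intro sum.cong refl) (simp add: cheb_discrete_orthogonality)
  also have "\<dots> = chebyshev_poly m" using m by simp
  finally show ?thesis .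
qed

text \<open>Each of the \<open>d\<close> terms is at most 2 / d. Interpolation thus has supremum
  norm at most 2 d; using this in place of the logarithmic Lebesgue constant costs only powers of
  \<open>d\<close>.\<close>

lemma cheb_kernel_bound:
  assumes "-1 \<le> x" "x \<le> 1"
  shows "\<bar>poly (cheb_kernel d j) x\<bar> \<le> 2"
proof (cases "d = 0")
  case False
  obtain \<phi> where x: "x = cos \<phi>" using assms by (metis cos_arccos)
  have "\<bar>poly (cheb_kernel d j) x\<bar> \<le> (\<Sum>i<d. \<bar>(if i = 0 then 1 else 2) * cos (real i * cheb_angle d j) / real d * cos (real i * \<phi>)\<bar>)"
    unfolding cheb_kernel_def x poly_sum poly_smult poly_chebyshev_cos by (rule sum_abs)
  also have "\<dots> \<le> (\<Sum>i<d. 2 / real d)"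
  proof (intro sum_mono)
    fix i
    have "\<bar>(if i = 0 then 1 else 2) * cos (real i * cheb_angle d j) / real d * cos (real i * \<phi>)\<bar>
      = (if i = 0 then 1 else 2) * \<bar>cos (real i * cheb_angle d j)\<bar> / real d * \<bar>cos (real i * \<phi>)\<bar>"
      by (simp add: abs_mult)
    also have "\<dots> \<le> 2 * 1 / real d * 1"
      by (intro mult_mono divide_right_mono) auto
    finally show "\<bar>(if i = 0 then 1 else 2) * cos (real i * cheb_angle d j) / real d * cos (real i * \<phi>)\<bar> \<le> 2 / real d" by simp
  qed
  finally show ?thesis using False by simp
qed (simp add: cheb_kernel_def)

lemma cheb_kernel_lipschitz:
  assumes "-1 \<le> x" "x \<le> 1" "-1 \<le> y" "y \<le> 1"
  shows "\<bar>poly (cheb_kernel d j) x - poly (cheb_kernel d j) y\<bar> \<le> 2 * (real d)\<^sup>2 * \<bar>x - y\<bar>"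
proof (cases "d = 0")
  case False
  obtain \<phi> where x: "x = cos \<phi>" using assms by (metis cos_arccos)
  obtain \<psi> where y: "y = cos \<psi>" using assms by (metis cos_arccos)
  have "\<bar>poly (cheb_kernel d j) x - poly (cheb_kernel d j) y\<bar>
     \<le> (\<Sum>i<d. \<bar>(if i = 0 then 1 else 2) * cos (real i * cheb_angle d j) / real d * (cos (real i * \<phi>) - cos (real i * \<psi>))\<bar>)"
    unfolding cheb_kernel_def x y poly_sum poly_smult poly_chebyshev_cos sum_subtractf[symmetric] right_diff_distrib[symmetric]
    by (rule sum_abs)
  also have "\<dots> \<le> (\<Sum>i<d. 2 / real d * ((real d)\<^sup>2 * \<bar>x - y\<bar>))"
  proof (intro sum_mono)
    fix i assume i: "i \<in> {..<d}"
    have "\<bar>(if i = 0 then 1 else 2) * cos (real i * cheb_angle d j) / real d * (cos (real i * \<phi>) - cos (real i * \<psi>))\<bar>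
      = (if i = 0 then 1 else 2) * \<bar>cos (real i * cheb_angle d j)\<bar> / real d * \<bar>cos (real i * \<phi>) - cos (real i * \<psi>)\<bar>"
      by (simp add: abs_mult)
    also have "\<dots> \<le> 2 * 1 / real d * ((real d)\<^sup>2 * \<bar>x - y\<bar>)"
    proof (intro mult_mono divide_right_mono)
      have "\<bar>cos (real i * \<phi>) - cos (real i * \<psi>)\<bar> \<le> (real i)\<^sup>2 * \<bar>x - y\<bar>"
        unfolding x y by (rule cos_multiple_lipschitz)
      also have "\<dots> \<le> (real d)\<^sup>2 * \<bar>x - y\<bar>"
        using i by (intro mult_right_mono power_mono) auto
      finally show "\<bar>cos (real i * \<phi>) - cos (real i * \<psi>)\<bar> \<le> (real d)\<^sup>2 * \<bar>x - y\<bar>" .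
    qed auto
    finally show "\<bar>(if i = 0 then 1 else 2) * cos (real i * cheb_angle d j) / real d * (cos (real i * \<phi>) - cos (real i * \<psi>))\<bar>
       \<le> 2 / real d * ((real d)\<^sup>2 * \<bar>x - y\<bar>)" by simp
  qed
  finally show ?thesis using False by simp
qed (simp add: cheb_kernel_def)

section \<open>Polynomial families with one member of each degree\<close>

text \<open>The interface through which the Legendre and the Chebyshev family enter. The first
  \<open>d\<close> members of either span the same polynomials, so estimates obtained from Chebyshev
  kernels hold for both dictionaries.\<close>

locale graded_polys =
  fixes P :: "nat \<Rightarrow> real poly"
  assumes degree_P: "degree (P j) = j" and P_nonzero: "P j \<noteq> 0"
begin

text \<open>Subtracting a multiple of \<open>P d\<close> removes the top coefficient. The hypothesis
  speaks of coefficients instead of the degree so that d = 0, which forces p = 0, can start the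
  induction.\<close>

lemma poly_expansion:
  assumes "\<And>i. i \<ge> d \<Longrightarrow> coeff p i = 0"
  shows "\<exists>a. p = (\<Sum>k<d. smult (a k) (P k))"
  using assms
proof (induction d arbitrary: p)
  case 0
  then show ?case by (auto simp: poly_eq_iff)
next
  case (Suc d)
  define c where "c = coeff p d / coeff (P d) d"
  have nz: "coeff (P d) d \<noteq> 0"
    using P_nonzero[of d] degree_P[of d] by (metis leading_coeff_0_iff)
  have "coeff (p - smult c (P d)) i = 0" if "i \<ge> d" for i
  proof (cases "i = d")
    case True
    then show ?thesis using nz by (simp add: c_def)
  next
    case False
    then have "coeff (P d) i = 0" using that degree_P[of d] by (intro coeff_eq_0) auto
    then show ?thesis using Suc.prems[of i] that False by simp
  qed
  from Suc.IH[OF this] obtain a where "p - smult c (P d) = (\<Sum>k<d. smult (a k) (P k))" by auto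
  then have "p = (\<Sum>k<Suc d. smult ((a(d := c)) k) (P k))"
    by (simp add: algebra_simps)
  then show ?case by blast
qed

lemma poly_expansion_unique:
  assumes "(\<Sum>k<d. smult (a k) (P k)) = (\<Sum>k<d. smult (b k) (P k))" "k < d"
  shows "a k = b k"
  using assms
proof (induction d arbitrary: k)
  case (Suc d)
  have nz: "coeff (P d) d \<noteq> 0"
    using P_nonzero[of d] degree_P[of d] by (metis leading_coeff_0_iff)
  have z: "coeff (P i) d = 0" if "i < d" for i
    using that degree_P[of i] by (intro coeff_eq_0) auto
  have "coeff (\<Sum>k<Suc d. smult (a k) (P k)) d = coeff (\<Sum>k<Suc d. smult (b k) (P k)) d"
    using Suc.prems(1) by simp
  then have ad: "a d = b d" using nz z by (simp add: coeff_sum)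
  then show ?case using Suc.IH[of k] Suc.prems by (cases "k = d") auto
qed simp

end

interpretation cheb: graded_polys chebyshev_poly
  by unfold_locales (rule degree_chebyshev)+

interpretation legendre: graded_polys legendre_poly
  by unfold_locales (rule degree_legendre)+

lemma (in graded_polys) cheb_kernel_reproduces:
  assumes i: "i < d"
  shows "(\<Sum>j<d. smult (poly (P i) (cheb_node d j)) (cheb_kernel d j)) = P i"
proof -
  obtain a where a: "P i = (\<Sum>k<d. smult (a k) (chebyshev_poly k))"
    using cheb.poly_expansion[of d "P i"] i degree_P[of i] by (metis coeff_eq_0 order_less_le_trans)
  have "(\<Sum>j<d. smult (poly (P i) (cheb_node d j)) (cheb_kernel d j))
     = (\<Sum>k<d. smult (a k) (\<Sum>j<d. smult (poly (chebyshev_poly k) (cheb_node d j)) (cheb_kernel d j)))"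
    unfolding a poly_sum poly_smult smult_sum smult_sum_right by (subst sum.swap) (simp add: mult_ac)
  also have "\<dots> = (\<Sum>k<d. smult (a k) (chebyshev_poly k))"
    by (intro sum.cong refl) (simp add: cheb_kernel_reproduces_chebyshev)
  finally show ?thesis using a by simp
qed

text \<open>The same numbers have two roles: they expand the kernels in the family, and summed
  against values at the nodes they extract the k-th coefficient. The second role follows by
  expanding the reproduction identity for \<open>P i\<close> and comparing coefficients. The first
  gives membership in the span of the dictionary, the second its linear independence.\<close>

lemma (in graded_polys) dual_coefficients:
  obtains b where "\<And>j. cheb_kernel d j = (\<Sum>k<d. smult (b k j) (P k))"
    and "\<And>i k. i < d \<Longrightarrow> k < d \<Longrightarrow> (\<Sum>j<d. b k j * poly (P i) (cheb_node d j)) = of_bool (i = k)"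
proof -
  have "\<exists>a. cheb_kernel d j = (\<Sum>k<d. smult (a k) (P k))" for j
    by (rule poly_expansion) (auto simp: cheb_kernel_def coeff_sum degree_chebyshev intro!: sum.neutral coeff_eq_0)
  then obtain b where b: "cheb_kernel d j = (\<Sum>k<d. smult (b j k) (P k))" for j
    by metis
  have "(\<Sum>j<d. b j k * poly (P i) (cheb_node d j)) = of_bool (i = k)" if ik: "i < d" "k < d" for i k
  proof -
    have "(\<Sum>k<d. smult (\<Sum>j<d. b j k * poly (P i) (cheb_node d j)) (P k)) =
       (\<Sum>j<d. smult (poly (P i) (cheb_node d j)) (cheb_kernel d j))"
      unfolding b smult_sum smult_sum_right by (subst sum.swap) (simp add: mult_ac)
    also have "\<dots> = P i" by (rule cheb_kernel_reproduces[OF ik(1)])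
    also have "\<dots> = (\<Sum>k<d. smult (of_bool (i = k)) (P k))"
    proof -
      have "(\<Sum>k<d. smult (of_bool (i = k)) (P k)) = (\<Sum>k<d. if i = k then P k else 0)"
        by (intro sum.cong) auto
      then show ?thesis using ik by simp
    qed
    finally show ?thesis by (rule poly_expansion_unique[OF _ ik(2)])
  qed
  then show ?thesis using b by (intro that[of "\<lambda>k j. b j k"]) auto
qed

section \<open>Tensorised Chebyshev interpolation\<close>

text \<open>Interpolation reproduces the approximant \<open>q\<close>, so it acts on g - q only, and
  the error \<open>e\<close> is amplified by at most 1 plus the operator norm 2 d.\<close>

lemma cheb_interpolation_error:
  fixes g :: "real \<Rightarrow> complex"
  assumes a: "\<And>\<theta>. cmod (g (cos \<theta>) - (\<Sum>k<d. a k * of_real (cos (real k * \<theta>)))) \<le> e"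
    and x: "-1 \<le> x" "x \<le> 1"
  shows "cmod (g x - (\<Sum>j<d. of_real (poly (cheb_kernel d j) x) * g (cheb_node d j))) \<le> (1 + 2 * real d) * e"
proof -
  define q where "q s = (\<Sum>k<d. a k * of_real (poly (chebyshev_poly k) s))" for s
  have aq: "cmod (g s - q s) \<le> e" if "-1 \<le> s" "s \<le> 1" for s
    using a[of "arccos s"] that unfolding q_def
    by (simp flip: poly_chebyshev_cos)
  have e0: "e \<ge> 0" using a[of 0] norm_ge_zero order_trans by blast
  have "(\<Sum>j<d. of_real (poly (cheb_kernel d j) x) * q (cheb_node d j))
     = (\<Sum>k<d. a k * of_real (poly (\<Sum>j<d. smult (poly (chebyshev_poly k) (cheb_node d j)) (cheb_kernel d j)) x))"
    unfolding q_def poly_sum poly_smult sum_distrib_left of_real_sum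
    by (subst sum.swap) (simp add: mult_ac)
  also have "\<dots> = q x"
    unfolding q_def by (intro sum.cong refl) (simp add: cheb_kernel_reproduces_chebyshev)
  finally have "g x - (\<Sum>j<d. of_real (poly (cheb_kernel d j) x) * g (cheb_node d j))
     = (g x - q x) - (\<Sum>j<d. of_real (poly (cheb_kernel d j) x) * (g (cheb_node d j) - q (cheb_node d j)))"
    by (simp add: right_diff_distrib sum_subtractf)
  also have "cmod \<dots> \<le> cmod (g x - q x) + cmod (\<Sum>j<d. of_real (poly (cheb_kernel d j) x) * (g (cheb_node d j) - q (cheb_node d j)))"
    by (rule norm_triangle_ineq4)
  also have "\<dots> \<le> e + (\<Sum>j<d. 2 * e)"
  proof (intro add_mono aq x sum_norm_le)
    fix j
    show "cmod (of_real (poly (cheb_kernel d j) x) * (g (cheb_node d j) - q (cheb_node d j))) \<le> 2 * e"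
      unfolding norm_mult norm_of_real
      by (intro mult_mono cheb_kernel_bound x aq cheb_node_bounds) auto
  qed
  finally show ?thesis by (simp add: algebra_simps)
qed

definition grid :: "nat \<Rightarrow> (nat ^ 'N) set" where
  "grid d = {\<nu>. \<forall>k. \<nu> $ k < d}"

lemma grid_eq_image: "grid d = vec_lambda ` (PiE UNIV (\<lambda>_. {..<d}))"
proof -
  have "\<nu> \<in> vec_lambda ` (PiE UNIV (\<lambda>_. {..<d}))" if "\<nu> \<in> grid d" for \<nu> :: "nat ^ 'a"
    using that by (intro image_eqI[of _ _ "vec_nth \<nu>"]) (auto simp: grid_def)
  then show ?thesis by (auto simp: grid_def)
qed

lemma inj_vec_lambda: "inj_on vec_lambda A"
  by (simp add: inj_on_def vec_lambda_inject)

lemma finite_grid: "finite (grid d)"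
  unfolding grid_eq_image by (intro finite_imageI finite_PiE) auto

lemma card_grid: "card (grid d :: (nat ^ 'N) set) = d ^ CARD('N)"
  unfolding grid_eq_image by (simp add: card_image inj_vec_lambda card_PiE)

lemma sum_grid_prod:
  fixes f :: "'N::finite \<Rightarrow> nat \<Rightarrow> 'c :: comm_semiring_1"
  shows "(\<Sum>\<nu>\<in>grid d. \<Prod>k\<in>UNIV. f k (\<nu> $ k)) = (\<Prod>k\<in>UNIV. \<Sum>i<d. f k i)"
  unfolding grid_eq_image by (subst prod_sum_PiE) (auto simp: sum.reindex inj_vec_lambda)

definition vec_upd :: "'a ^ 'N \<Rightarrow> 'N \<Rightarrow> 'a \<Rightarrow> 'a ^ 'N" where
  "vec_upd x k s = (\<chi> i. if i = k then s else x $ i)"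

lemma vec_upd_nth: "vec_upd x k s $ i = (if i = k then s else x $ i)"
  by (simp add: vec_upd_def)

lemma vec_upd_same: "vec_upd x k (x $ k) = x"
  by (simp add: vec_upd_def vec_eq_iff)

lemma vec_upd_cube: "x \<in> cube \<Longrightarrow> -1 \<le> s \<Longrightarrow> s \<le> 1 \<Longrightarrow> vec_upd x k s \<in> cube"
  by (auto simp: cube_def vec_upd_def)

text \<open>Interpolation in coordinate \<open>k\<close> alone, with the other coordinates frozen.
  Tensorised interpolation is the composition of these operators along a list of all coordinates,
  which permits induction on the list.\<close>

definition cheb_op :: "nat \<Rightarrow> 'N \<Rightarrow> (real ^ 'N \<Rightarrow> complex) \<Rightarrow> real ^ 'N \<Rightarrow> complex" where
  "cheb_op d k G x = (\<Sum>j<d. of_real (poly (cheb_kernel d j) (x $ k)) * G (vec_upd x k (cheb_node d j)))"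

primrec cheb_ops :: "nat \<Rightarrow> 'N list \<Rightarrow> (real ^ 'N \<Rightarrow> complex) \<Rightarrow> real ^ 'N \<Rightarrow> complex" where
  "cheb_ops d [] G = G"
| "cheb_ops d (k # ks) G = cheb_op d k (cheb_ops d ks G)"

lemma cheb_op_bound:
  assumes "\<And>y. y \<in> cube \<Longrightarrow> cmod (G y) \<le> B" "x \<in> cube"
  shows "cmod (cheb_op d k G x) \<le> 2 * real d * B"
proof -
  have "cmod (cheb_op d k G x) \<le> (\<Sum>j<d. 2 * B)"
    unfolding cheb_op_def
  proof (intro sum_norm_le)
    fix j
    show "cmod (of_real (poly (cheb_kernel d j) (x $ k)) * G (vec_upd x k (cheb_node d j))) \<le> 2 * B"
      unfolding norm_mult norm_of_real using assms(2)
      by (intro mult_mono cheb_kernel_bound assms(1) vec_upd_cube cheb_node_bounds) (auto simp: cube_def)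
  qed
  then show ?thesis by simp
qed

text \<open>With A the composition along \<open>ks\<close> and A_k the new operator, G - A_k A G =
  (G - A_k G) + A_k (G - A G), where A_k has norm at most 2 d. Hence only one-variable interpolation
  errors of \<open>G\<close> itself enter.\<close>

lemma cheb_ops_error:
  assumes \<eta>: "\<And>x k. x \<in> cube \<Longrightarrow> cmod (G x - cheb_op d k G x) \<le> \<eta>" and x: "x \<in> cube"
  shows "cmod (G x - cheb_ops d ks G x) \<le> \<eta> * (\<Sum>i<length ks. (2 * real d) ^ i)"
  using x
proof (induction ks arbitrary: x)
  case (Cons k ks)
  have "G x - cheb_ops d (k # ks) G x = (G x - cheb_op d k G x) + cheb_op d k (\<lambda>y. G y - cheb_ops d ks G y) x"
    by (simp add: cheb_op_def right_diff_distrib sum_subtractf)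
  also have "cmod \<dots> \<le> \<eta> + 2 * real d * (\<eta> * (\<Sum>i<length ks. (2 * real d) ^ i))"
    using Cons by (intro order_trans[OF norm_triangle_ineq] add_mono \<eta> cheb_op_bound) auto
  also have "\<dots> = \<eta> * (\<Sum>i<length (k # ks). (2 * real d) ^ i)"
    by (simp only: length_Cons sum.lessThan_Suc_shift) (simp add: sum_distrib_left algebra_simps)
  finally show ?case .
qed simp

text \<open>Composition amounts to interpolation at tuples of nodes. Distinctness keeps the kernel
  factors of the other coordinates unchanged when coordinate \<open>k\<close> is overwritten by a
  node.\<close>

lemma cheb_ops_expand:
  assumes "distinct ks"
  shows "cheb_ops d ks G x = (\<Sum>f\<in>PiE (set ks) (\<lambda>_. {..<d}).
     of_real (\<Prod>k\<in>set ks. poly (cheb_kernel d (f k)) (x $ k)) * G (\<chi> i. if i \<in> set ks then cheb_node d (f i) else x $ i))"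
  using assms
proof (induction ks arbitrary: x)
  case (Cons k ks)
  define W where "W f y = complex_of_real (\<Prod>k\<in>set ks. poly (cheb_kernel d (f k)) (y $ k))" for f and y :: "real ^ 'a"
  define Y where "Y f y = (\<chi> i. if i \<in> set ks then cheb_node d (f i) else y $ i)" for f and y :: "real ^ 'a"
  have k: "k \<notin> set ks" using Cons by auto
  have W1: "W f (vec_upd x k s) = W f x" for f s
    unfolding W_def using k by (intro arg_cong[where f = of_real] prod.cong) (auto simp: vec_upd_nth)
  have W2: "W (f(k := j)) x = W f x" for f j
    unfolding W_def using k by (intro arg_cong[where f = of_real] prod.cong) auto
  have Y1: "(\<chi> i. if i \<in> set (k # ks) then cheb_node d ((f(k := j)) i) else x $ i) = Y f (vec_upd x k (cheb_node d j))" for f j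
    unfolding Y_def using k by (auto simp: vec_eq_iff vec_upd_nth)
  have "cheb_ops d (k # ks) G x = (\<Sum>j<d. of_real (poly (cheb_kernel d j) (x $ k)) *
     (\<Sum>f\<in>PiE (set ks) (\<lambda>_. {..<d}). W f (vec_upd x k (cheb_node d j)) * G (Y f (vec_upd x k (cheb_node d j)))))"
    using Cons unfolding W_def Y_def by (simp add: cheb_op_def)
  also have "\<dots> = (\<Sum>(j, f)\<in>{..<d} \<times> PiE (set ks) (\<lambda>_. {..<d}).
     of_real (poly (cheb_kernel d j) (x $ k)) * W f x * G (Y f (vec_upd x k (cheb_node d j))))"
    unfolding W1 sum_distrib_left sum.cartesian_product by (simp add: mult.assoc)
  also have "\<dots> = (\<Sum>f\<in>PiE (set (k # ks)) (\<lambda>_. {..<d}).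
     of_real (poly (cheb_kernel d (f k)) (x $ k)) * W f x * G (\<chi> i. if i \<in> set (k # ks) then cheb_node d (f i) else x $ i))"
  \<comment> \<open>Assignments on \<open>k # ks\<close> correspond to a node index for
    \<open>k\<close> and an assignment on \<open>ks\<close>; extensionality requires the reset of
    \<open>k\<close> to \<open>undefined\<close>.\<close>
  proof (rule sum.reindex_bij_witness[of _ "\<lambda>f. (f k, f(k := undefined))" "\<lambda>(j, f). f(k := j)"], goal_cases)
    case (1 a)
    then show ?case using k by (auto simp: PiE_def extensional_def)
  next
    case (2 a)
    then show ?case using k by (auto simp: PiE_def extensional_def)
  next
    case (3 b)
    then show ?case by auto
  next
    case (4 b)
    then show ?case using k by (auto simp: PiE_def extensional_def)
  next
    case (5 a)
    then show ?case by (cases a) (simp only: prod.case Y1 W2 fun_upd_same)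
  qed
  also have "\<dots> = (\<Sum>f\<in>PiE (set (k # ks)) (\<lambda>_. {..<d}).
     of_real (\<Prod>i\<in>set (k # ks). poly (cheb_kernel d (f i)) (x $ i)) * G (\<chi> i. if i \<in> set (k # ks) then cheb_node d (f i) else x $ i))"
    unfolding W_def using k by simp
  finally show ?case .
qed simp

context graded_polys
begin

definition comb :: "nat \<Rightarrow> (nat ^ 'N \<Rightarrow> complex) \<Rightarrow> real ^ 'N \<Rightarrow> complex" where
  "comb d c x = (\<Sum>\<nu>\<in>grid d. c \<nu> * tensor_poly P \<nu> x)"

lemma cheb_op_tensor:
  assumes "\<nu> \<in> grid d"
  shows "cheb_op d k (tensor_poly P \<nu>) x = tensor_poly P \<nu> x"
proof -
  define R where "R = (\<Prod>i\<in>UNIV - {k}. poly (P (\<nu> $ i)) (x $ i))"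
  have "tensor_poly P \<nu> (vec_upd x k s) = of_real (poly (P (\<nu> $ k)) s * R)" for s
    unfolding tensor_poly_def R_def
    by (subst prod.remove[of _ k]) (auto simp: vec_upd_nth intro!: prod.cong)
  then have "cheb_op d k (tensor_poly P \<nu>) x = of_real (R * (poly (\<Sum>j<d. smult (poly (P (\<nu> $ k)) (cheb_node d j)) (cheb_kernel d j)) (x $ k)))"
    unfolding cheb_op_def by (simp add: poly_sum sum_distrib_left mult_ac)
  also have "\<dots> = of_real (R * poly (P (\<nu> $ k)) (x $ k))"
    using assms by (subst cheb_kernel_reproduces) (auto simp: grid_def)
  also have "\<dots> = tensor_poly P \<nu> x"
    unfolding tensor_poly_def R_def by (subst (2) prod.remove[of _ k]) (auto simp: mult_ac)
  finally show ?thesis .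
qed

text \<open>Being fixed by interpolation in each coordinate, the polynomials of the space inherit
  the bounds of the kernels.\<close>

lemma cheb_op_comb: "cheb_op d k (comb d c) x = comb d c x"
proof -
  have "cheb_op d k (comb d c) x = (\<Sum>\<nu>\<in>grid d. c \<nu> * cheb_op d k (tensor_poly P \<nu>) x)"
    unfolding cheb_op_def comb_def sum_distrib_left by (subst sum.swap) (simp add: mult_ac)
  then show ?thesis by (simp add: comb_def cheb_op_tensor)
qed

text \<open>Interpolating the polynomial in the coordinate that changes moves the whole difference
  onto the kernels: \<open>d\<close> summands, each with Lipschitz constant 2 d^2 and a nodal value
  of size at most \<open>B\<close>. The coordinates are then exchanged one at a time.\<close>

lemma comb_lipschitz:
  fixes c :: "nat ^ 'N \<Rightarrow> complex"
  assumes B: "\<And>y. y \<in> cube \<Longrightarrow> cmod (comb d c y) \<le> B" and x: "x \<in> cube" and y: "y \<in> cube"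
  shows "cmod (comb d c x - comb d c y) \<le> 2 * real d ^ 3 * B * (\<Sum>k\<in>UNIV. \<bar>x $ k - y $ k\<bar>)"
proof -
  have one: "cmod (comb d c z - comb d c (vec_upd z k s)) \<le> 2 * real d ^ 3 * B * \<bar>z $ k - s\<bar>"
    if z: "z \<in> cube" and s: "-1 \<le> s" "s \<le> 1" for z k s
  proof -
    have zk: "-1 \<le> z $ k" "z $ k \<le> 1" using z by (auto simp: cube_def)
    have u: "vec_upd (vec_upd z k s) k t = vec_upd z k t" for t
      by (simp add: vec_upd_def vec_eq_iff)
    have "comb d c z - comb d c (vec_upd z k s) = cheb_op d k (comb d c) z - cheb_op d k (comb d c) (vec_upd z k s)"
      by (simp only: cheb_op_comb)
    also have "\<dots> = (\<Sum>j<d. of_real (poly (cheb_kernel d j) (z $ k) - poly (cheb_kernel d j) s) * comb d c (vec_upd z k (cheb_node d j)))"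
      unfolding cheb_op_def u vec_upd_nth by (simp add: left_diff_distrib sum_subtractf)
    also have "cmod \<dots> \<le> (\<Sum>j<d. (2 * (real d)\<^sup>2 * \<bar>z $ k - s\<bar>) * B)"
    proof (intro sum_norm_le)
      fix j
      show "cmod (of_real (poly (cheb_kernel d j) (z $ k) - poly (cheb_kernel d j) s) * comb d c (vec_upd z k (cheb_node d j)))
        \<le> (2 * (real d)\<^sup>2 * \<bar>z $ k - s\<bar>) * B"
        unfolding norm_mult norm_of_real
        by (intro mult_mono cheb_kernel_lipschitz zk s B vec_upd_cube z cheb_node_bounds) auto
    qed
    finally show ?thesis by (simp add: power2_eq_square power3_eq_cube mult_ac)
  qed
  \<comment> \<open>Intermediate points between \<open>x\<close> and \<open>y\<close>; they stay in
    the cube, where the bound \<open>B\<close> is available.\<close>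
  define Z where "Z A = (\<chi> i. if i \<in> A then y $ i else x $ i)" for A
  have Zc: "Z A \<in> cube" for A using x y by (auto simp: Z_def cube_def)
  have "cmod (comb d c x - comb d c (Z A)) \<le> 2 * real d ^ 3 * B * (\<Sum>k\<in>A. \<bar>x $ k - y $ k\<bar>)" if "finite A" for A
    using that
  proof (induction A)
    case empty
    have "Z {} = x" by (simp add: Z_def)
    then show ?case by simp
  next
    case (insert k A)
    have e: "Z (insert k A) = vec_upd (Z A) k (y $ k)" "Z A $ k = x $ k"
      using insert by (auto simp: Z_def vec_upd_def vec_eq_iff)
    have "cmod (comb d c x - comb d c (Z (insert k A)))
       \<le> cmod (comb d c x - comb d c (Z A)) + cmod (comb d c (Z A) - comb d c (vec_upd (Z A) k (y $ k)))"
      unfolding e(1) using norm_triangle_ineq[of "comb d c x - comb d c (Z A)" "comb d c (Z A) - comb d c (vec_upd (Z A) k (y $ k))"]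
      by simp
    also have "\<dots> \<le> 2 * real d ^ 3 * B * (\<Sum>k\<in>A. \<bar>x $ k - y $ k\<bar>) + 2 * real d ^ 3 * B * \<bar>Z A $ k - y $ k\<bar>"
      using y by (intro add_mono insert.IH one Zc) (auto simp: cube_def)
    finally show ?case using insert e(2) by (simp add: algebra_simps)
  qed
  from this[of UNIV] show ?thesis by (simp add: Z_def)
qed

text \<open>Expanding each kernel of the product in the family and multiplying out gives one
  coefficient per index of the grid.\<close>

lemma cheb_ops_in_span:
  fixes G :: "real ^ 'N \<Rightarrow> complex"
  assumes "distinct ks" "set ks = (UNIV :: 'N set)"
  obtains c where "cheb_ops d ks G = comb d c"
proof -
  obtain b where b: "\<And>j. cheb_kernel d j = (\<Sum>k<d. smult (b k j) (P k))"
    by (rule dual_coefficients[of d]) blast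
  define Q where "Q = PiE (UNIV :: 'N set) (\<lambda>_. {..<d})"
  have W: "complex_of_real (\<Prod>k\<in>UNIV. poly (cheb_kernel d (f k)) (x $ k))
     = (\<Sum>\<nu>\<in>grid d. of_real (\<Prod>k\<in>UNIV. b (\<nu> $ k) (f k)) * tensor_poly P \<nu> x)" for f and x :: "real ^ 'N"
  proof -
    have "(\<Prod>k\<in>UNIV. poly (cheb_kernel d (f k)) (x $ k)) = (\<Prod>k\<in>UNIV. \<Sum>i<d. b i (f k) * poly (P i) (x $ k))"
      unfolding b by (simp add: poly_sum)
    also have "\<dots> = (\<Sum>\<nu>\<in>grid d. \<Prod>k\<in>UNIV. b (\<nu> $ k) (f k) * poly (P (\<nu> $ k)) (x $ k))"
      by (rule sum_grid_prod[symmetric])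
    finally show ?thesis by (simp add: prod.distrib tensor_poly_def)
  qed
  have "cheb_ops d ks G x = comb d (\<lambda>\<nu>. \<Sum>f\<in>Q. of_real (\<Prod>k\<in>UNIV. b (\<nu> $ k) (f k)) * G (\<chi> i. cheb_node d (f i))) x" for x
  proof -
    have "cheb_ops d ks G x = (\<Sum>f\<in>Q. (\<Sum>\<nu>\<in>grid d. of_real (\<Prod>k\<in>UNIV. b (\<nu> $ k) (f k)) * tensor_poly P \<nu> x) * G (\<chi> i. cheb_node d (f i)))"
      unfolding cheb_ops_expand[OF assms(1)] assms(2) Q_def by (simp only: W UNIV_I if_True)
    then show ?thesis
      unfolding comb_def sum_distrib_right by (subst (asm) sum.swap) (simp add: mult_ac)
  qed
  then show ?thesis by (intro that ext)
qed

text \<open>The product of the one-dimensional dual functionals uses values at the tensor nodes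
  only, which lie in the cube, and extracts the coefficient of \<nu>.\<close>

lemma comb_eq_0_imp:
  assumes z: "\<And>x. x \<in> cube \<Longrightarrow> comb d c x = 0" and \<nu>: "\<nu> \<in> grid d"
  shows "c \<nu> = 0"
proof -
  obtain b where b: "\<And>i k. i < d \<Longrightarrow> k < d \<Longrightarrow> (\<Sum>j<d. b k j * poly (P i) (cheb_node d j)) = of_bool (i = k)"
    by (rule dual_coefficients[of d]) blast
  define N where "N \<iota> = (\<chi> i. cheb_node d (\<iota> $ i))" for \<iota> :: "nat ^ 'a"
  have Nc: "N \<iota> \<in> cube" for \<iota> by (auto simp: N_def cube_def cheb_node_bounds)
  define w where "w \<iota> = complex_of_real (\<Prod>k\<in>UNIV. b (\<nu> $ k) (\<iota> $ k))" for \<iota> :: "nat ^ 'a"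
  have dual: "(\<Sum>\<iota>\<in>grid d. w \<iota> * tensor_poly P \<mu> (N \<iota>)) = of_bool (\<mu> = \<nu>)" if \<mu>: "\<mu> \<in> grid d" for \<mu>
  proof -
    have "(\<Sum>\<iota>\<in>grid d. w \<iota> * tensor_poly P \<mu> (N \<iota>)) =
      of_real (\<Sum>\<iota>\<in>grid d. \<Prod>k\<in>UNIV. b (\<nu> $ k) (\<iota> $ k) * poly (P (\<mu> $ k)) (cheb_node d (\<iota> $ k)))"
      by (simp add: w_def tensor_poly_def N_def prod.distrib)
    also have "\<dots> = of_real (\<Prod>k\<in>UNIV. \<Sum>j<d. b (\<nu> $ k) j * poly (P (\<mu> $ k)) (cheb_node d j))"
      by (subst sum_grid_prod) simp
    also have "\<dots> = of_real (\<Prod>k\<in>UNIV. of_bool (\<mu> $ k = \<nu> $ k))"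
      using \<mu> \<nu> by (simp add: b grid_def)
    also have "\<dots> = of_bool (\<mu> = \<nu>)"
    proof (cases "\<mu> = \<nu>")
      case False
      then obtain k where "\<mu> $ k \<noteq> \<nu> $ k" by (auto simp: vec_eq_iff)
      then have "(\<Prod>k\<in>UNIV. of_bool (\<mu> $ k = \<nu> $ k)) = (0::real)"
        by (intro prod_zero) auto
      then show ?thesis using False by simp
    qed simp
    finally show ?thesis .
  qed
  have "0 = (\<Sum>\<iota>\<in>grid d. w \<iota> * comb d c (N \<iota>))"
    by (simp add: z Nc)
  also have "\<dots> = (\<Sum>\<mu>\<in>grid d. c \<mu> * (\<Sum>\<iota>\<in>grid d. w \<iota> * tensor_poly P \<mu> (N \<iota>)))"
    unfolding comb_def sum_distrib_left by (subst sum.swap) (simp add: mult_ac)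
  also have "\<dots> = (\<Sum>\<mu>\<in>grid d. if \<mu> = \<nu> then c \<mu> else 0)"
    by (intro sum.cong refl) (simp add: dual)
  also have "\<dots> = c \<nu>" using \<nu> by (simp add: finite_grid)
  finally show ?thesis by simp
qed

end

section \<open>Least squares\<close>

text \<open>A Gram-Schmidt step in the index set: the data and the new column are reduced modulo the
  old columns to \<open>e\<close> and \<open>e0\<close>, and then the component of \<open>e\<close>
  along \<open>e0\<close> is removed. Rank-deficient data are covered.\<close>

lemma least_squares_normal_equations:
  fixes a :: "'i \<Rightarrow> nat \<Rightarrow> complex"
  assumes "finite I"
  shows "\<exists>c. \<forall>\<mu>\<in>I. (\<Sum>j<n. (b j - (\<Sum>\<nu>\<in>I. c \<nu> * a \<nu> j)) * cnj (a \<mu> j)) = 0"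
  using assms
proof (induction I arbitrary: b)
  case (insert \<nu>0 I)
  obtain c where c: "\<And>\<mu>. \<mu> \<in> I \<Longrightarrow> (\<Sum>j<n. (b j - (\<Sum>\<nu>\<in>I. c \<nu> * a \<nu> j)) * cnj (a \<mu> j)) = 0"
    using insert.IH[of b] by blast
  obtain g where g: "\<And>\<mu>. \<mu> \<in> I \<Longrightarrow> (\<Sum>j<n. (a \<nu>0 j - (\<Sum>\<nu>\<in>I. g \<nu> * a \<nu> j)) * cnj (a \<mu> j)) = 0"
    using insert.IH[of "a \<nu>0"] by blast
  define e where "e j = b j - (\<Sum>\<nu>\<in>I. c \<nu> * a \<nu> j)" for j
  define e0 where "e0 j = a \<nu>0 j - (\<Sum>\<nu>\<in>I. g \<nu> * a \<nu> j)" for j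
  define s where "s = (\<Sum>j<n. e0 j * cnj (e0 j))"
  \<comment> \<open>If the new column depends on the old ones at the samples, then \<open>e0\<close>
    vanishes there, s = 0, and division by zero gives t = 0, for which the next identity still
    holds.\<close>
  define t where "t = (\<Sum>j<n. e j * cnj (e0 j)) / s"
  have t: "(\<Sum>j<n. e j * cnj (e0 j)) = t * s"
  proof (cases "s = 0")
    case True
    have "s = of_real (\<Sum>j<n. (cmod (e0 j))\<^sup>2)"
      unfolding s_def by (simp only: complex_norm_square[symmetric] of_real_sum)
    then have "(\<Sum>j<n. (cmod (e0 j))\<^sup>2) = 0" using True by (metis of_real_eq_0_iff)
    then have "\<And>j. j < n \<Longrightarrow> e0 j = 0" by (simp add: sum_nonneg_eq_0_iff)
    then show ?thesis using True by simp
  qed (simp add: t_def)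
  define c' where "c' = (\<lambda>\<nu>. c \<nu> - t * g \<nu>)(\<nu>0 := t)"
  have res: "b j - (\<Sum>\<nu>\<in>insert \<nu>0 I. c' \<nu> * a \<nu> j) = e j - t * e0 j" for j
  proof -
    have "(\<Sum>\<nu>\<in>I. c' \<nu> * a \<nu> j) = (\<Sum>\<nu>\<in>I. (c \<nu> - t * g \<nu>) * a \<nu> j)"
      using insert by (intro sum.cong) (auto simp: c'_def)
    then show ?thesis
      using insert unfolding e_def e0_def
      by (simp add: c'_def left_diff_distrib right_diff_distrib sum_subtractf sum_distrib_left mult.assoc)
  qed
  have o: "(\<Sum>j<n. (e j - t * e0 j) * cnj (a \<mu> j)) = 0" if "\<mu> \<in> I" for \<mu>
  proof -
    have "(\<Sum>j<n. (e j - t * e0 j) * cnj (a \<mu> j)) = (\<Sum>j<n. e j * cnj (a \<mu> j)) - t * (\<Sum>j<n. e0 j * cnj (a \<mu> j))"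
      by (simp add: left_diff_distrib sum_subtractf sum_distrib_left mult.assoc)
    then show ?thesis using c[OF that] g[OF that] unfolding e_def e0_def by simp
  qed
  have "(\<Sum>j<n. (e j - t * e0 j) * cnj (a \<nu>0 j)) =
    (\<Sum>j<n. (e j - t * e0 j) * cnj (e0 j + (\<Sum>\<nu>\<in>I. g \<nu> * a \<nu> j)))"
    by (simp add: e0_def)
  also have "\<dots> = (\<Sum>j<n. (e j - t * e0 j) * cnj (e0 j))
     + (\<Sum>j<n. \<Sum>\<nu>\<in>I. cnj (g \<nu>) * ((e j - t * e0 j) * cnj (a \<nu> j)))"
    by (simp only: complex_cnj_add cnj_sum complex_cnj_mult distrib_left sum.distrib sum_distrib_left mult.left_commute)
  also have "(\<Sum>j<n. \<Sum>\<nu>\<in>I. cnj (g \<nu>) * ((e j - t * e0 j) * cnj (a \<nu> j)))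
     = (\<Sum>\<nu>\<in>I. cnj (g \<nu>) * (\<Sum>j<n. (e j - t * e0 j) * cnj (a \<nu> j)))"
    unfolding sum_distrib_left by (rule sum.swap)
  also have "\<dots> = 0" by (simp add: o)
  also have "(\<Sum>j<n. (e j - t * e0 j) * cnj (e0 j)) = (\<Sum>j<n. e j * cnj (e0 j)) - t * s"
    by (simp add: s_def left_diff_distrib sum_subtractf sum_distrib_left mult.assoc)
  finally have "(\<Sum>j<n. (e j - t * e0 j) * cnj (a \<nu>0 j)) = 0" using t by simp
  then have "\<forall>\<mu>\<in>insert \<nu>0 I. (\<Sum>j<n. (b j - (\<Sum>\<nu>\<in>insert \<nu>0 I. c' \<nu> * a \<nu> j)) * cnj (a \<mu> j)) = 0"
    unfolding res using o by blast
  then show ?case by blast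
qed simp

text \<open>The cross term vanishes because two fits differ by a combination of columns, to which
  the residual is orthogonal.\<close>

lemma least_squares_pythagoras:
  fixes a :: "'i \<Rightarrow> nat \<Rightarrow> complex"
  assumes c: "\<forall>\<mu>\<in>I. (\<Sum>j<n. (b j - (\<Sum>\<nu>\<in>I. c \<nu> * a \<nu> j)) * cnj (a \<mu> j)) = 0"
  shows "(\<Sum>j<n. (cmod (b j - (\<Sum>\<nu>\<in>I. c' \<nu> * a \<nu> j)))\<^sup>2) =
    (\<Sum>j<n. (cmod (b j - (\<Sum>\<nu>\<in>I. c \<nu> * a \<nu> j)))\<^sup>2) + (\<Sum>j<n. (cmod (\<Sum>\<nu>\<in>I. (c \<nu> - c' \<nu>) * a \<nu> j))\<^sup>2)"
proof -
  define e where "e j = b j - (\<Sum>\<nu>\<in>I. c \<nu> * a \<nu> j)" for j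
  define h where "h j = (\<Sum>\<nu>\<in>I. (c \<nu> - c' \<nu>) * a \<nu> j)" for j
  have eh: "b j - (\<Sum>\<nu>\<in>I. c' \<nu> * a \<nu> j) = e j + h j" for j
    by (simp add: e_def h_def left_diff_distrib sum_subtractf)
  have "(\<Sum>j<n. e j * cnj (h j)) = (\<Sum>\<nu>\<in>I. cnj (c \<nu> - c' \<nu>) * (\<Sum>j<n. e j * cnj (a \<nu> j)))"
    unfolding h_def cnj_sum complex_cnj_mult sum_distrib_left
    by (subst sum.swap) (simp add: mult_ac)
  also have "\<dots> = 0" using c by (simp add: e_def)
  finally have "(\<Sum>j<n. Re (e j * cnj (h j))) = 0" by (subst Re_sum[symmetric]) simp
  moreover have "(cmod (x + y))\<^sup>2 = (cmod x)\<^sup>2 + (cmod y)\<^sup>2 + 2 * Re (x * cnj y)" for x y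
    unfolding cmod_power2 by (simp add: power2_eq_square algebra_simps)
  ultimately show ?thesis
    unfolding eh e_def[symmetric] h_def[symmetric] by (simp only: sum.distrib sum_distrib_left[symmetric])
qed

lemma frobenius_norm_squared: "(frobenius_norm l n A)\<^sup>2 = (\<Sum>i<l. \<Sum>j<n. (cmod (A i j))\<^sup>2)"
  unfolding frobenius_norm_def by (intro real_sqrt_pow2 sum_nonneg) auto

text \<open>The Frobenius objective splits into one least squares problem per row. By Pythagoras it
  is a constant plus \<open>D K\<close>, and \<open>inj\<close> makes \<open>D\<close> vanish only
  at the extensional solution \<open>K0\<close> of the normal equations.\<close>

lemma edmd_matrix_unique:
  assumes I: "finite I"
    and inj: "\<And>g. (\<And>j. j < n \<Longrightarrow> (\<Sum>\<nu>\<in>I. g \<nu> * \<psi> \<nu> (fst (\<omega> j))) = 0) \<Longrightarrow> \<forall>\<nu>\<in>I. g \<nu> = 0"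
  shows "\<exists>!K. edmd_matrix l n \<phi> I \<psi> \<omega> K"
proof -
  define a where "a \<nu> j = \<psi> \<nu> (fst (\<omega> j))" for \<nu> j
  define F where "F K = (frobenius_norm l n (\<lambda>i j. \<phi> i (snd (\<omega> j)) - (\<Sum>\<nu>\<in>I. K i \<nu> * \<psi> \<nu> (fst (\<omega> j)))))\<^sup>2" for K
  have "\<forall>i. \<exists>c. \<forall>\<mu>\<in>I. (\<Sum>j<n. (\<phi> i (snd (\<omega> j)) - (\<Sum>\<nu>\<in>I. c \<nu> * a \<nu> j)) * cnj (a \<mu> j)) = 0"
    using least_squares_normal_equations[OF I, where n = n and b = "\<lambda>j. \<phi> i (snd (\<omega> j))" and a = a for i] by (rule allI)
  then obtain c where "\<forall>i. \<forall>\<mu>\<in>I. (\<Sum>j<n. (\<phi> i (snd (\<omega> j)) - (\<Sum>\<nu>\<in>I. c i \<nu> * a \<nu> j)) * cnj (a \<mu> j)) = 0"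
    by (rule choice[THEN exE])
  note c = this[rule_format]
  define K0 where "K0 = (\<lambda>i\<in>{..<l}. \<lambda>\<nu>\<in>I. c i \<nu>)"
  define D where "D K = (\<Sum>i<l. \<Sum>j<n. (cmod (\<Sum>\<nu>\<in>I. (c i \<nu> - K i \<nu>) * a \<nu> j))\<^sup>2)" for K
  define F0 where "F0 = (\<Sum>i<l. \<Sum>j<n. (cmod (\<phi> i (snd (\<omega> j)) - (\<Sum>\<nu>\<in>I. c i \<nu> * a \<nu> j)))\<^sup>2)"
  have F: "F K = F0 + D K" for K
  proof -
    have "(\<Sum>i<l. \<Sum>j<n. (cmod (\<phi> i (snd (\<omega> j)) - (\<Sum>\<nu>\<in>I. K i \<nu> * a \<nu> j)))\<^sup>2) =
      (\<Sum>i<l. (\<Sum>j<n. (cmod (\<phi> i (snd (\<omega> j)) - (\<Sum>\<nu>\<in>I. c i \<nu> * a \<nu> j)))\<^sup>2)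
         + (\<Sum>j<n. (cmod (\<Sum>\<nu>\<in>I. (c i \<nu> - K i \<nu>) * a \<nu> j))\<^sup>2))"
      by (rule sum.cong[OF refl least_squares_pythagoras[OF ballI[OF c]]])
    then show ?thesis
      by (simp only: F_def F0_def D_def frobenius_norm_squared sum.distrib a_def)
  qed
  have K0: "K0 \<in> coeff_matrices l I"
    by (auto simp: K0_def coeff_matrices_def)
  have D0: "D K0 = 0"
    unfolding D_def K0_def by (auto intro!: sum.neutral)
  have Dnn: "D K \<ge> 0" for K unfolding D_def by (intro sum_nonneg) auto
  have Dz: "K = K0" if K: "K \<in> coeff_matrices l I" and z: "D K = 0" for K
  proof -
    have "\<And>i. i < l \<Longrightarrow> (\<Sum>j<n. (cmod (\<Sum>\<nu>\<in>I. (c i \<nu> - K i \<nu>) * a \<nu> j))\<^sup>2) = 0"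
      using z unfolding D_def by (subst (asm) sum_nonneg_eq_0_iff) (auto intro: sum_nonneg)
    then have "\<And>i j. i < l \<Longrightarrow> j < n \<Longrightarrow> (\<Sum>\<nu>\<in>I. (c i \<nu> - K i \<nu>) * a \<nu> j) = 0"
      by (subst (asm) sum_nonneg_eq_0_iff) auto
    then have "\<And>i. i < l \<Longrightarrow> \<forall>\<nu>\<in>I. c i \<nu> - K i \<nu> = 0"
      unfolding a_def by (intro inj) auto
    then have eq: "K i \<nu> = K0 i \<nu>" if "i < l" "\<nu> \<in> I" for i \<nu> using that by (simp add: K0_def)
    show ?thesis
    proof
      fix i
      show "K i = K0 i"
      proof (cases "i < l")
        case True
        have "K i \<in> I \<rightarrow>\<^sub>E UNIV" "K0 i \<in> I \<rightarrow>\<^sub>E UNIV"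
          using K K0 True by (auto simp: coeff_matrices_def PiE_def Pi_def)
        then show ?thesis by (rule PiE_ext) (rule eq[OF True])
      next
        case False
        then show ?thesis using K K0 by (auto simp: coeff_matrices_def PiE_def extensional_def)
      qed
    qed
  qed
  have iff: "edmd_matrix l n \<phi> I \<psi> \<omega> K \<longleftrightarrow> K \<in> coeff_matrices l I \<and> (\<forall>K'\<in>coeff_matrices l I. D K \<le> D K')" for K
    unfolding edmd_matrix_def is_arg_min_def F_def[symmetric] F by (auto simp: not_less)
  show ?thesis
  proof (rule ex1I)
    show "edmd_matrix l n \<phi> I \<psi> \<omega> K0" unfolding iff D0 using K0 Dnn by blast
    fix K assume "edmd_matrix l n \<phi> I \<psi> \<omega> K"
    then have K: "K \<in> coeff_matrices l I" "D K \<le> D K0" using K0 unfolding iff by auto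
    then show "K = K0" using Dz[OF K(1)] Dnn[of K] D0 by linarith
  qed
qed

text \<open>A global minimiser is optimal in each row, since one row can be replaced while the
  others are kept.\<close>

lemma edmd_matrix_row:
  assumes K: "edmd_matrix l n \<phi> I \<psi> \<omega> K" and i: "i < l"
  shows "(\<Sum>j<n. (cmod (\<phi> i (snd (\<omega> j)) - (\<Sum>\<nu>\<in>I. K i \<nu> * \<psi> \<nu> (fst (\<omega> j)))))\<^sup>2)
    \<le> (\<Sum>j<n. (cmod (\<phi> i (snd (\<omega> j)) - (\<Sum>\<nu>\<in>I. c \<nu> * \<psi> \<nu> (fst (\<omega> j)))))\<^sup>2)"
proof -
  define f where "f g i = (\<Sum>j<n. (cmod (\<phi> i (snd (\<omega> j)) - (\<Sum>\<nu>\<in>I. g \<nu> * \<psi> \<nu> (fst (\<omega> j)))))\<^sup>2)" for g i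
  define K' where "K' = K(i := restrict c I)"
  have KI: "K \<in> coeff_matrices l I" using K by (simp add: edmd_matrix_def is_arg_min_def)
  then have K'I: "K' \<in> coeff_matrices l I"
    using i by (auto simp: K'_def coeff_matrices_def PiE_def extensional_def Pi_def)
  have "\<not> (\<Sum>i<l. f (K' i) i) < (\<Sum>i<l. f (K i) i)"
    using K K'I unfolding edmd_matrix_def is_arg_min_def frobenius_norm_squared f_def by blast
  moreover have "(\<Sum>i<l. f (K' i) i) = f (K' i) i + (\<Sum>i\<in>{..<l} - {i}. f (K' i) i)"
    "(\<Sum>i<l. f (K i) i) = f (K i) i + (\<Sum>i\<in>{..<l} - {i}. f (K i) i)"
    using i by (auto intro: sum.remove)
  moreover have "(\<Sum>i\<in>{..<l} - {i}. f (K' i) i) = (\<Sum>i\<in>{..<l} - {i}. f (K i) i)"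
    by (intro sum.cong) (auto simp: K'_def)
  ultimately have "f (K i) i \<le> f (K' i) i" by linarith
  then show ?thesis by (simp add: f_def K'_def)
qed

section \<open>The reference measures\<close>

lemma cube_eq_cbox: "(cube :: (real ^ 'N) set) = cbox (\<chi> k. -1) (\<chi> k. 1)"
  by (auto simp: cube_def mem_box_cart)

lemma closed_cube: "closed cube" and compact_cube: "compact cube"
  unfolding cube_eq_cbox by auto

lemma cube_borel[measurable]: "cube \<in> sets borel"
  by (simp add: closed_cube borel_closed)

text \<open>What the two measures have in common. The constant 1 / pi ^ N is a lower bound for both
  densities inside the cube: the uniform density is 1 / 2 ^ N, and each Chebyshev factor 1 / (pi
  sqrt (1 - s^2)) is at least 1 / pi.\<close>

locale cube_prob = prob_space \<rho> for \<rho> :: "(real ^ 'N) measure" +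
  assumes sets_eq_borel [measurable_cong, simp]: "sets \<rho> = sets borel"
    and AE_cube: "AE x in \<rho>. x \<in> cube"
    and prob_box: "\<And>a b. (\<And>k. -1 \<le> a $ k \<and> a $ k \<le> b $ k \<and> b $ k \<le> 1) \<Longrightarrow>
      (\<Prod>k\<in>UNIV. b $ k - a $ k) / pi ^ CARD('N) \<le> prob (box a b)"

lemma measure_lborel_box_cart:
  fixes a b :: "real ^ 'N"
  assumes "\<And>k. a $ k \<le> b $ k"
  shows "emeasure lborel (box a b) = ennreal (\<Prod>k\<in>UNIV. b $ k - a $ k)"
    and "emeasure lborel (cbox a b) = ennreal (\<Prod>k\<in>UNIV. b $ k - a $ k)"
proof -
  have "a \<in> cbox a b" using assms by (auto simp: mem_box_cart)
  then have "measure lborel (cbox a b) = (\<Prod>k\<in>UNIV. b $ k - a $ k)"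
    using content_cbox_cart[of a b] by auto
  then show c: "emeasure lborel (cbox a b) = ennreal (\<Prod>k\<in>UNIV. b $ k - a $ k)"
    using emeasure_lborel_cbox_finite[of a b] by (subst emeasure_eq_ennreal_measure) auto
  then show "emeasure lborel (box a b) = ennreal (\<Prod>k\<in>UNIV. b $ k - a $ k)"
    using assms by (simp add: emeasure_lborel_box_eq emeasure_lborel_cbox_eq)
qed

lemma emeasure_lborel_cube: "emeasure lborel (cube :: (real ^ 'N) set) = ennreal (2 ^ CARD('N))"
  unfolding cube_eq_cbox by (subst measure_lborel_box_cart) auto

lemma cube_prob_uniform: "cube_prob (uniform_cube :: (real ^ 'N) measure)"
proof -
  have ne: "emeasure lborel (cube :: (real ^ 'N) set) \<noteq> 0" "emeasure lborel (cube :: (real ^ 'N) set) \<noteq> \<infinity>"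
    unfolding emeasure_lborel_cube by auto
  interpret prob_space "uniform_cube :: (real ^ 'N) measure"
    unfolding uniform_cube_def by (rule prob_space_uniform_measure[OF ne])
  show ?thesis
  proof
    show "sets (uniform_cube :: (real ^ 'N) measure) = sets borel"
      by (simp add: uniform_cube_def)
    show "AE x in (uniform_cube :: (real ^ 'N) measure). x \<in> cube"
      unfolding uniform_cube_def by (rule AE_uniform_measureI) auto
    fix a b :: "real ^ 'N"
    assume ab: "\<And>k. -1 \<le> a $ k \<and> a $ k \<le> b $ k \<and> b $ k \<le> 1"
    have "x \<in> cube" if "x \<in> box a b" for x
    proof -
      have "-1 \<le> x $ k \<and> x $ k \<le> 1" for k
        using that[unfolded mem_box_cart, rule_format, of k] ab[of k] by linarith
      then show ?thesis by (simp add: cube_def)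
    qed
    then have sub: "cube \<inter> box a b = box a b" by auto
    have p: "(\<Prod>k\<in>UNIV. b $ k - a $ k) \<ge> 0" using ab by (intro prod_nonneg) auto
    have "emeasure uniform_cube (box a b) = emeasure lborel (box a b) / emeasure lborel (cube :: (real ^ 'N) set)"
      unfolding uniform_cube_def by (subst emeasure_uniform_measure) (auto simp: sub)
    also have "\<dots> = ennreal ((\<Prod>k\<in>UNIV. b $ k - a $ k) / 2 ^ CARD('N))"
      using ab p unfolding emeasure_lborel_cube by (subst measure_lborel_box_cart) (auto simp: divide_ennreal)
    finally have "prob (box a b) = (\<Prod>k\<in>UNIV. b $ k - a $ k) / 2 ^ CARD('N)"
      using p by (simp add: measure_def)
    moreover have "(\<Prod>k\<in>UNIV. b $ k - a $ k) / pi ^ CARD('N) \<le> (\<Prod>k\<in>UNIV. b $ k - a $ k) / 2 ^ CARD('N)"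
      using p pi_ge_two by (intro divide_left_mono power_mono) auto
    ultimately show "(\<Prod>k\<in>UNIV. b $ k - a $ k) / pi ^ CARD('N) \<le> prob (box a b)" by simp
  qed
qed

lemma nn_integral_arcsine_density:
  "(\<integral>\<^sup>+s. ennreal (indicator {-1..1} s * (1 / (pi * sqrt (1 - s\<^sup>2)))) \<partial>lborel) = 1"
proof -
  define f where "f s = 1 / (pi * sqrt (1 - s\<^sup>2))" for s :: real
  \<comment> \<open>The antiderivative rises from -1/2 to 1/2. Only its limits at the ends are
    needed, where the density is singular.\<close>
  define F where "F s = arcsin s / pi" for s :: real
  have sq: "1 - s\<^sup>2 > 0" if "-1 < s" "s < 1" for s :: real
    using that by (simp add: abs_square_less_1)
  have cF: "continuous_on {-1..1} F"
    unfolding F_def by (intro continuous_intros continuous_on_arcsin') auto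
  have d: "DERIV F s :> f s" and c: "isCont f s" if "ereal (-1) < ereal s" "ereal s < ereal 1" for s
  proof -
    have s: "-1 < s" "s < 1" using that by auto
    show "DERIV F s :> f s"
      unfolding F_def f_def using s by (auto intro!: derivative_eq_intros simp: field_simps)
    show "isCont f s"
      unfolding f_def using sq[OF s] by (intro continuous_intros) auto
  qed
  have nn: "AE x in lborel. ereal (-1) < ereal x \<longrightarrow> ereal x < ereal 1 \<longrightarrow> 0 \<le> f x"
    using sq by (auto simp: f_def less_imp_le)
  have l: "((F \<circ> real_of_ereal) \<longlongrightarrow> - 1 / 2) (at_right (ereal (-1)))"
    unfolding ereal_tendsto_simps1 using continuous_on_Icc_at_rightD[OF cF] by (simp add: F_def)
  have r: "((F \<circ> real_of_ereal) \<longlongrightarrow> 1 / 2) (at_left (ereal 1))"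
    unfolding ereal_tendsto_simps1 using continuous_on_Icc_at_leftD[OF cF] by (simp add: F_def)
  have "ereal (-1) < ereal 1" by simp
  note FTC = interval_integral_FTC_nonneg[OF this d c nn l r]
  moreover have ei: "einterval (ereal (-1)) (ereal 1) = {-1<..<1}"
    by (auto simp: einterval_iff)
  ultimately have int: "integrable lborel (\<lambda>s. indicator {-1<..<1} s *\<^sub>R f s)"
    and val: "(LBINT s. indicator {-1<..<1} s *\<^sub>R f s) = 1"
    by (auto simp: set_integrable_def interval_lebesgue_integral_le_eq set_lebesgue_integral_def)
  have "(\<integral>\<^sup>+s. ennreal (indicator {-1..1} s * (1 / (pi * sqrt (1 - s\<^sup>2)))) \<partial>lborel)
     = (\<integral>\<^sup>+s. ennreal (indicator {-1<..<1} s *\<^sub>R f s) \<partial>lborel)"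
    \<comment> \<open>At the end points the density is 1 / 0 = 0, so the integrands over the closed
      and the open interval agree pointwise.\<close>
    by (intro nn_integral_cong) (auto simp: f_def indicator_def power2_eq_1_iff)
  also have "\<dots> = ennreal (LBINT s. indicator {-1<..<1} s *\<^sub>R f s)"
    using sq by (intro nn_integral_eq_integral int) (auto simp: f_def indicator_def less_imp_le)
  finally show ?thesis using val by simp
qed

lemma Basis_cart_real: "(Basis :: (real ^ 'N) set) = (\<lambda>k. axis k 1) ` UNIV"
  by (auto simp: Basis_vec_def)

lemma nn_integral_lborel_prod_cart:
  fixes g :: "real \<Rightarrow> ennreal"
  assumes [measurable]: "g \<in> borel_measurable borel"
  shows "(\<integral>\<^sup>+x. (\<Prod>k\<in>UNIV. g (x $ k)) \<partial>(lborel :: (real ^ 'N) measure)) = (\<integral>\<^sup>+s. g s \<partial>lborel) ^ CARD('N)"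
proof -
  have inj: "inj (\<lambda>k::'N. axis k (1::real))" by (auto simp: inj_on_def axis_eq_axis)
  have "(\<Prod>b\<in>Basis. g (x \<bullet> b)) = (\<Prod>k\<in>UNIV. g (x $ k))" for x :: "real ^ 'N"
    unfolding Basis_cart_real by (subst prod.reindex[OF inj]) (simp add: inner_axis)
  then have "(\<integral>\<^sup>+x. (\<Prod>k\<in>UNIV. g (x $ k)) \<partial>(lborel :: (real ^ 'N) measure))
      = (\<integral>\<^sup>+x. (\<Prod>b\<in>Basis. g (x \<bullet> b)) \<partial>(lborel :: (real ^ 'N) measure))" by simp
  also have "\<dots> = (\<Prod>b\<in>(Basis :: (real ^ 'N) set). \<integral>\<^sup>+s. g s \<partial>lborel)"
    by (rule nn_integral_lborel_prod) auto
  finally show ?thesis by simp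
qed

lemma cube_prob_chebyshev: "cube_prob (chebyshev_measure :: (real ^ 'N) measure)"
proof -
  define h where "h s = indicator {-1..1} s * (1 / (pi * sqrt (1 - s\<^sup>2)))" for s :: real
  have hm [measurable]: "h \<in> borel_measurable borel" unfolding h_def by measurable
  have "s\<^sup>2 \<le> 1" if "-1 \<le> s" "s \<le> 1" for s :: real using that by (simp add: abs_square_le_1 abs_le_iff)
  then have h0: "h s \<ge> 0" for s
    by (auto simp: h_def indicator_def)
  define D where "D x = ennreal (indicator cube x * (\<Prod>k\<in>UNIV. 1 / (pi * sqrt (1 - (x $ k)\<^sup>2))))" for x :: "real ^ 'N"
  have D: "D x = (\<Prod>k\<in>UNIV. ennreal (h (x $ k)))" for x
  proof -
    have "indicator cube x = (\<Prod>k\<in>UNIV. indicator {-1..1} (x $ k) :: real)"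
    proof (cases "x \<in> cube")
      case True
      then show ?thesis by (auto simp: cube_def)
    next
      case False
      then obtain k where "x $ k \<notin> {-1..1}" by (auto simp: cube_def)
      then have "(\<Prod>k\<in>UNIV. indicator {-1..1} (x $ k)) = (0 :: real)"
        by (intro prod_zero bexI[of _ k]) (auto simp: indicator_def)
      then show ?thesis using False by simp
    qed
    then have "indicator cube x * (\<Prod>k\<in>UNIV. 1 / (pi * sqrt (1 - (x $ k)\<^sup>2))) = (\<Prod>k\<in>UNIV. h (x $ k))"
      by (simp add: h_def prod.distrib[symmetric] del: mult_divide_mult_cancel_left_if)
    then show ?thesis unfolding D_def using h0 by (simp add: prod_ennreal)
  qed
  have Dm [measurable]: "D \<in> borel_measurable borel" unfolding D by measurable
  have cheb: "chebyshev_measure = density lborel D"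
    unfolding chebyshev_measure_def D_def by simp
  have "(\<integral>\<^sup>+x. D x \<partial>lborel) = (\<integral>\<^sup>+s. ennreal (h s) \<partial>lborel) ^ CARD('N)"
    unfolding D by (rule nn_integral_lborel_prod_cart) measurable
  also have "\<dots> = 1" unfolding h_def nn_integral_arcsine_density by simp
  finally have one: "(\<integral>\<^sup>+x. D x \<partial>lborel) = 1" .
  interpret prob_space "chebyshev_measure :: (real ^ 'N) measure"
    unfolding cheb by (rule prob_spaceI) (simp add: emeasure_density one)
  show ?thesis
  proof
    show "sets (chebyshev_measure :: (real ^ 'N) measure) = sets borel" by (simp add: cheb)
    show "AE x in (chebyshev_measure :: (real ^ 'N) measure). x \<in> cube"
      unfolding cheb by (subst AE_density) (auto simp: D_def indicator_def split: if_splits)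
    fix a b :: "real ^ 'N"
    assume ab: "\<And>k. -1 \<le> a $ k \<and> a $ k \<le> b $ k \<and> b $ k \<le> 1"
    have p: "(\<Prod>k\<in>UNIV. b $ k - a $ k) \<ge> 0" using ab by (intro prod_nonneg) auto
    \<comment> \<open>The box is open for a reason: on a face of the cube, where a coordinate is 1
      or -1, the density takes the value 0.\<close>
    have low: "ennreal (1 / pi ^ CARD('N)) * indicator (box a b) x \<le> D x * indicator (box a b) x" for x
    proof (cases "x \<in> box a b")
      case True
      have hk: "1 / pi \<le> h (x $ k)" for k
      proof -
        have xk: "-1 < x $ k" "x $ k < 1" using True[unfolded mem_box_cart, rule_format, of k] ab[of k] by linarith+
        then have "0 < 1 - (x $ k)\<^sup>2" by (simp add: abs_square_less_1)
        then have "0 < sqrt (1 - (x $ k)\<^sup>2)" "sqrt (1 - (x $ k)\<^sup>2) \<le> 1" by auto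
        then have "1 / pi \<le> 1 / (pi * sqrt (1 - (x $ k)\<^sup>2))"
          by (intro divide_left_mono) auto
        then show ?thesis using xk by (simp add: h_def)
      qed
      have "(\<Prod>k\<in>(UNIV :: 'N set). 1 / pi) \<le> (\<Prod>k\<in>UNIV. h (x $ k))"
        by (intro prod_mono) (auto simp: hk)
      then show ?thesis using True h0 by (simp add: D prod_ennreal power_one_over ennreal_leI)
    qed simp
    have "ennreal ((\<Prod>k\<in>UNIV. b $ k - a $ k) / pi ^ CARD('N)) = ennreal (1 / pi ^ CARD('N)) * emeasure lborel (box a b)"
      using ab p by (subst measure_lborel_box_cart) (auto simp: ennreal_mult[symmetric])
    also have "\<dots> = (\<integral>\<^sup>+x. ennreal (1 / pi ^ CARD('N)) * indicator (box a b) x \<partial>lborel)"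
      by (subst nn_integral_cmult_indicator) auto
    also have "\<dots> \<le> (\<integral>\<^sup>+x. D x * indicator (box a b) x \<partial>lborel)"
      by (intro nn_integral_mono low)
    also have "\<dots> = emeasure chebyshev_measure (box a b)"
      unfolding cheb by (subst emeasure_density) auto
    also have "\<dots> = ennreal (prob (box a b))" by (rule emeasure_eq_measure)
    finally show "(\<Prod>k\<in>UNIV. b $ k - a $ k) / pi ^ CARD('N) \<le> prob (box a b)"
      by (simp add: ennreal_le_iff)
  qed
qed

section \<open>Cells of the cube\<close>

text \<open>Closed cubes of side 2 / M. Neighbours share faces, which is harmless: the cells only
  have to cover the cube, and their bad events are combined by a union bound.\<close>

definition cell :: "nat \<Rightarrow> nat ^ 'N \<Rightarrow> (real ^ 'N) set" where
  "cell M a = cbox (\<chi> k. -1 + 2 * real (a $ k) / real M) (\<chi> k. -1 + 2 * (real (a $ k) + 1) / real M)"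

lemma cell_subset_cube:
  assumes "a \<in> grid M" shows "cell M a \<subseteq> cube"
proof
  fix x assume x: "x \<in> cell M a"
  have "-1 \<le> x $ k \<and> x $ k \<le> 1" for k
  proof -
    have "a $ k < M" using assms by (auto simp: grid_def)
    then have "2 * (real (a $ k) + 1) / real M \<le> 2" by (simp add: field_simps)
    moreover have "2 * real (a $ k) / real M \<ge> 0" by simp
    moreover have "-1 + 2 * real (a $ k) / real M \<le> x $ k" "x $ k \<le> -1 + 2 * (real (a $ k) + 1) / real M"
      using x by (auto simp: cell_def mem_box_cart)
    ultimately show ?thesis by linarith
  qed
  then show "x \<in> cube" by (simp add: cube_def)
qed

lemma cell_diameter:
  assumes "x \<in> cell M a" "y \<in> cell M a"
  shows "\<bar>x $ k - y $ k\<bar> \<le> 2 / real M"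
proof -
  have "-1 + 2 * real (a $ k) / real M \<le> x $ k" "x $ k \<le> -1 + 2 * (real (a $ k) + 1) / real M"
     "-1 + 2 * real (a $ k) / real M \<le> y $ k" "y $ k \<le> -1 + 2 * (real (a $ k) + 1) / real M"
    using assms by (auto simp: cell_def mem_box_cart)
  moreover have "2 * (real (a $ k) + 1) / real M = 2 * real (a $ k) / real M + 2 / real M"
    by (simp add: add_divide_distrib distrib_left)
  ultimately show ?thesis by linarith
qed

lemma cell_cover:
  assumes M: "M > 0" and x: "x \<in> cube"
  obtains a where "a \<in> grid M" "x \<in> cell M a"
proof -
  have "\<exists>i<M. -1 + 2 * real i / real M \<le> s \<and> s \<le> -1 + 2 * (real i + 1) / real M" if s: "-1 \<le> s" "s \<le> 1" for s
  \<comment> \<open>The right end belongs to the last cell, whereas the floor below would give the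
    index \<open>M\<close>.\<close>
  proof (cases "s = 1")
    case True
    then show ?thesis using M by (intro exI[of _ "M - 1"]) (auto simp: of_nat_diff field_simps)
  next
    case False
    define i where "i = nat \<lfloor>(s + 1) / 2 * real M\<rfloor>"
    have nn: "(s + 1) / 2 * real M \<ge> 0" using s by auto
    have i: "real i \<le> (s + 1) / 2 * real M" "(s + 1) / 2 * real M < real i + 1"
      unfolding i_def using nn by linarith+
    have "(s + 1) / 2 * real M < 1 * real M"
      using False s M by (intro mult_strict_right_mono) auto
    then have "i < M" using i by linarith
    moreover have "2 * real i / real M \<le> s + 1" "s + 1 \<le> 2 * (real i + 1) / real M"
      using i M by (auto simp: field_simps)
    ultimately show ?thesis by (intro exI[of _ i]) auto
  qed
  then have "\<forall>k. \<exists>i<M. -1 + 2 * real i / real M \<le> x $ k \<and> x $ k \<le> -1 + 2 * (real i + 1) / real M"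
    using x by (simp add: cube_def)
  then obtain f where f: "\<And>k. f k < M \<and> -1 + 2 * real (f k) / real M \<le> x $ k \<and> x $ k \<le> -1 + 2 * (real (f k) + 1) / real M"
    by metis
  show ?thesis
    by (rule that[of "\<chi> k. f k"]) (use f in \<open>auto simp: grid_def cell_def mem_box_cart\<close>)
qed

context cube_prob
begin

text \<open>Each side 2 / M contributes a factor (2 / M) / pi, and pi < 4 bounds it below by 1 / (2
  M).\<close>

lemma prob_cell:
  assumes "a \<in> grid M" "M > 0"
  shows "(1 / (2 * real M)) ^ CARD('N) \<le> prob (cell M a)"
proof -
  define u v :: "real ^ 'N" where "u = (\<chi> k. -1 + 2 * real (a $ k) / real M)"
    and "v = (\<chi> k. -1 + 2 * (real (a $ k) + 1) / real M)"
  have uv: "-1 \<le> u $ k \<and> u $ k \<le> v $ k \<and> v $ k \<le> 1" for k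
  proof -
    have "a $ k < M" using assms by (auto simp: grid_def)
    then have "2 * (real (a $ k) + 1) / real M \<le> 2" by (simp add: field_simps)
    then show ?thesis using assms(2) by (auto simp: u_def v_def divide_right_mono)
  qed
  have d: "v $ k - u $ k = 2 / real M" for k
    by (simp add: u_def v_def add_divide_distrib distrib_left)
  have "1 / (2 * real M) \<le> (2 / real M) / pi"
    using pi_less_4 pi_gt_zero assms(2) by (simp add: field_simps)
  then have "(1 / (2 * real M)) ^ CARD('N) \<le> ((2 / real M) / pi) ^ CARD('N)"
    by (intro power_mono) auto
  also have "\<dots> = (\<Prod>k\<in>UNIV. v $ k - u $ k) / pi ^ CARD('N)"
    by (simp only: d prod_constant power_divide)
  also have "\<dots> \<le> prob (box u v)" by (rule prob_box[OF uv])
  also have "\<dots> \<le> prob (cell M a)"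
    unfolding cell_def u_def v_def by (intro finite_measure_mono box_subset_cbox) auto
  finally show ?thesis .
qed

text \<open>Hence a holomorphic extension is determined on the cube by the observable that it extends.\<close>

lemma continuous_AE_eq_imp_eq:
  fixes f g :: "real ^ 'N \<Rightarrow> 'b :: metric_space"
  assumes "continuous_on cube f" "continuous_on cube g" "AE x in \<rho>. f x = g x" "x \<in> cube"
  shows "f x = g x"
proof (rule ccontr)
  assume ne: "f x \<noteq> g x"
  define e where "e = dist (f x) (g x) / 2"
  have e: "e > 0" using ne by (simp add: e_def)
  obtain d1 where d1: "d1 > 0" "\<And>y. y \<in> cube \<Longrightarrow> dist y x < d1 \<Longrightarrow> dist (f y) (f x) < e"
    using assms(1,4) e unfolding continuous_on_iff by meson
  obtain d2 where d2: "d2 > 0" "\<And>y. y \<in> cube \<Longrightarrow> dist y x < d2 \<Longrightarrow> dist (g y) (g x) < e"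
    using assms(2,4) e unfolding continuous_on_iff by meson
  have ne': "f y \<noteq> g y" if "y \<in> cube" "dist y x < d1" "dist y x < d2" for y
  proof
    assume "f y = g y"
    then have "dist (f x) (g x) \<le> dist (f y) (f x) + dist (g y) (g x)"
      by (metis dist_commute dist_triangle)
    also have "\<dots> < e + e" by (intro add_strict_mono d1 d2 that)
    finally show False by (simp add: e_def)
  qed
  \<comment> \<open>Fine enough for the whole cell around \<open>x\<close> to lie where
    \<open>f\<close> and \<open>g\<close> stay apart; its positive mass contradicts equality almost
    everywhere.\<close>
  obtain M where M: "real CARD('N) * 2 / min d1 d2 < real M" using reals_Archimedean2 by blast
  have dp: "min d1 d2 > 0" using d1 d2 by auto
  have "0 \<le> real CARD('N) * 2 / min d1 d2" using dp by auto
  then have M0: "M > 0" using M by linarith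
  obtain a where a: "a \<in> grid M" "x \<in> cell M a" using cell_cover[OF M0 assms(4)] .
  have dist: "dist y x < min d1 d2" if y: "y \<in> cell M a" for y
  proof -
    have "dist y x \<le> (\<Sum>k\<in>UNIV. \<bar>y $ k - x $ k\<bar>)"
      unfolding dist_norm using norm_le_l1_cart[of "y - x"] by simp
    also have "\<dots> \<le> (\<Sum>k\<in>(UNIV::'N set). 2 / real M)"
      by (intro sum_mono cell_diameter[OF y a(2)])
    also have "\<dots> = real CARD('N) * 2 / real M" by simp
    also have "\<dots> < min d1 d2"
      using M M0 dp by (simp only: pos_divide_less_eq of_nat_0_less_iff mult.commute)
    finally show ?thesis .
  qed
  have "AE y in \<rho>. y \<notin> cell M a"
    using assms(3)
  proof eventually_elim
    case (elim y)
    then show ?case using ne'[of y] dist[of y] cell_subset_cube[OF a(1)] by auto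
  qed
  moreover have cm: "cell M a \<in> events" by (simp add: cell_def)
  ultimately have "prob (cell M a) = 0"
    by (simp add: prob_eq_0)
  moreover have "(1 / (2 * real M)) ^ CARD('N) > 0" using M0 by simp
  ultimately show False using prob_cell[OF a(1) M0] by linarith
qed

end

section \<open>Sampling\<close>

locale koopman_data = cube_prob \<rho> for \<rho> :: "(real ^ 'N) measure" +
  fixes \<kappa> :: "real ^ 'N \<Rightarrow> (real ^ 'N) measure"
  assumes kernel: "\<kappa> \<in> borel \<rightarrow>\<^sub>M prob_algebra borel"
begin

lemma prob_space_kernel: "prob_space (\<kappa> x)" and sets_kernel_borel: "sets (\<kappa> x) = sets borel"
  using measurable_space[OF kernel, of x] by (auto simp: space_prob_algebra)

lemma law_in_prob_algebra: "\<rho> \<in> space (prob_algebra borel)"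
  using prob_space_axioms by (simp add: space_prob_algebra)

lemma return_pair_measurable: "(\<lambda>y. return borel (x, y)) \<in> borel \<rightarrow>\<^sub>M prob_algebra (borel :: ((real ^ 'N) \<times> (real ^ 'N)) measure)"
  by (rule measurable_compose[OF _ measurable_return_prob_space]) (simp add: borel_prod[symmetric])

lemma pair_kernel_measurable:
  "(\<lambda>x. \<kappa> x \<bind> (\<lambda>y. return borel (x, y))) \<in> borel \<rightarrow>\<^sub>M prob_algebra (borel :: ((real ^ 'N) \<times> (real ^ 'N)) measure)"
proof (rule measurable_bind_prob_space2[OF kernel])
  have "return borel \<in> (borel :: ((real ^ 'N) \<times> (real ^ 'N)) measure) \<rightarrow>\<^sub>M prob_algebra borel"
    by (rule measurable_return_prob_space)
  then show "(\<lambda>(x, y). return borel (x, y)) \<in> (borel \<Otimes>\<^sub>M borel) \<rightarrow>\<^sub>M prob_algebra (borel :: ((real ^ 'N) \<times> (real ^ 'N)) measure)"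
    by (simp add: borel_prod case_prod_beta')
qed

lemma prob_space_pair_law: "prob_space (pair_law \<rho> \<kappa>)"
  unfolding pair_law_def by (rule prob_space_bind'[OF law_in_prob_algebra pair_kernel_measurable])

lemma sets_pair_law [measurable_cong, simp]: "sets (pair_law \<rho> \<kappa>) = sets borel"
  unfolding pair_law_def by (rule sets_bind'[OF law_in_prob_algebra pair_kernel_measurable])

lemma measurable_from_law: "f \<in> \<rho> \<rightarrow>\<^sub>M N \<longleftrightarrow> f \<in> borel \<rightarrow>\<^sub>M N"
  by (intro measurable_cong_sets[THEN arg_cong[where f = "\<lambda>A. f \<in> A"]] sets_eq_borel refl)

text \<open>Unfolds the two stages of sampling, so that conditions on the kernel become almost sure
  conditions on a sampled pair.\<close>

lemma AE_pair_law:
  assumes Q: "Measurable.pred borel Q"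
  shows "(AE z in pair_law \<rho> \<kappa>. Q z) \<longleftrightarrow> (AE x in \<rho>. AE y in \<kappa> x. Q (x, y))"
proof -
  have "(AE z in pair_law \<rho> \<kappa>. Q z) \<longleftrightarrow> (AE x in \<rho>. AE z in \<kappa> x \<bind> (\<lambda>y. return borel (x, y)). Q z)"
    unfolding pair_law_def
    by (rule AE_bind[OF _ Q]) (simp add: measurable_from_law measurable_prob_algebraD[OF pair_kernel_measurable])
  also have "\<dots> \<longleftrightarrow> (AE x in \<rho>. AE y in \<kappa> x. Q (x, y))"
  proof (intro arg_cong[where f = "\<lambda>R. AE x in \<rho>. R x"] ext)
    fix x
    show "(AE z in \<kappa> x \<bind> (\<lambda>y. return borel (x, y)). Q z) \<longleftrightarrow> (AE y in \<kappa> x. Q (x, y))"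
    proof -
    have "(\<lambda>y. return borel (x, y)) \<in> \<kappa> x \<rightarrow>\<^sub>M subprob_algebra (borel :: ((real ^ 'N) \<times> (real ^ 'N)) measure)"
      using measurable_prob_algebraD[OF return_pair_measurable[of x]]
      by (simp add: measurable_cong_sets[OF sets_kernel_borel refl])
    from AE_bind[OF this Q] show ?thesis
      using Q by (simp add: AE_return)
    qed
  qed
  finally show ?thesis .
qed

text \<open>The first marginal of the joint law is \<rho>, so the number of initial states in a cell
  does not see the dynamics.\<close>

lemma pair_law_fst:
  assumes A: "A \<in> sets borel"
  shows "measure (pair_law \<rho> \<kappa>) {z. fst z \<in> A} = prob A"
proof -
  have m: "{z. fst z \<in> A} \<in> sets (borel :: ((real ^ 'N) \<times> (real ^ 'N)) measure)"
  proof -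
    have "{z. fst z \<in> A} = A \<times> (UNIV :: (real ^ 'N) set)" by auto
    then show ?thesis unfolding borel_prod[symmetric] using A by (simp add: pair_measureI)
  qed
  have "emeasure (\<kappa> x \<bind> (\<lambda>y. return borel (x, y))) {z. fst z \<in> A} = indicator A x" for x
  proof -
    have "emeasure (\<kappa> x \<bind> (\<lambda>y. return borel (x, y))) {z. fst z \<in> A}
       = (\<integral>\<^sup>+y. emeasure (return borel (x, y)) {z. fst z \<in> A} \<partial>\<kappa> x)"
      by (rule emeasure_bind_prob_algebra[OF measurable_space[OF kernel] return_pair_measurable m]) simp
    also have "\<dots> = (\<integral>\<^sup>+y. indicator A x \<partial>\<kappa> x)"
      using m by (intro nn_integral_cong) (auto simp: emeasure_return indicator_def)
    also have "\<dots> = indicator A x"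
      using prob_space.emeasure_space_1[OF prob_space_kernel] by simp
    finally show ?thesis .
  qed
  then have "emeasure (pair_law \<rho> \<kappa>) {z. fst z \<in> A} = (\<integral>\<^sup>+x. indicator A x \<partial>\<rho>)"
    unfolding pair_law_def by (subst emeasure_bind_prob_algebra[OF law_in_prob_algebra pair_kernel_measurable m]) simp
  also have "\<dots> = emeasure \<rho> A" using A by simp
  finally show ?thesis by (simp add: measure_def)
qed

lemma prob_space_data_law: "prob_space (data_law n \<rho> \<kappa>)"
  unfolding data_law_def by (rule prob_space_PiM) (rule prob_space_pair_law)

lemma AE_data_law:
  assumes Q: "AE z in pair_law \<rho> \<kappa>. Q z"
  shows "AE \<omega> in data_law n \<rho> \<kappa>. \<forall>j<n. Q (\<omega> j)"
proof -
  have "AE \<omega> in data_law n \<rho> \<kappa>. \<forall>j\<in>{..<n}. Q (\<omega> j)"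
    unfolding data_law_def
    by (intro eventually_ball_finite ballI AE_PiM_component prob_space_pair_law Q) auto
  then show ?thesis by (simp add: Ball_def)
qed

text \<open>Hoeffding's inequality for the number of hits, whose mean is at least n q: a fall to n q
  / 2 is a deviation t >= n q / 2, and 2 t^2 / n >= n q^2 / 2.\<close>

lemma few_samples_prob:
  assumes A: "A \<in> sets borel" and q: "0 < q" "q \<le> prob A" and n: "n > 0"
  shows "measure (data_law n \<rho> \<kappa>) {\<omega> \<in> space (data_law n \<rho> \<kappa>). (\<Sum>j<n. indicator A (fst (\<omega> j)) :: real) \<le> real n * q / 2}
    \<le> exp (- real n * q\<^sup>2 / 2)"
proof -
  interpret D: prob_space "data_law n \<rho> \<kappa>" by (rule prob_space_data_law)
  interpret Z: prob_space "pair_law \<rho> \<kappa>" by (rule prob_space_pair_law)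
  define g where "g z = (indicator A (fst z) :: real)" for z :: "(real ^ 'N) \<times> (real ^ 'N)"
  have [measurable]: "A \<in> sets borel" by (rule A)
  have gm [measurable]: "g \<in> borel_measurable borel"
    unfolding g_def borel_prod[symmetric] by measurable
  have co: "(\<lambda>\<omega>. \<omega> j) \<in> data_law n \<rho> \<kappa> \<rightarrow>\<^sub>M pair_law \<rho> \<kappa>" if "j \<in> {..<n}" for j
    unfolding data_law_def using that by (rule measurable_component_singleton)
  have dist: "distr (data_law n \<rho> \<kappa>) (pair_law \<rho> \<kappa>) (\<lambda>\<omega>. \<omega> j) = pair_law \<rho> \<kappa>" if "j \<in> {..<n}" for j
    unfolding data_law_def using that by (intro distr_PiM_component) (auto intro: prob_space_pair_law)
  \<comment> \<open>The coordinates are independent because their joint law is the product measure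
    itself.\<close>
  have "D.indep_vars (\<lambda>_. pair_law \<rho> \<kappa>) (\<lambda>j \<omega>. \<omega> j) {..<n}"
  proof (subst D.indep_vars_iff_distr_eq_PiM')
    have "distr (data_law n \<rho> \<kappa>) (Pi\<^sub>M {..<n} (\<lambda>_. pair_law \<rho> \<kappa>)) (\<lambda>\<omega>. \<lambda>j\<in>{..<n}. \<omega> j)
       = distr (data_law n \<rho> \<kappa>) (data_law n \<rho> \<kappa>) (\<lambda>\<omega>. \<omega>)"
      by (rule distr_cong) (auto simp: data_law_def space_PiM PiE_def extensional_restrict)
    also have "\<dots> = data_law n \<rho> \<kappa>" by (rule distr_id)
    also have "\<dots> = Pi\<^sub>M {..<n} (\<lambda>j. distr (data_law n \<rho> \<kappa>) (pair_law \<rho> \<kappa>) (\<lambda>\<omega>. \<omega> j))"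
      unfolding data_law_def[of n \<rho> \<kappa>] by (intro PiM_cong refl dist[unfolded data_law_def, symmetric])
    finally show "distr (data_law n \<rho> \<kappa>) (Pi\<^sub>M {..<n} (\<lambda>_. pair_law \<rho> \<kappa>)) (\<lambda>\<omega>. \<lambda>j\<in>{..<n}. \<omega> j)
       = Pi\<^sub>M {..<n} (\<lambda>j. distr (data_law n \<rho> \<kappa>) (pair_law \<rho> \<kappa>) (\<lambda>\<omega>. \<omega> j))" .
  qed (use n co in auto)
  then have ind: "D.indep_vars (\<lambda>_. borel) (\<lambda>j \<omega>. g (\<omega> j)) {..<n}"
    by (rule D.indep_vars_compose2) measurable
  interpret H: Hoeffding_ineq "data_law n \<rho> \<kappa>" "{..<n}" "\<lambda>j \<omega>. g (\<omega> j)" "\<lambda>_. 0" "\<lambda>_. 1"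
      "\<Sum>j<n. D.expectation (\<lambda>\<omega>. g (\<omega> j))"
  proof unfold_locales
    show "D.indep_vars (\<lambda>_. borel) (\<lambda>j \<omega>. g (\<omega> j)) {..<n}" by (rule ind)
    show "AE \<omega> in data_law n \<rho> \<kappa>. g (\<omega> j) \<in> {0..1}" for j
      by (rule AE_I2) (simp add: g_def indicator_def)
  qed auto
  have E: "D.expectation (\<lambda>\<omega>. g (\<omega> j)) = prob A" if j: "j \<in> {..<n}" for j
  proof -
    have "D.expectation (\<lambda>\<omega>. g (\<omega> j)) = Z.expectation g"
    proof -
      have "Z.expectation g = integral\<^sup>L (distr (data_law n \<rho> \<kappa>) (pair_law \<rho> \<kappa>) (\<lambda>\<omega>. \<omega> j)) g"
        by (simp only: dist[OF j])
      also have "\<dots> = D.expectation (\<lambda>\<omega>. g (\<omega> j))"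
        by (rule integral_distr[OF co[OF j]]) measurable
      finally show ?thesis ..
    qed
    also have "\<dots> = Z.expectation (indicator {z. fst z \<in> A})"
      by (intro Bochner_Integration.integral_cong) (auto simp: g_def indicator_def)
    also have "\<dots> = prob A"
      using pair_law_fst[OF A] sets_eq_imp_space_eq[OF sets_pair_law] by simp
    finally show ?thesis .
  qed
  \<comment> \<open>Chosen so that the mean minus \<open>t\<close> is exactly n q / 2, whatever the
    true mass of \<open>A\<close>.\<close>
  define t where "t = real n * prob A - real n * q / 2"
  have t: "t \<ge> real n * q / 2"
    using mult_left_mono[OF q(2), of "real n"] by (simp add: t_def mult.commute)
  have nq: "real n * q / 2 \<ge> 0" using q by simp
  have "measure (data_law n \<rho> \<kappa>) {\<omega> \<in> space (data_law n \<rho> \<kappa>). (\<Sum>j<n. g (\<omega> j)) \<le> (\<Sum>j<n. D.expectation (\<lambda>\<omega>. g (\<omega> j))) - t}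
     \<le> exp (- 2 * t\<^sup>2 / (\<Sum>j<n. (1 - 0)\<^sup>2))"
    using t nq n by (intro H.Hoeffding_ineq_le) auto
  also have "(\<Sum>j<n. D.expectation (\<lambda>\<omega>. g (\<omega> j))) - t = real n * q / 2"
    by (simp add: E t_def)
  also have "exp (- 2 * t\<^sup>2 / (\<Sum>j<n. (1 - 0)\<^sup>2)) \<le> exp (- real n * q\<^sup>2 / 2)"
  proof -
    have "(real n * q / 2)\<^sup>2 \<le> t\<^sup>2" using t nq by (intro power_mono) auto
    then have "2 * (real n * q / 2)\<^sup>2 / real n \<le> 2 * t\<^sup>2 / real n" by (intro divide_right_mono) auto
    moreover have "2 * (real n * q / 2)\<^sup>2 / real n = real n * q\<^sup>2 / 2"
      using n by (simp add: power2_eq_square)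
    ultimately show ?thesis by simp
  qed
  finally show ?thesis by (simp add: g_def)
qed

text \<open>Union bound over the M ^ N cells. The event concerns initial states only, so it serves
  all observables at once.\<close>

lemma all_cells_sampled_prob:
  fixes M n :: nat and \<epsilon> :: real
  defines "q \<equiv> (1 / (2 * real M)) ^ CARD('N)"
  assumes M: "M > 0" and n: "n > 0"
    and large: "real M ^ CARD('N) * exp (- real n * q\<^sup>2 / 2) \<le> \<epsilon>"
  obtains E where "E \<in> sets (data_law n \<rho> \<kappa>)" "measure (data_law n \<rho> \<kappa>) E \<ge> 1 - \<epsilon>"
    "\<And>\<omega> a. \<omega> \<in> E \<Longrightarrow> a \<in> grid M \<Longrightarrow> real n * q / 2 \<le> (\<Sum>j<n. indicator (cell M a) (fst (\<omega> j)))"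
proof -
  interpret D: prob_space "data_law n \<rho> \<kappa>" by (rule prob_space_data_law)
  define B where "B a = {\<omega> \<in> space (data_law n \<rho> \<kappa>). (\<Sum>j<n. indicator (cell M a) (fst (\<omega> j)) :: real) \<le> real n * q / 2}" for a
  have q: "q > 0" using M by (simp add: q_def)
  have cm: "cell M a \<in> sets borel" for a :: "nat ^ 'N" by (simp add: cell_def)
  have g: "(\<lambda>z. indicator (cell M a) (fst z) :: real) \<in> borel_measurable (pair_law \<rho> \<kappa>)" for a :: "nat ^ 'N"
  proof -
    have [measurable]: "cell M a \<in> sets borel" by (rule cm)
    show ?thesis by (simp add: measurable_cong_sets[OF sets_pair_law refl] borel_prod[symmetric])
  qed
  have "(\<lambda>\<omega>. indicator (cell M a) (fst (\<omega> j)) :: real) \<in> borel_measurable (data_law n \<rho> \<kappa>)" if "j \<in> {..<n}" for a :: "nat ^ 'N" and j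
    unfolding data_law_def by (rule measurable_compose[OF measurable_component_singleton[OF that] g])
  then have Bm: "B a \<in> sets (data_law n \<rho> \<kappa>)" for a
    unfolding B_def by measurable
  have Bp: "D.prob (B a) \<le> exp (- real n * q\<^sup>2 / 2)" if "a \<in> grid M" for a
    unfolding B_def using few_samples_prob[OF cm q _ n] prob_cell[OF that M] by (simp add: q_def)
  define E where "E = space (data_law n \<rho> \<kappa>) - (\<Union>a\<in>grid M. B a)"
  have Um: "(\<Union>a\<in>grid M. B a) \<in> D.events" using Bm finite_grid by auto
  have "D.prob (\<Union>a\<in>grid M. B a) \<le> (\<Sum>a\<in>grid M. D.prob (B a))"
    using Bm finite_grid by (intro D.finite_measure_subadditive_finite) auto
  also have "\<dots> \<le> (\<Sum>a\<in>(grid M :: (nat ^ 'N) set). exp (- real n * q\<^sup>2 / 2))"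
    by (intro sum_mono Bp)
  also have "\<dots> \<le> \<epsilon>" using large by (simp add: card_grid)
  finally have "D.prob E \<ge> 1 - \<epsilon>"
    unfolding E_def using D.prob_compl[OF Um] by simp
  moreover have "E \<in> D.events" unfolding E_def using Um by auto
  ultimately show ?thesis
    by (intro that) (auto simp: E_def B_def)
qed

end

section \<open>Sampling inequality on the polynomial space\<close>

context graded_polys
begin

lemma continuous_comb: "continuous_on A (comb d c)"
  unfolding comb_def tensor_poly_def by (intro continuous_intros)

text \<open>The maximum is attained in some cell on which the polynomial keeps half of its size, and that
  cell contains a fixed fraction of the samples.\<close>

lemma comb_norm_equivalence:
  fixes x :: "nat \<Rightarrow> real ^ 'N" and c :: "nat ^ 'N \<Rightarrow> complex" and d :: nat
  defines "M \<equiv> 8 * CARD('N) * d ^ 3"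
  assumes d: "d > 0" and n: "n > 0" and q: "q > 0"
    and cells: "\<And>a. a \<in> grid M \<Longrightarrow> real n * q / 2 \<le> (\<Sum>j<n. indicator (cell M a) (x j))"
    and y: "y \<in> cube"
  shows "(cmod (comb d c y))\<^sup>2 \<le> 8 / (real n * q) * (\<Sum>j<n. (cmod (comb d c (x j)))\<^sup>2)"
proof -
  have ne: "(cube :: (real ^ 'N) set) \<noteq> {}" using y by auto
  obtain z where z: "z \<in> cube" "\<And>y. y \<in> cube \<Longrightarrow> cmod (comb d c y) \<le> cmod (comb d c z)"
    using continuous_attains_sup[OF compact_cube ne, of "\<lambda>y. cmod (comb d c y)"]
    by (auto intro!: continuous_on_norm continuous_comb)
  define B where "B = cmod (comb d c z)"
  have M0: "M > 0" using d by (simp add: M_def)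
  obtain a where a: "a \<in> grid M" "z \<in> cell M a" using cell_cover[OF M0 z(1)] .
  \<comment> \<open>The l1 diameter of a cell is at most 2 N / M, so the variation is at most 4 N
    d^3 B / M, which is B / 2 for this \<open>M\<close>.\<close>
  have half: "B / 2 \<le> cmod (comb d c w)" if w: "w \<in> cell M a" for w
  proof -
    have "cmod (comb d c z - comb d c w) \<le> 2 * real d ^ 3 * B * (\<Sum>k\<in>UNIV. \<bar>z $ k - w $ k\<bar>)"
      using z w cell_subset_cube[OF a(1)] unfolding B_def by (intro comb_lipschitz) auto
    also have "\<dots> \<le> 2 * real d ^ 3 * B * (\<Sum>k\<in>(UNIV :: 'N set). 2 / real M)"
      unfolding B_def by (intro mult_left_mono sum_mono cell_diameter[OF a(2) w]) auto
    also have "\<dots> = B / 2"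
      using d unfolding M_def by (simp add: field_simps)
    finally have "cmod (comb d c z - comb d c w) \<le> B / 2" .
    moreover have "B \<le> cmod (comb d c w) + cmod (comb d c z - comb d c w)"
      unfolding B_def by (metis norm_triangle_sub)
    ultimately show ?thesis by linarith
  qed
  \<comment> \<open>At least n q / 2 samples in the cell contribute B^2 / 4 each, whence the factor
    8 / (n q).\<close>
  have "real n * q / 2 * (B / 2)\<^sup>2 \<le> (\<Sum>j<n. indicator (cell M a) (x j)) * (B / 2)\<^sup>2"
    by (intro mult_right_mono cells a) auto
  also have "\<dots> = (\<Sum>j<n. indicator (cell M a) (x j) * (B / 2)\<^sup>2)" by (rule sum_distrib_right)
  also have "\<dots> \<le> (\<Sum>j<n. (cmod (comb d c (x j)))\<^sup>2)"
  proof (intro sum_mono)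
    fix j
    show "indicator (cell M a) (x j) * (B / 2)\<^sup>2 \<le> (cmod (comb d c (x j)))\<^sup>2"
    proof (cases "x j \<in> cell M a")
      case True
      then have "(B / 2)\<^sup>2 \<le> (cmod (comb d c (x j)))\<^sup>2"
        by (intro power_mono half) (auto simp: B_def)
      then show ?thesis using True by simp
    qed simp
  qed
  finally have "B\<^sup>2 \<le> 8 / (real n * q) * (\<Sum>j<n. (cmod (comb d c (x j)))\<^sup>2)"
    using n q by (simp add: field_simps power_divide)
  moreover have "(cmod (comb d c y))\<^sup>2 \<le> B\<^sup>2"
    unfolding B_def by (intro power_mono z y) auto
  ultimately show ?thesis by linarith
qed

end

section \<open>Approximation rate and least squares error\<close>

lemma of_real_in_bernstein_ellipse:
  assumes "-1 \<le> s" "s \<le> 1" "1 \<le> r"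
  shows "complex_of_real s \<in> bernstein_ellipse r"
proof -
  have "complex_of_real s = (cis (arccos s) + inverse (cis (arccos s))) / 2"
    using assms by (simp add: complex_eq_iff)
  then show ?thesis
    unfolding bernstein_ellipse_def by (intro CollectI exI[of _ "cis (arccos s)"] conjI) (use assms in simp_all)
qed

lemma complexify_in_polyellipse:
  assumes "x \<in> cube" "\<And>k. 1 < r $ k"
  shows "complexify x \<in> bernstein_polyellipse r"
  unfolding bernstein_polyellipse_def complexify_def
  using assms of_real_in_bernstein_ellipse[OF _ _ less_imp_le] by (simp add: cube_def)

lemma compact_bernstein_ellipse: "compact (bernstein_ellipse r)"
proof -
  have "bernstein_ellipse r = (\<lambda>z. (z + inverse z) / 2) ` {z. 1 \<le> cmod z \<and> cmod z \<le> r}"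
    by (auto simp: bernstein_ellipse_def)
  moreover have "compact {z. 1 \<le> cmod z \<and> cmod z \<le> r}"
    unfolding compact_eq_bounded_closed
  proof (intro conjI)
    show "bounded {z. 1 \<le> cmod z \<and> cmod z \<le> r}"
      by (rule boundedI[of _ r]) auto
    show "closed {z. 1 \<le> cmod z \<and> cmod z \<le> r}"
      by (intro closed_Collect_conj closed_Collect_le continuous_intros)
  qed
  moreover have "continuous_on {z. 1 \<le> cmod z \<and> cmod z \<le> r} (\<lambda>z. (z + inverse z) / 2)"
    by (intro continuous_intros ballI) auto
  ultimately show ?thesis
    by (simp only: compact_continuous_image)
qed

lemma compact_bernstein_polyellipse: "compact (bernstein_polyellipse r)"
  unfolding compact_eq_bounded_closed
proof (intro conjI)
  have "bernstein_polyellipse r = (\<Inter>k. (\<lambda>z. z $ k) -` bernstein_ellipse (r $ k))"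
    by (auto simp: bernstein_polyellipse_def)
  moreover have "closed ((\<lambda>z. z $ k) -` bernstein_ellipse (r $ k))" for k
    by (intro closed_vimage compact_imp_closed compact_bernstein_ellipse continuous_intros)
  ultimately show "closed (bernstein_polyellipse r)" by auto
  have "\<exists>b. \<forall>z\<in>bernstein_ellipse (r $ k). cmod z \<le> b" for k
    using compact_imp_bounded[OF compact_bernstein_ellipse] by (simp add: bounded_iff)
  then obtain b where b: "\<And>k z. z \<in> bernstein_ellipse (r $ k) \<Longrightarrow> cmod z \<le> b k" by metis
  show "bounded (bernstein_polyellipse r)"
  proof (rule boundedI)
    fix z assume z: "z \<in> bernstein_polyellipse r"
    have "norm z \<le> (\<Sum>k\<in>UNIV. cmod (z $ k))"
      unfolding norm_vec_def by (rule L2_set_le_sum) auto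
    also have "\<dots> \<le> (\<Sum>k\<in>UNIV. b k)"
      using z by (intro sum_mono b) (auto simp: bernstein_polyellipse_def)
    finally show "norm z \<le> (\<Sum>k\<in>UNIV. b k)" .
  qed
qed

lemma holomorphic_several_continuous:
  assumes "holomorphic_several F A" shows "continuous_on A F"
proof -
  obtain U where U: "open U" "A \<subseteq> U" "\<forall>z\<in>U. \<exists>D. (F has_derivative D) (at z) \<and> (\<forall>c v. D (c *s v) = c * D v)"
    using assms unfolding holomorphic_several_def by blast
  show ?thesis
  proof (intro continuous_at_imp_continuous_on ballI)
    fix z assume "z \<in> A"
    then obtain D where "(F has_derivative D) (at z)" using U by blast
    then show "isCont F z" by (rule has_derivative_continuous)
  qed
qed

text \<open>A real \<open>SUP\<close> is an upper bound only for a set that is bounded above;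
  continuity on the compact polyellipse supplies this.\<close>

lemma polyellipse_sup_norm_upper:
  assumes "holomorphic_several F (bernstein_polyellipse r)" "z \<in> bernstein_polyellipse r"
  shows "cmod (F z) \<le> polyellipse_sup_norm r F"
  unfolding polyellipse_sup_norm_def
proof (rule cSUP_upper[OF assms(2)])
  have "compact ((\<lambda>z. cmod (F z)) ` bernstein_polyellipse r)"
    using holomorphic_several_continuous[OF assms(1)]
    by (intro compact_continuous_image compact_bernstein_polyellipse continuous_on_norm)
  then show "bdd_above ((\<lambda>z. cmod (F z)) ` bernstein_polyellipse r)"
    by (intro bounded_imp_bdd_above compact_imp_bounded)
qed

lemma vec_upd_has_derivative:
  fixes w :: "complex ^ 'N"
  shows "((\<lambda>z. vec_upd w k z) has_derivative (\<lambda>c. c *s axis k 1)) (at z)"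
proof -
  have "linear (\<lambda>c :: complex. c *s (axis k 1 :: complex ^ 'N))"
  proof (rule linearI)
    show "(b + c) *s (axis k 1 :: complex ^ 'N) = b *s axis k 1 + c *s axis k 1" for b c :: complex
      by (rule vector_sadd_rdistrib)
    show "(s *\<^sub>R c) *s (axis k 1 :: complex ^ 'N) = s *\<^sub>R (c *s axis k 1)" for s and c :: complex
      by (simp add: vec_eq_iff)
  qed
  then have "bounded_linear (\<lambda>c :: complex. c *s (axis k 1 :: complex ^ 'N))"
    by (rule linear_conv_bounded_linear[THEN iffD1])
  from has_derivative_add[OF has_derivative_const[of "vec_upd w k 0"] bounded_linear_imp_has_derivative[OF this]]
  have "((\<lambda>z. vec_upd w k 0 + z *s axis k 1) has_derivative (\<lambda>c. c *s axis k 1)) (at z)"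
    by simp
  moreover have "vec_upd w k 0 + z *s axis k 1 = vec_upd w k z" for z
    by (simp add: vec_eq_iff vec_upd_nth axis_def)
  ultimately show ?thesis by (simp only:)
qed

text \<open>With all coordinates but \<open>k\<close> frozen at real values, which belong to their
  ellipses, \<open>F\<close> becomes a function of one variable. Complex linearity of the Frechet
  derivative makes it holomorphic near the ellipse of coordinate \<open>k\<close>. Approximation by
  frequencies up to \<open>e\<close> matches interpolation at \<open>Suc e\<close> nodes.\<close>

lemma polyellipse_cheb_op_error:
  fixes F :: "complex ^ 'N \<Rightarrow> complex"
  assumes hol: "holomorphic_several F (bernstein_polyellipse r)" and r: "\<And>k. 1 < r $ k"
    and x: "x \<in> cube"
  shows "cmod (F (complexify x) - cheb_op (Suc e) k (\<lambda>x. F (complexify x)) x)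
    \<le> (1 + 2 * real (Suc e)) * (polyellipse_sup_norm r F * (r $ k + 1) / (r $ k - 1) / (r $ k) ^ e)"
proof -
  obtain U where U: "open U" "bernstein_polyellipse r \<subseteq> U"
      "\<And>z. z \<in> U \<Longrightarrow> \<exists>D. (F has_derivative D) (at z) \<and> (\<forall>c v. D (c *s v) = c * D v)"
    using hol unfolding holomorphic_several_def by blast
  define h where "h z = vec_upd (complexify x) k z" for z
  define V where "V = h -` U"
  have ch: "continuous_on UNIV h"
    unfolding h_def by (intro continuous_at_imp_continuous_on ballI has_derivative_continuous[OF vec_upd_has_derivative])
  have V: "open V" unfolding V_def using U(1) ch by (simp add: open_vimage)
  have hE: "h z \<in> bernstein_polyellipse r" if "z \<in> bernstein_ellipse (r $ k)" for z
    using complexify_in_polyellipse[OF x r] that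
    by (auto simp: bernstein_polyellipse_def h_def vec_upd_nth)
  have holh: "(\<lambda>z. F (h z)) holomorphic_on V"
    unfolding holomorphic_on_open[OF V]
  proof
    fix z assume "z \<in> V"
    then obtain D where D: "(F has_derivative D) (at (h z))" "\<And>c v. D (c *s v) = c * D v"
      using U(3)[of "h z"] by (auto simp: V_def)
    have "((\<lambda>z. F (h z)) has_derivative (\<lambda>c. D (c *s axis k 1))) (at z)"
      using vec_upd_has_derivative D(1) unfolding h_def by (rule has_derivative_compose)
    then show "\<exists>f'. ((\<lambda>z. F (h z)) has_field_derivative f') (at z)"
      unfolding has_field_derivative_def D(2) by (auto simp: mult.commute[of _ "D (axis k 1)"])
  qed
  obtain a where a: "\<And>\<theta>. cmod (F (h (of_real (cos \<theta>))) - (\<Sum>k<Suc e. a k * of_real (cos (real k * \<theta>))))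
     \<le> polyellipse_sup_norm r F * (r $ k + 1) / (r $ k - 1) / (r $ k) ^ e"
    by (rule bernstein_ellipse_approx[OF r V holh, where B = "polyellipse_sup_norm r F" and d = e])
      (use hE U(2) polyellipse_sup_norm_upper[OF hol] in \<open>auto simp: V_def\<close>)
  have hx: "h (of_real s) = complexify (vec_upd x k s)" for s
    by (simp add: h_def complexify_def vec_upd_def vec_eq_iff)
  have xk: "-1 \<le> x $ k" "x $ k \<le> 1" using x by (auto simp: cube_def)
  show ?thesis
    using cheb_interpolation_error[where g = "\<lambda>s. F (h (of_real s))", OF a xk]
    by (simp only: hx cheb_op_def vec_upd_same)
qed

text \<open>The factors are the amplification by interpolation, the geometric rate for degree d - 1
  with all ellipse parameters at least \<open>R\<close>, and the telescoped norms of the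
  \<open>N\<close> coordinate operators.\<close>

definition approx_rate :: "nat \<Rightarrow> real \<Rightarrow> nat \<Rightarrow> real" where
  "approx_rate N R d = (1 + 2 * real d) * ((R + 1) / (R - 1) / R ^ (d - 1)) * (\<Sum>i<N. (2 * real d) ^ i)"

context graded_polys
begin

lemma polyellipse_comb_approx:
  fixes F :: "complex ^ 'N \<Rightarrow> complex"
  assumes hol: "holomorphic_several F (bernstein_polyellipse r)" and R: "1 < R" "\<And>k. R \<le> r $ k"
    and d: "d > 0"
  obtains c where "\<And>x. x \<in> cube \<Longrightarrow>
     cmod (F (complexify x) - comb d c x) \<le> polyellipse_sup_norm r F * approx_rate CARD('N) R d"
proof -
  define B where "B = polyellipse_sup_norm r F"
  have r: "1 < r $ k" for k using R(1) R(2)[of k] by linarith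
  obtain e where e: "d = Suc e" using d by (cases d) auto
  have "(0 :: real ^ 'N) \<in> cube" by (simp add: cube_def)
  then have B0: "B \<ge> 0"
    unfolding B_def using polyellipse_sup_norm_upper[OF hol complexify_in_polyellipse[OF _ r]] norm_ge_zero order_trans by blast
  obtain ks :: "'N list" where ks: "set ks = UNIV" "distinct ks"
    using finite_distinct_list[OF finite_class.finite_UNIV] by metis
  obtain c where c: "cheb_ops d ks (\<lambda>x. F (complexify x)) = comb d c"
    using cheb_ops_in_span[OF ks(2,1)] .
  have one: "cmod (F (complexify x) - cheb_op d k (\<lambda>x. F (complexify x)) x) \<le> (1 + 2 * real d) * (B * ((R + 1) / (R - 1) / R ^ (d - 1)))"
    if "x \<in> cube" for x k
  proof -
    \<comment> \<open>This form shows that (s + 1) / (s - 1) decreases in s, so the lower bound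
      \<open>R\<close> may replace each \<open>r $ k\<close>.\<close>
    have "(r $ k + 1) / (r $ k - 1) = 1 + 2 / (r $ k - 1)" "(R + 1) / (R - 1) = 1 + 2 / (R - 1)"
      using r[of k] R(1) by (auto simp: field_simps)
    moreover have "2 / (r $ k - 1) \<le> 2 / (R - 1)"
      using R by (intro divide_left_mono) (auto simp: less_le_trans[OF R(1)] intro!: mult_pos_pos)
    ultimately have "(r $ k + 1) / (r $ k - 1) \<le> (R + 1) / (R - 1)" by linarith
    then have "(r $ k + 1) / (r $ k - 1) / (r $ k) ^ e \<le> (R + 1) / (R - 1) / R ^ e"
      by (rule frac_le[rotated]) (use R R(2)[of k] r[of k] in \<open>auto intro!: power_mono\<close>)
    then have "B * ((r $ k + 1) / (r $ k - 1) / (r $ k) ^ e) \<le> B * ((R + 1) / (R - 1) / R ^ e)"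
      using B0 by (rule mult_left_mono)
    then have "(1 + 2 * real d) * (B * ((r $ k + 1) / (r $ k - 1) / (r $ k) ^ e)) \<le> (1 + 2 * real d) * (B * ((R + 1) / (R - 1) / R ^ e))"
      by (rule mult_left_mono) simp
    then show ?thesis
      using polyellipse_cheb_op_error[OF hol r that, of e k] unfolding e B_def by simp
  qed
  show ?thesis
  proof (rule that)
    fix x :: "real ^ 'N" assume x: "x \<in> cube"
    have len: "length ks = CARD('N)" using ks distinct_card[of ks] by simp
    show "cmod (F (complexify x) - comb d c x) \<le> polyellipse_sup_norm r F * approx_rate CARD('N) R d"
      using cheb_ops_error[of "\<lambda>x. F (complexify x)", OF one x, of ks]
      unfolding c len approx_rate_def B_def by (simp add: mult_ac)
  qed
qed

text \<open>The sampling inequality turns vanishing at the samples into vanishing on the cube, where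
  the dictionary is linearly independent.\<close>

lemma edmd_matrix_grid_unique:
  fixes \<omega> :: "nat \<Rightarrow> (real ^ 'N) \<times> (real ^ 'N)" and d :: nat
  defines "M \<equiv> 8 * CARD('N) * d ^ 3"
  assumes d: "d > 0" and n: "n > 0" and q: "q > 0"
    and cells: "\<And>a. a \<in> grid M \<Longrightarrow> real n * q / 2 \<le> (\<Sum>j<n. indicator (cell M a) (fst (\<omega> j)))"
  shows "\<exists>!K. edmd_matrix l n \<phi> (grid d) (tensor_poly P) \<omega> K"
proof (rule edmd_matrix_unique[OF finite_grid], intro ballI)
  fix g \<nu>
  assume z: "\<And>j. j < n \<Longrightarrow> (\<Sum>\<nu>\<in>grid d. g \<nu> * tensor_poly P \<nu> (fst (\<omega> j))) = 0"
    and \<nu>: "\<nu> \<in> (grid d :: (nat ^ 'N) set)"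
  have "comb d g y = 0" if "y \<in> cube" for y
  proof -
    have "(cmod (comb d g y))\<^sup>2 \<le> 8 / (real n * q) * (\<Sum>j<n. (cmod (comb d g (fst (\<omega> j))))\<^sup>2)"
      using d n q cells that unfolding M_def by (intro comb_norm_equivalence) auto
    also have "\<dots> = 0" using z by (simp add: comb_def)
    finally show ?thesis by simp
  qed
  then show "g \<nu> = 0" using \<nu> by (rule comb_eq_0_imp)
qed

text \<open>Quasi-optimality: the difference \<open>w\<close> of the least squares solution and the
  competitor \<open>c\<close> lies in the polynomial space. Both have squared residuals summing to
  at most n \<eta>^2, so \<open>w\<close> is small at the samples, and the sampling inequality
  carries this over to the whole cube.\<close>

lemma edmd_error:
  fixes \<omega> :: "nat \<Rightarrow> (real ^ 'N) \<times> (real ^ 'N)" and d :: nat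
  defines "M \<equiv> 8 * CARD('N) * d ^ 3"
  assumes d: "d > 0" and n: "n > 0" and q: "q > 0" "q \<le> 1"
    and cells: "\<And>a. a \<in> grid M \<Longrightarrow> real n * q / 2 \<le> (\<Sum>j<n. indicator (cell M a) (fst (\<omega> j)))"
    and samples: "\<And>j. j < n \<Longrightarrow> fst (\<omega> j) \<in> cube \<and> \<phi> i (snd (\<omega> j)) = G (fst (\<omega> j))"
    and K: "edmd_matrix l n \<phi> (grid d) (tensor_poly P) \<omega> K" and i: "i < l"
    and \<eta>: "\<And>y. y \<in> cube \<Longrightarrow> cmod (G y - comb d c y) \<le> \<eta>"
    and y: "y \<in> cube"
  shows "cmod (comb d (K i) y - G y) \<le> \<eta> * (1 + 6 / q)"
proof -
  define w where "w = (\<lambda>\<nu>. K i \<nu> - c \<nu>)"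
  have w: "comb d w x = comb d (K i) x - comb d c x" for x
    by (simp add: w_def comb_def left_diff_distrib sum_subtractf)
  have \<eta>0: "\<eta> \<ge> 0" using \<eta>[OF y] norm_ge_zero order_trans by blast
  have ec: "(\<Sum>j<n. (cmod (G (fst (\<omega> j)) - comb d c (fst (\<omega> j))))\<^sup>2) \<le> (\<Sum>j<n. \<eta>\<^sup>2)"
    using samples by (intro sum_mono power_mono \<eta>) auto
  have "(\<Sum>j<n. (cmod (G (fst (\<omega> j)) - comb d (K i) (fst (\<omega> j))))\<^sup>2)
      \<le> (\<Sum>j<n. (cmod (G (fst (\<omega> j)) - comb d c (fst (\<omega> j))))\<^sup>2)"
    using edmd_matrix_row[OF K i, of c] samples by (simp add: comb_def)
  then have eK: "(\<Sum>j<n. (cmod (G (fst (\<omega> j)) - comb d (K i) (fst (\<omega> j))))\<^sup>2) \<le> (\<Sum>j<n. \<eta>\<^sup>2)"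
    using ec by linarith
  have par: "(cmod (comb d w x))\<^sup>2 \<le> 2 * (cmod (G x - comb d (K i) x))\<^sup>2 + 2 * (cmod (G x - comb d c x))\<^sup>2" for x
  proof -
    have "cmod (comb d w x) \<le> cmod (G x - comb d (K i) x) + cmod (G x - comb d c x)"
      unfolding w using norm_triangle_ineq4[of "G x - comb d c x" "G x - comb d (K i) x"] by simp
    then have "(cmod (comb d w x))\<^sup>2 \<le> (cmod (G x - comb d (K i) x) + cmod (G x - comb d c x))\<^sup>2"
      by (intro power_mono) auto
    also have "\<dots> \<le> 2 * (cmod (G x - comb d (K i) x))\<^sup>2 + 2 * (cmod (G x - comb d c x))\<^sup>2"
      using sum_squares_bound[of "cmod (G x - comb d (K i) x)" "cmod (G x - comb d c x)"]
      by (simp add: power2_sum)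
    finally show ?thesis .
  qed
  have "(\<Sum>j<n. (cmod (comb d w (fst (\<omega> j))))\<^sup>2) \<le> (\<Sum>j<n. 2 * (cmod (G (fst (\<omega> j)) - comb d (K i) (fst (\<omega> j))))\<^sup>2
      + 2 * (cmod (G (fst (\<omega> j)) - comb d c (fst (\<omega> j))))\<^sup>2)"
    by (intro sum_mono par)
  also have "\<dots> \<le> 2 * (\<Sum>j<n. \<eta>\<^sup>2) + 2 * (\<Sum>j<n. \<eta>\<^sup>2)"
    unfolding sum.distrib sum_distrib_left[symmetric] using ec eK by linarith
  finally have sw: "(\<Sum>j<n. (cmod (comb d w (fst (\<omega> j))))\<^sup>2) \<le> 4 * real n * \<eta>\<^sup>2" by simp
  have "(cmod (comb d w y))\<^sup>2 \<le> 8 / (real n * q) * (\<Sum>j<n. (cmod (comb d w (fst (\<omega> j))))\<^sup>2)"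
    using d n q(1) cells y unfolding M_def by (intro comb_norm_equivalence) auto
  also have "\<dots> \<le> 8 / (real n * q) * (4 * real n * \<eta>\<^sup>2)"
    using q n by (intro mult_left_mono sw) auto
  also have "\<dots> = 32 * \<eta>\<^sup>2 / q" using n by simp
  \<comment> \<open>Weakening 32 / q to 36 / q^2, by q <= 1, makes the bound a perfect
    square.\<close>
  also have "\<dots> \<le> 36 * \<eta>\<^sup>2 / (q * q)"
  proof -
    have "32 * \<eta>\<^sup>2 * q \<le> 36 * \<eta>\<^sup>2 * 1" using q by (intro mult_mono) auto
    then show ?thesis using q by (simp add: field_simps)
  qed
  also have "\<dots> = (6 * \<eta> / q)\<^sup>2" by (simp add: power2_eq_square)
  finally have "cmod (comb d w y) \<le> 6 * \<eta> / q"
    using \<eta>0 q by (intro power2_le_imp_le[of "cmod (comb d w y)"]) auto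
  moreover have "cmod (comb d (K i) y - G y) \<le> cmod (comb d w y) + cmod (G y - comb d c y)"
    unfolding w using norm_triangle_ineq4[of "comb d (K i) y - comb d c y" "G y - comb d c y"] by simp
  ultimately show ?thesis using \<eta>[OF y] by (simp add: algebra_simps)
qed

end

lemma (in cube_prob) L2_bounded:
  assumes m: "f \<in> borel_measurable borel" and b: "AE x in \<rho>. cmod (f x) \<le> \<delta>" and \<delta>: "\<delta> \<ge> 0"
  shows "f \<in> L2 \<rho>" "L2_norm \<rho> f \<le> \<delta>"
proof -
  have [measurable]: "f \<in> borel_measurable \<rho>"
    using m by (simp add: measurable_cong_sets[OF sets_eq_borel refl])
  have b2: "AE x in \<rho>. (cmod (f x))\<^sup>2 \<le> \<delta>\<^sup>2"
    using b by eventually_elim (auto intro: power_mono)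
  have int: "integrable \<rho> (\<lambda>x. (cmod (f x))\<^sup>2)"
    by (rule integrable_const_bound[of _ "\<delta>\<^sup>2"]) (use b2 in auto)
  then show "f \<in> L2 \<rho>" by (simp add: L2_def)
  have "(LINT x|\<rho>. (cmod (f x))\<^sup>2) \<le> (LINT x|\<rho>. \<delta>\<^sup>2)"
    by (rule integral_mono_AE[OF int _ b2]) simp
  also have "\<dots> = \<delta>\<^sup>2" by (simp add: prob_space)
  finally show "L2_norm \<rho> f \<le> \<delta>"
    unfolding L2_norm_def using \<delta> by (intro real_le_lsqrt) (auto intro: integral_nonneg_AE)
qed

text \<open>Smallest value of $n / \log (n / \epsilon)$ for which the tensor grid of degree below \<open>d\<close> is
  used; it is $2 / q^2$ for the guaranteed mass $q$ of the cells used for degree \<open>d\<close>.\<close>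

definition grid_threshold :: "nat \<Rightarrow> nat \<Rightarrow> real" where
  "grid_threshold N d = 2 * (16 * real N * real d ^ 3) ^ (2 * N)"

lemma power_le_fact_mult_exp:
  assumes "(x::real) \<ge> 0" shows "x ^ k \<le> fact k * exp x"
proof -
  have "(\<Sum>n\<in>{k}. x ^ n /\<^sub>R fact n) \<le> (\<Sum>n. x ^ n /\<^sub>R fact n)"
    using assms summable_exp_generic[of x] by (intro sum_le_suminf) auto
  then show ?thesis by (simp add: exp_def field_simps)
qed

text \<open>Apart from the decay of R ^ (- d), all factors grow at most like powers of d + 1, so the
  product stays bounded. The threshold is taken at \<open>Suc d\<close> because it bounds from above
  the values of m for which grid size \<open>d\<close> is used.\<close>

lemma approx_rate_superalgebraic:
  assumes R: "R > 1" and N: "N > 0" and a: "a \<ge> 0"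
  obtains C where "\<And>d. approx_rate N R d * (1 + 6 * (16 * real N * real d ^ 3) ^ N) * grid_threshold N (Suc d) powr a \<le> C"
proof -
  define s where "s = nat \<lceil>a\<rceil>"
  have s: "a \<le> real s" unfolding s_def using a by linarith
  \<comment> \<open>The factor R ^ 2 trades R ^ (d - 1) for R ^ (d + 1), also for d = 0, where the
    truncated exponent is 0.\<close>
  define A where "A = (R + 1) / (R - 1) * R ^ 2"
  have A: "A \<ge> 0" using R by (simp add: A_def)
  \<comment> \<open>The exponents of d + 1 contributed by 1 + 2 d, by the sum of powers, by the
    factor standing for 1 + 6 / q, and by the threshold to the power \<open>s\<close>.\<close>
  define J where "J = 1 + N + 3 * N + 3 * (2 * N) * s"
  define c where "c = 2 * A * (real N * 2 ^ N) * (7 * (16 * real N) ^ N) * (2 * (16 * real N) ^ (2 * N)) ^ s"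
  have c0: "c \<ge> 0" using A by (simp add: c_def)
  have "approx_rate N R d * (1 + 6 * (16 * real N * real d ^ 3) ^ N) * grid_threshold N (Suc d) powr a
     \<le> c * (fact J / ln R ^ J)" for d
  proof -
    define x where "x = real (Suc d)"
    have x: "x \<ge> 1" "real d \<le> x" by (auto simp: x_def)
    have N1: "real N \<ge> 1" using N by simp
    have 1: "1 + 2 * real d \<le> 2 * x" by (simp add: x_def)
    have 2: "(R + 1) / (R - 1) / R ^ (d - 1) \<le> A / R ^ Suc d"
    proof -
      have "R ^ Suc d \<le> R ^ 2 * R ^ (d - 1)"
        unfolding power_add[symmetric] using R by (intro power_increasing) auto
      then have "(R + 1) / (R - 1) * R ^ Suc d \<le> (R + 1) / (R - 1) * (R ^ 2 * R ^ (d - 1))"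
        using R by (intro mult_left_mono) auto
      then show ?thesis using R unfolding A_def
        by (simp only: divide_le_eq pos_le_divide_eq zero_less_power) (simp add: pos_divide_le_eq pos_le_divide_eq mult_ac)
    qed
    have 3: "(\<Sum>i<N. (2 * real d) ^ i) \<le> real N * 2 ^ N * x ^ N"
    proof -
      have "(\<Sum>i<N. (2 * real d) ^ i) \<le> (\<Sum>i<N. (2 * x) ^ N)"
      proof (intro sum_mono)
        fix i assume "i \<in> {..<N}"
        then have "(2 * x) ^ i \<le> (2 * x) ^ N" using x by (intro power_increasing) auto
        moreover have "(2 * real d) ^ i \<le> (2 * x) ^ i" using x by (intro power_mono) auto
        ultimately show "(2 * real d) ^ i \<le> (2 * x) ^ N" by linarith
      qed
      then show ?thesis by (simp add: power_mult_distrib)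
    qed
    have b1: "(16 * real N * x ^ 3) ^ N \<ge> 1"
      using N1 x by (intro one_le_power) (auto intro!: mult_ge1_I simp: one_le_power)
    have b2: "(16 * real N * real d ^ 3) ^ N \<le> (16 * real N * x ^ 3) ^ N"
      using x by (intro power_mono mult_left_mono) auto
    have 4: "1 + 6 * (16 * real N * real d ^ 3) ^ N \<le> 7 * (16 * real N) ^ N * x ^ (3 * N)"
    proof -
      have "7 * (16 * real N) ^ N * x ^ (3 * N) = 7 * (16 * real N * x ^ 3) ^ N"
        by (simp add: power_mult_distrib power_mult)
      then show ?thesis using b1 b2 by linarith
    qed
    have t: "grid_threshold N (Suc d) = 2 * (16 * real N) ^ (2 * N) * x ^ (3 * (2 * N))"
      by (simp add: grid_threshold_def x_def[symmetric] power_mult_distrib power_mult[symmetric] del: of_nat_Suc)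
    have t1: "grid_threshold N (Suc d) \<ge> 1"
      unfolding t using N1 x by (intro mult_ge1_I one_le_power) auto
    have "grid_threshold N (Suc d) powr a \<le> grid_threshold N (Suc d) powr real s"
      using s t1 by (rule powr_mono)
    also have "\<dots> = grid_threshold N (Suc d) ^ s"
      using t1 by (intro powr_realpow) auto
    also have "\<dots> = (2 * (16 * real N) ^ (2 * N)) ^ s * x ^ (3 * (2 * N) * s)"
      unfolding t by (simp add: power_mult_distrib power_mult)
    finally have 5: "grid_threshold N (Suc d) powr a \<le> (2 * (16 * real N) ^ (2 * N)) ^ s * x ^ (3 * (2 * N) * s)" .
    have "approx_rate N R d * (1 + 6 * (16 * real N * real d ^ 3) ^ N) * grid_threshold N (Suc d) powr a
      \<le> (2 * x) * (A / R ^ Suc d) * (real N * 2 ^ N * x ^ N) * (7 * (16 * real N) ^ N * x ^ (3 * N))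
         * ((2 * (16 * real N) ^ (2 * N)) ^ s * x ^ (3 * (2 * N) * s))"
      unfolding approx_rate_def
      by (intro mult_mono 1 2 3 4 5 mult_nonneg_nonneg sum_nonneg divide_nonneg_nonneg) (use R x A in auto)
    also have "\<dots> = c * (x ^ J / R ^ Suc d)"
    proof -
      have xJ: "x ^ J = x * x ^ N * x ^ (3 * N) * x ^ (3 * (2 * N) * s)"
        by (simp only: J_def power_add power_one_right)
      show ?thesis unfolding xJ c_def by (simp only: times_divide_eq_left times_divide_eq_right mult_ac)
    qed
    also have "x ^ J / R ^ Suc d \<le> fact J / ln R ^ J"
    proof -
      have lR: "ln R > 0" using R by simp
      have "(x * ln R) ^ J \<le> fact J * exp (x * ln R)"
        using x lR by (intro power_le_fact_mult_exp) auto
      also have "exp (x * ln R) = R ^ Suc d"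
        using R unfolding x_def by (metis exp_ln exp_of_nat_mult less_trans zero_less_one)
      finally show ?thesis using lR R by (simp add: power_mult_distrib field_simps)
    qed
    finally show ?thesis using c0 by (simp add: mult_left_mono)
  qed
  then show ?thesis by (rule that)
qed

section \<open>The error estimate for EDMD\<close>

lemma holomorphic_extension_continuous:
  assumes "holomorphic_extension \<rho> r f F" "\<And>k. 1 < r $ k"
  shows "continuous_on cube (\<lambda>x. F (complexify x))"
proof -
  have 1: "continuous_on (bernstein_polyellipse r) F"
    using assms(1) by (intro holomorphic_several_continuous) (simp add: holomorphic_extension_def)
  have 2: "continuous_on cube complexify"
    unfolding complexify_def by (intro continuous_intros)
  have 3: "complexify ` cube \<subseteq> bernstein_polyellipse r"
    using complexify_in_polyellipse assms(2) by blast
  show ?thesis by (rule continuous_on_compose2[OF 1 2 3])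
qed

context koopman_data
begin

text \<open>For noise-free observables the data of the least squares problem are almost surely exact
  values of a function continuous on the cube. The exceptional null set depends on
  \<open>F0\<close>, which is therefore fixed beforehand; the parameter \<open>r\<close> may vary
  with \<open>i\<close>.\<close>

lemma extension_AE_samples:
  fixes \<phi> :: "nat \<Rightarrow> real ^ 'N \<Rightarrow> complex" and F0 :: "nat \<Rightarrow> complex ^ 'N \<Rightarrow> complex"
  assumes \<phi>: "\<And>i. i < l \<Longrightarrow> \<phi> i \<in> L2 \<rho> \<and> noise_free \<rho> \<kappa> (\<phi> i)"
    and F0: "\<And>i. i < l \<Longrightarrow> \<exists>r. (\<forall>k. 1 < r $ k) \<and> holomorphic_extension \<rho> r (koopman \<kappa> (\<phi> i)) (F0 i)"
  shows "AE \<omega> in data_law n \<rho> \<kappa>. \<forall>j<n. fst (\<omega> j) \<in> cube \<and>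
    (\<forall>i<l. \<phi> i (snd (\<omega> j)) = F0 i (complexify (fst (\<omega> j))))"
proof (rule AE_data_law)
  \<comment> \<open>Set to 0 off the cube to obtain a Borel function, since \<open>F0 i\<close> is
    arbitrary away from its polyellipse.\<close>
  define G where "G i x = (if x \<in> cube then F0 i (complexify x) else 0)" for i x
  have cont: "continuous_on cube (\<lambda>x. F0 i (complexify x))" if i: "i < l" for i
  proof -
    obtain r where r: "\<And>k. 1 < r $ k" "holomorphic_extension \<rho> r (koopman \<kappa> (\<phi> i)) (F0 i)"
      using F0[OF i] by blast
    show ?thesis
      by (rule holomorphic_extension_continuous[OF r(2) r(1)])
  qed
  have Gm: "G i \<in> borel_measurable borel" if "i < l" for i
    unfolding G_def by (rule borel_measurable_continuous_on_if) (auto intro: cont[OF that])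
  have \<phi>m: "\<phi> i \<in> borel_measurable borel" if "i < l" for i
    using \<phi>[OF that] by (simp add: L2_def measurable_cong_sets[OF sets_eq_borel refl])
  have Q: "AE z in pair_law \<rho> \<kappa>. \<phi> i (snd z) = G i (fst z)" if i: "i < l" for i
  proof (subst AE_pair_law)
    have [measurable]: "\<phi> i \<in> borel_measurable borel" "G i \<in> borel_measurable borel"
      using \<phi>m Gm i by auto
    have "Measurable.pred (borel \<Otimes>\<^sub>M borel) (\<lambda>z. \<phi> i (snd z) = G i (fst z))" by measurable
    then show "Measurable.pred borel (\<lambda>z. \<phi> i (snd z) = G i (fst z))" by (simp only: borel_prod)
    have "AE x in \<rho>. AE y in \<kappa> x. \<phi> i y = koopman \<kappa> (\<phi> i) x"
      using \<phi>[OF i] by (simp add: noise_free_def)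
    moreover have "AE x in \<rho>. F0 i (complexify x) = koopman \<kappa> (\<phi> i) x"
      using F0[OF i] by (auto simp: holomorphic_extension_def)
    ultimately show "AE x in \<rho>. AE y in \<kappa> x. \<phi> i (snd (x, y)) = G i (fst (x, y))"
      using AE_cube by eventually_elim (auto simp: G_def)
  qed
  have "AE z in pair_law \<rho> \<kappa>. fst z \<in> cube"
  proof (subst AE_pair_law)
    have "Measurable.pred (borel \<Otimes>\<^sub>M borel) (\<lambda>z :: (real ^ 'N) \<times> (real ^ 'N). fst z \<in> cube)" by measurable
    then show "Measurable.pred borel (\<lambda>z :: (real ^ 'N) \<times> (real ^ 'N). fst z \<in> cube)" by (simp only: borel_prod)
    show "AE x in \<rho>. AE y in \<kappa> x. fst (x, y) \<in> cube"
      using AE_cube by eventually_elim auto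
  qed
  moreover have "AE z in pair_law \<rho> \<kappa>. \<forall>i\<in>{..<l}. \<phi> i (snd z) = G i (fst z)"
    by (intro eventually_ball_finite ballI Q) auto
  ultimately show "AE z in pair_law \<rho> \<kappa>. fst z \<in> cube \<and> (\<forall>i<l. \<phi> i (snd z) = F0 i (complexify (fst z)))"
    by eventually_elim (auto simp: G_def)
qed

lemma koopman_measurable:
  assumes "\<phi> \<in> borel_measurable borel"
  shows "koopman \<kappa> \<phi> \<in> borel_measurable borel"
  unfolding koopman_def
  by (rule measurable_compose[OF measurable_prob_algebraD[OF kernel] integral_measurable_subprob_algebra[OF assms]])

lemma koopman_L2_error:
  assumes \<phi>: "\<phi> \<in> L2 \<rho>" and u: "u \<in> borel_measurable borel" and \<delta>: "\<delta> \<ge> 0"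
    and ext: "AE x in \<rho>. F (complexify x) = koopman \<kappa> \<phi> x"
    and e: "\<And>x. x \<in> cube \<Longrightarrow> cmod (u x - F (complexify x)) \<le> \<delta>"
  shows "(\<lambda>x. u x - koopman \<kappa> \<phi> x) \<in> L2 \<rho> \<and> L2_norm \<rho> (\<lambda>x. u x - koopman \<kappa> \<phi> x) \<le> \<delta>"
proof -
  have "\<phi> \<in> borel_measurable borel"
    using \<phi> by (simp add: L2_def measurable_cong_sets[OF sets_eq_borel refl])
  then have m: "(\<lambda>x. u x - koopman \<kappa> \<phi> x) \<in> borel_measurable borel"
    by (intro borel_measurable_diff u koopman_measurable)
  have "AE x in \<rho>. cmod (u x - koopman \<kappa> \<phi> x) \<le> \<delta>"
    using ext AE_cube by eventually_elim (use e in force)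
  then show ?thesis using L2_bounded[OF m _ \<delta>] by blast
qed

end

section \<open>Choice of the grid size\<close>

text \<open>The threshold at 0 is 0 < m, so the first index at which it exceeds m is a successor; d
  = 0 remains possible. The third claim is the cardinality bound for the grid.\<close>

lemma grid_size_selection:
  fixes m :: real
  assumes m: "m > 0" and N: "N > 0"
  obtains d where "grid_threshold N d \<le> m" "m < grid_threshold N (Suc d)" "real d ^ N \<le> m"
proof -
  have ge: "real d ^ N \<le> grid_threshold N d \<and> real d \<le> grid_threshold N d" for d
  proof (cases "d = 0")
    case True
    then show ?thesis using N by (simp add: grid_threshold_def zero_power)
  next
    case False
    have "real d \<le> 16 * real N * real d ^ 3"
    proof -
      have "real d ^ 1 \<le> real d ^ 3" using False by (intro power_increasing) auto
      moreover have "1 * real d ^ 3 \<le> 16 * real N * real d ^ 3" using N by (intro mult_right_mono) auto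
      ultimately show ?thesis unfolding power_one_right mult_1 by linarith
    qed
    then have 1: "real d ^ (2 * N) \<le> (16 * real N * real d ^ 3) ^ (2 * N)" by (intro power_mono) auto
    have "real d ^ N \<le> real d ^ (2 * N)" "real d ^ 1 \<le> real d ^ (2 * N)"
      by (rule power_increasing; use False N in simp)+
    moreover have "0 \<le> (16 * real N * real d ^ 3) ^ (2 * N)" by simp
    ultimately show ?thesis using 1 unfolding grid_threshold_def power_one_right by linarith
  qed
  define k where "k = (LEAST k. m < grid_threshold N k)"
  obtain j where "m < real j" using reals_Archimedean2 by blast
  then have ex: "m < grid_threshold N j" using ge[of j] by linarith
  have k: "m < grid_threshold N k" unfolding k_def by (rule LeastI[of "\<lambda>k. m < grid_threshold N k", OF ex])
  have "grid_threshold N 0 = 0" using N by (simp add: grid_threshold_def)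
  then have "k \<noteq> 0" using k m by (metis less_asym)
  then obtain d where d: "k = Suc d" by (cases k) auto
  have "\<not> m < grid_threshold N d"
    using not_less_Least[of d "\<lambda>k. m < grid_threshold N k"] d unfolding k_def[symmetric] by simp
  then show ?thesis
    by (intro that[of d]) (use k d ge[of d] in auto)
qed

text \<open>The threshold equals 2 / q^2, so \<open>thr\<close> says that exp (- n q^2 / 2) is at
  most \<epsilon> / n. The number M ^ N of cells is at most the threshold and hence at most
  n.\<close>

lemma sampling_condition:
  fixes \<epsilon> :: real
  assumes \<epsilon>: "0 < \<epsilon>" "\<epsilon> < 1" and n: "3 \<le> n" and N: "N > 0" and d: "d > 0"
    and thr: "grid_threshold N d \<le> real n / ln (real n / \<epsilon>)"
  shows "real (8 * N * d ^ 3) ^ N * exp (- real n * ((1 / (2 * real (8 * N * d ^ 3))) ^ N)\<^sup>2 / 2) \<le> \<epsilon>"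
proof -
  define M where "M = real (8 * N * d ^ 3)"
  define q where "q = (1 / (2 * M)) ^ N"
  have M1: "M \<ge> 1" unfolding M_def using N d by (simp add: Suc_le_eq flip: of_nat_power of_nat_mult)
  have q0: "q > 0" unfolding q_def using M1 by simp
  have M2: "16 * real N * real d ^ 3 = 2 * M" by (simp add: M_def)
  have thr2: "grid_threshold N d = 2 / q\<^sup>2"
    by (simp add: grid_threshold_def q_def M2 power_even_eq power_divide)
  define L where "L = ln (real n / \<epsilon>)"
  \<comment> \<open>Here n >= 3 > e enters: it gives ln (n / \<epsilon>) >= 1 and thus n / ln (n /
    \<epsilon>) <= n.\<close>
  have "exp 1 \<le> real n / \<epsilon>"
  proof -
    have "exp 1 \<le> real n" using exp_le n by linarith
    also have "real n \<le> real n / \<epsilon>" using \<epsilon> n by (simp add: field_simps)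
    finally show ?thesis .
  qed
  moreover have pos: "real n / \<epsilon> > 0" using \<epsilon> n by simp
  ultimately have L1: "L \<ge> 1" unfolding L_def by (simp add: ln_ge_iff)
  have "2 / q\<^sup>2 * L \<le> real n"
    using thr L1 unfolding thr2 L_def[symmetric] by (simp add: pos_le_divide_eq)
  then have "L \<le> real n * q\<^sup>2 / 2" using q0 by (simp add: field_simps)
  then have "exp (- (real n * q\<^sup>2 / 2)) \<le> exp (- L)" by simp
  also have "exp (- L) = \<epsilon> / real n" unfolding L_def exp_minus using pos by (simp add: field_simps)
  finally have ex: "exp (- real n * q\<^sup>2 / 2) \<le> \<epsilon> / real n" by simp
  have "M ^ N \<le> (2 * M) ^ (2 * N)"
  proof -
    have "M ^ N \<le> (2 * M) ^ N" using M1 by (intro power_mono) auto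
    also have "\<dots> \<le> (2 * M) ^ (2 * N)" using M1 by (intro power_increasing) auto
    finally show ?thesis .
  qed
  also have "\<dots> \<le> 2 * (2 * M) ^ (2 * N)" using M1 by simp
  also have "\<dots> = grid_threshold N d" by (simp add: grid_threshold_def M2)
  also have "\<dots> \<le> real n / L" using thr by (simp add: L_def)
  also have "\<dots> \<le> real n" using L1 n by (simp add: divide_le_eq)
  finally have "M ^ N \<le> real n" .
  then have "M ^ N * exp (- real n * q\<^sup>2 / 2) \<le> real n * (\<epsilon> / real n)"
    using ex by (intro mult_mono) auto
  then show ?thesis using n unfolding q_def M_def by simp
qed

lemma edmd_koopman_unit:
  assumes "i < l"
  shows "edmd_koopman l I \<psi> K (unit_coeff i) x = (\<Sum>\<nu>\<in>I. K i \<nu> * \<psi> \<nu> x)"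
proof -
  have "edmd_koopman l I \<psi> K (unit_coeff i) x = (\<Sum>j<l. if j = i then \<Sum>\<nu>\<in>I. K j \<nu> * \<psi> \<nu> x else 0)"
    unfolding edmd_koopman_def unit_coeff_def by (intro sum.cong) auto
  then show ?thesis using assms by simp
qed

theorem theorem2:
  shows "\<exists>C :: real ^ 'N \<Rightarrow> real \<Rightarrow> real.
    \<forall>(\<epsilon>::real) (p::real) (n::nat) (l::nat) (\<rho> :: (real ^ 'N) measure) P
      (\<kappa> :: real ^ 'N \<Rightarrow> (real ^ 'N) measure) (\<phi> :: nat \<Rightarrow> real ^ 'N \<Rightarrow> complex).
      0 < \<epsilon> \<and> \<epsilon> < 1 \<and> 0 < p \<and> p < 1 \<and> 3 \<le> n \<and>
      (\<rho> = uniform_cube \<and> P = legendre_poly \<or> \<rho> = chebyshev_measure \<and> P = chebyshev_poly) \<and>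
      transition_kernel \<kappa> \<and> (\<forall>i<l. \<phi> i \<in> L2 \<rho> \<and> noise_free \<rho> \<kappa> (\<phi> i))
      \<longrightarrow> (\<exists>S :: nat \<Rightarrow> (nat ^ 'N) set.
        (\<forall>i<l. finite (S i) \<and> int (card (S i)) \<le> \<lceil>real n / ln (real n / \<epsilon>)\<rceil>) \<and>
        (\<exists>E \<in> sets (data_law n \<rho> \<kappa>).
          measure (data_law n \<rho> \<kappa>) E \<ge> 1 - real l * \<epsilon> \<and>
          (\<forall>\<omega>\<in>E. \<forall>(r :: real ^ 'N) (F :: nat \<Rightarrow> complex ^ 'N \<Rightarrow> complex).
            (\<forall>k. 1 < r $ k) \<and> (\<forall>i<l. holomorphic_extension \<rho> r (koopman \<kappa> (\<phi> i)) (F i))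
            \<longrightarrow> (\<exists>!K. edmd_matrix l n \<phi> (\<Union>i<l. S i) (tensor_poly P) \<omega> K) \<and>
                (\<forall>K. edmd_matrix l n \<phi> (\<Union>i<l. S i) (tensor_poly P) \<omega> K \<longrightarrow>
                  (\<forall>i<l.
                    (\<lambda>x. edmd_koopman l (\<Union>i<l. S i) (tensor_poly P) K (unit_coeff i) x
                         - koopman \<kappa> (\<phi> i) x) \<in> L2 \<rho> \<and>
                    L2_norm \<rho>
                      (\<lambda>x. edmd_koopman l (\<Union>i<l. S i) (tensor_poly P) K (unit_coeff i) x
                           - koopman \<kappa> (\<phi> i) x)
                    \<le> C r p * polyellipse_sup_norm r (F i)
                      * (real n / ln (real n / \<epsilon>)) powr (1 / 2 - 1 / p))))))"
proof -
  define N where "N = CARD('N)"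
  have N: "N > 0" by (simp add: N_def)
  \<comment> \<open>The smallest parameter governs the rate in all coordinates.\<close>
  define R where "R r = Min (range (($) r))" for r :: "real ^ 'N"
  have R: "1 < R r" "R r \<le> r $ k" if "\<forall>k. 1 < r $ k" for r k
    using that unfolding R_def by (auto intro: Min_le)
  define rate where "rate r d = approx_rate N (R r) d * (1 + 6 * (16 * real N * real d ^ 3) ^ N)" for r d
  \<comment> \<open>The constant has to absorb an empty grid, where m is below
    \<open>grid_threshold N 1\<close> and the error is at most the supremum norm, as well as the
    rate of a nonempty grid. It is obtained before all other parameters, which is what makes it
    depend on \<open>r\<close> and \<open>p\<close> only.\<close>
  have "\<exists>C. (\<forall>k. 1 < r $ k) \<and> 0 < p \<and> p < 1 \<longrightarrow>
      grid_threshold N 1 powr (1 / p - 1 / 2) \<le> C \<and> (\<forall>d. rate r d * grid_threshold N (Suc d) powr (1 / p - 1 / 2) \<le> C)" for r and p :: real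
  proof (cases "(\<forall>k. 1 < r $ k) \<and> 0 < p \<and> p < 1")
    case True
    then have "1 / p - 1 / 2 \<ge> 0" by (simp add: field_simps)
    then obtain C where C: "\<And>d. rate r d * grid_threshold N (Suc d) powr (1 / p - 1 / 2) \<le> C"
      unfolding rate_def using approx_rate_superalgebraic[OF R(1) N] True by metis
    show ?thesis
      by (intro exI[of _ "max C (grid_threshold N 1 powr (1 / p - 1 / 2))"]) (auto intro: max.coboundedI1 C)
  qed auto
  then obtain C where C: "\<And>r p. \<forall>k. 1 < r $ k \<Longrightarrow> 0 < p \<Longrightarrow> p < 1 \<Longrightarrow>
      grid_threshold N 1 powr (1 / p - 1 / 2) \<le> C r p \<and> (\<forall>d. rate r d * grid_threshold N (Suc d) powr (1 / p - 1 / 2) \<le> C r p)"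
    by metis
  show ?thesis
  proof (intro exI[of _ C] allI impI, elim conjE)
    fix \<epsilon> p :: real and n l :: nat and \<rho> :: "(real ^ 'N) measure" and P and \<kappa> :: "real ^ 'N \<Rightarrow> (real ^ 'N) measure"
      and \<phi> :: "nat \<Rightarrow> real ^ 'N \<Rightarrow> complex"
    assume \<epsilon>: "0 < \<epsilon>" "\<epsilon> < 1" and p: "0 < p" "p < 1" and n: "3 \<le> n"
      and \<rho>P: "\<rho> = uniform_cube \<and> P = legendre_poly \<or> \<rho> = chebyshev_measure \<and> P = chebyshev_poly"
      and \<kappa>: "transition_kernel \<kappa>" and \<phi>: "\<forall>i<l. \<phi> i \<in> L2 \<rho> \<and> noise_free \<rho> \<kappa> (\<phi> i)"
    interpret graded_polys P
      using \<rho>P cheb.graded_polys_axioms legendre.graded_polys_axioms by auto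
    interpret cube_prob \<rho>
      using \<rho>P cube_prob_uniform cube_prob_chebyshev by auto
    interpret koopman_data \<rho> \<kappa>
      by unfold_locales (use \<kappa> in \<open>simp add: transition_kernel_def\<close>)
    interpret D: prob_space "data_law n \<rho> \<kappa>" by (rule prob_space_data_law)
    define m where "m = real n / ln (real n / \<epsilon>)"
    have "real n / \<epsilon> > 1"
    proof -
      have "real n \<le> real n / \<epsilon>" using \<epsilon> n by (simp add: field_simps)
      then show ?thesis using n by linarith
    qed
    then have m: "m > 0" unfolding m_def using n by simp
    obtain d where d: "grid_threshold N d \<le> m" "m < grid_threshold N (Suc d)" "real d ^ N \<le> m"
      by (rule grid_size_selection[OF m N])
    \<comment> \<open>As m < \<open>grid_threshold N (Suc d)\<close>, a bound on x times a power of
      the threshold yields the required power of m.\<close>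
    have scale: "B * x \<le> C r p * B * m powr (1 / 2 - 1 / p)"
      if x: "x \<ge> 0" "x * grid_threshold N (Suc d) powr (1 / p - 1 / 2) \<le> C r p" and B: "B \<ge> 0" for x B :: real and r
    proof -
      have a: "1 / p - 1 / 2 \<ge> 0" using p by (simp add: field_simps)
      have "m powr (1 / p - 1 / 2) \<le> grid_threshold N (Suc d) powr (1 / p - 1 / 2)"
        using d(2) m a by (intro powr_mono2) auto
      then have "x * m powr (1 / p - 1 / 2) \<le> C r p"
        using mult_left_mono[OF _ x(1)] x(2) by (meson order_trans)
      then have "x * m powr (1 / p - 1 / 2) * m powr (1 / 2 - 1 / p) \<le> C r p * m powr (1 / 2 - 1 / p)"
        by (intro mult_right_mono) auto
      moreover have "x * m powr (1 / p - 1 / 2) * m powr (1 / 2 - 1 / p) = x"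
        using m by (simp add: mult.assoc flip: powr_add)
      ultimately have "B * x \<le> B * (C r p * m powr (1 / 2 - 1 / p))"
        using B by (intro mult_left_mono) auto
      then show ?thesis by (simp only: mult_ac)
    qed
    define I where "I = (\<Union>i<l. grid d :: (nat ^ 'N) set)"
    define bound where "bound \<omega> r F \<longleftrightarrow> (\<exists>!K. edmd_matrix l n \<phi> I (tensor_poly P) \<omega> K) \<and>
        (\<forall>K. edmd_matrix l n \<phi> I (tensor_poly P) \<omega> K \<longrightarrow>
          (\<forall>i<l.
            (\<lambda>x. edmd_koopman l I (tensor_poly P) K (unit_coeff i) x - koopman \<kappa> (\<phi> i) x) \<in> L2 \<rho> \<and>
            L2_norm \<rho> (\<lambda>x. edmd_koopman l I (tensor_poly P) K (unit_coeff i) x - koopman \<kappa> (\<phi> i) x)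
              \<le> C r p * polyellipse_sup_norm r (F i) * m powr (1 / 2 - 1 / p)))" for \<omega> r F
    \<comment> \<open>Passage from a supremum bound on the cube to the claim, shared by the empty
      and the nonempty dictionary with different \<open>rt\<close>.\<close>
    have boundI: "bound \<omega> r F"
      if r: "\<forall>k. 1 < r $ k" and F: "\<forall>i<l. holomorphic_extension \<rho> r (koopman \<kappa> (\<phi> i)) (F i)"
        and rt: "rt \<ge> 0" "rt * grid_threshold N (Suc d) powr (1 / p - 1 / 2) \<le> C r p"
        and uniq: "\<exists>!K. edmd_matrix l n \<phi> I (tensor_poly P) \<omega> K"
        and err: "\<And>K i y. edmd_matrix l n \<phi> I (tensor_poly P) \<omega> K \<Longrightarrow> i < l \<Longrightarrow> y \<in> cube \<Longrightarrow>
          cmod ((\<Sum>\<nu>\<in>I. K i \<nu> * tensor_poly P \<nu> y) - F i (complexify y)) \<le> polyellipse_sup_norm r (F i) * rt"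
      for \<omega> r F rt
      unfolding bound_def
    proof (intro conjI uniq allI impI)
      fix K i assume K: "edmd_matrix l n \<phi> I (tensor_poly P) \<omega> K" and i: "i < l"
      define B where "B = polyellipse_sup_norm r (F i)"
      have hol: "holomorphic_several (F i) (bernstein_polyellipse r)"
        and ae: "AE x in \<rho>. F i (complexify x) = koopman \<kappa> (\<phi> i) x"
        using F i by (auto simp: holomorphic_extension_def)
      have "(0 :: real ^ 'N) \<in> cube" by (simp add: cube_def)
      then have "cmod (F i (complexify 0)) \<le> B"
        unfolding B_def using r by (intro polyellipse_sup_norm_upper[OF hol] complexify_in_polyellipse) auto
      then have B0: "B \<ge> 0" using norm_ge_zero order_trans by blast
      have sc: "B * rt \<le> C r p * B * m powr (1 / 2 - 1 / p)"
        by (rule scale[OF rt B0])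
      have "continuous_on UNIV (\<lambda>x. edmd_koopman l I (tensor_poly P) K (unit_coeff i) x)"
        unfolding edmd_koopman_unit[OF i] tensor_poly_def by (intro continuous_intros)
      then have um: "(\<lambda>x. edmd_koopman l I (tensor_poly P) K (unit_coeff i) x) \<in> borel_measurable borel"
        by (rule borel_measurable_continuous_onI)
      have "(\<lambda>x. edmd_koopman l I (tensor_poly P) K (unit_coeff i) x - koopman \<kappa> (\<phi> i) x) \<in> L2 \<rho> \<and>
        L2_norm \<rho> (\<lambda>x. edmd_koopman l I (tensor_poly P) K (unit_coeff i) x - koopman \<kappa> (\<phi> i) x) \<le> B * rt"
        using \<phi> i rt(1) B0 err[OF K i] unfolding edmd_koopman_unit[OF i, symmetric] B_def
        by (intro koopman_L2_error[OF _ um _ ae]) auto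
      then show "(\<lambda>x. edmd_koopman l I (tensor_poly P) K (unit_coeff i) x - koopman \<kappa> (\<phi> i) x) \<in> L2 \<rho>"
        "L2_norm \<rho> (\<lambda>x. edmd_koopman l I (tensor_poly P) K (unit_coeff i) x - koopman \<kappa> (\<phi> i) x)
              \<le> C r p * polyellipse_sup_norm r (F i) * m powr (1 / 2 - 1 / p)"
        using sc unfolding B_def by auto
    qed
    have event: "\<exists>E\<in>D.events. 1 - real l * \<epsilon> \<le> D.prob E \<and> (\<forall>\<omega>\<in>E. \<forall>r F.
        (\<forall>k. 1 < r $ k) \<and> (\<forall>i<l. holomorphic_extension \<rho> r (koopman \<kappa> (\<phi> i)) (F i)) \<longrightarrow> bound \<omega> r F)"
    proof (cases "l = 0 \<or> d = 0")
      case True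
      then have I: "I = {}" by (auto simp: I_def grid_def)
      have "bound \<omega> r F" if r: "\<forall>k. 1 < r $ k" and F: "\<forall>i<l. holomorphic_extension \<rho> r (koopman \<kappa> (\<phi> i)) (F i)" for \<omega> r F
      proof -
        \<comment> \<open>For d = 0 the approximation is 0 and its error at most the supremum norm,
          hence the factor 1. For l = 0 there is nothing to estimate, but \<open>d\<close> may be
          large, so that 1 might violate \<open>xC\<close>.\<close>
        define x :: real where "x = (if l = 0 then 0 else 1)"
        have x: "x \<ge> 0" by (simp add: x_def)
        have xC: "x * grid_threshold N (Suc d) powr (1 / p - 1 / 2) \<le> C r p"
          using C[OF r p] True unfolding x_def by (auto intro: order_trans[OF powr_ge_zero])
        have uniq: "\<exists>!K. edmd_matrix l n \<phi> I (tensor_poly P) \<omega> K"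
          unfolding I by (rule edmd_matrix_unique) auto
        have err: "cmod ((\<Sum>\<nu>\<in>I. K i \<nu> * tensor_poly P \<nu> y) - F i (complexify y)) \<le> polyellipse_sup_norm r (F i) * x"
          if "i < l" "y \<in> cube" for K :: "nat \<Rightarrow> nat ^ 'N \<Rightarrow> complex" and i y
          using F r that by (auto simp: I x_def holomorphic_extension_def intro!: polyellipse_sup_norm_upper complexify_in_polyellipse)
        show ?thesis by (rule boundI[OF r F x xC uniq]) (rule err)
      qed
      moreover have "1 - real l * \<epsilon> \<le> D.prob (space (data_law n \<rho> \<kappa>))"
        using \<epsilon> by (simp add: D.prob_space)
      ultimately show ?thesis by (intro bexI[of _ "space (data_law n \<rho> \<kappa>)"]) auto
    next
      case False
      then have l: "l > 0" and d0: "d > 0" by auto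
      have I: "I = grid d" using l by (auto simp: I_def)
      define M where "M = 8 * CARD('N) * d ^ 3"
      define q where "q = (1 / (2 * real M)) ^ CARD('N)"
      have M: "M > 0" using d0 by (simp add: M_def)
      then have q: "q > 0" "q \<le> 1" by (auto simp: q_def intro!: power_le_one)
      have n0: "n > 0" using n by simp
      have "real M ^ CARD('N) * exp (- real n * q\<^sup>2 / 2) \<le> \<epsilon>"
        using sampling_condition[OF \<epsilon> n N d0] d(1) unfolding m_def M_def q_def N_def by simp
      then obtain E where E: "E \<in> D.events" "D.prob E \<ge> 1 - \<epsilon>"
        "\<And>\<omega> a. \<omega> \<in> E \<Longrightarrow> a \<in> grid M \<Longrightarrow> real n * q / 2 \<le> (\<Sum>j<n. indicator (cell M a) (fst (\<omega> j)))"
        using all_cells_sampled_prob[OF M n0, of \<epsilon>] unfolding q_def by metis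
      \<comment> \<open>A single event of probability 1 - \<epsilon> serves all \<open>l\<close>
        observables, and l >= 1.\<close>
      have pE: "1 - real l * \<epsilon> \<le> D.prob E"
      proof -
        have "1 * \<epsilon> \<le> real l * \<epsilon>" using l \<epsilon> by (intro mult_right_mono) auto
        then show ?thesis using E(2) by linarith
      qed
      show ?thesis
      \<comment> \<open>If some observable has no extension at all, the claim on \<open>r\<close>
        and \<open>F\<close> is vacuous. Otherwise one family \<open>F0\<close> is fixed before the
        sample is drawn: exceptional sets for the uncountably many possible \<open>F\<close> could
        not be collected into a null set directly.\<close>
      proof (cases "\<forall>i<l. \<exists>F r. (\<forall>k. 1 < r $ k) \<and> holomorphic_extension \<rho> r (koopman \<kappa> (\<phi> i)) F")
        case ext: True
        then obtain F0 where F0: "\<And>i. i < l \<Longrightarrow> \<exists>r. (\<forall>k. 1 < r $ k) \<and> holomorphic_extension \<rho> r (koopman \<kappa> (\<phi> i)) (F0 i)"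
          by metis
        have "AE \<omega> in data_law n \<rho> \<kappa>. \<forall>j<n. fst (\<omega> j) \<in> cube \<and>
            (\<forall>i<l. \<phi> i (snd (\<omega> j)) = F0 i (complexify (fst (\<omega> j))))"
          using \<phi> F0 by (intro extension_AE_samples) auto
        then obtain Z where Z: "Z \<in> null_sets (data_law n \<rho> \<kappa>)" "\<And>\<omega> j. \<omega> \<in> space (data_law n \<rho> \<kappa>) - Z \<Longrightarrow> j < n \<Longrightarrow>
            fst (\<omega> j) \<in> cube \<and> (\<forall>i<l. \<phi> i (snd (\<omega> j)) = F0 i (complexify (fst (\<omega> j))))"
          by (elim AE_E3) blast
        have "bound \<omega> r F" if \<omega>: "\<omega> \<in> E - Z" and r: "\<forall>k. 1 < r $ k"
          and F: "\<forall>i<l. holomorphic_extension \<rho> r (koopman \<kappa> (\<phi> i)) (F i)" for \<omega> r F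
        proof -
          have \<omega>s: "\<omega> \<in> space (data_law n \<rho> \<kappa>) - Z" using \<omega> sets.sets_into_space[OF E(1)] by auto
          have cells: "\<And>a. a \<in> grid M \<Longrightarrow> real n * q / 2 \<le> (\<Sum>j<n. indicator (cell M a) (fst (\<omega> j)))"
            using E(3) \<omega> by auto
          have x: "0 \<le> rate r d"
            unfolding rate_def approx_rate_def using R[OF r] by (intro mult_nonneg_nonneg sum_nonneg divide_nonneg_nonneg) auto
          have xC: "rate r d * grid_threshold N (Suc d) powr (1 / p - 1 / 2) \<le> C r p"
            using C[OF r p] by blast
          have uniq: "\<exists>!K. edmd_matrix l n \<phi> I (tensor_poly P) \<omega> K"
            unfolding I by (rule edmd_matrix_grid_unique[OF d0 n0 q(1) cells[unfolded M_def]])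
          have err: "cmod ((\<Sum>\<nu>\<in>I. K i \<nu> * tensor_poly P \<nu> y) - F i (complexify y)) \<le> polyellipse_sup_norm r (F i) * rate r d"
            if K: "edmd_matrix l n \<phi> I (tensor_poly P) \<omega> K" and i: "i < l" and y: "y \<in> cube" for K i y
          proof -
            have hol: "holomorphic_several (F i) (bernstein_polyellipse r)"
              using F i by (auto simp: holomorphic_extension_def)
            obtain c where c: "\<And>x. x \<in> cube \<Longrightarrow>
                cmod (F i (complexify x) - comb d c x) \<le> polyellipse_sup_norm r (F i) * approx_rate CARD('N) (R r) d"
              using polyellipse_comb_approx[OF hol R(1)[OF r] R(2)[OF r] d0] by metis
            \<comment> \<open>All extensions of one observable agree on the cube, whatever their
              polyellipses, so the null set belonging to \<open>F0\<close> works for every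
              \<open>F\<close>.\<close>
            have eqF: "F0 i (complexify x) = F i (complexify x)" if "x \<in> cube" for x
            proof -
              obtain r0 where r0: "\<forall>k. 1 < r0 $ k" "holomorphic_extension \<rho> r0 (koopman \<kappa> (\<phi> i)) (F0 i)"
                using F0[OF i] by blast
              have "AE x in \<rho>. F0 i (complexify x) = koopman \<kappa> (\<phi> i) x" "AE x in \<rho>. F i (complexify x) = koopman \<kappa> (\<phi> i) x"
                using r0 F i by (auto simp: holomorphic_extension_def)
              then have "AE x in \<rho>. F0 i (complexify x) = F i (complexify x)" by eventually_elim simp
              then show ?thesis
                using r0 F i r that by (intro continuous_AE_eq_imp_eq holomorphic_extension_continuous) auto
            qed
            have samples: "fst (\<omega> j) \<in> cube \<and> \<phi> i (snd (\<omega> j)) = F i (complexify (fst (\<omega> j)))" if "j < n" for j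
              using Z(2)[OF \<omega>s that] i eqF by auto
            have "cmod (comb d (K i) y - F i (complexify y)) \<le> polyellipse_sup_norm r (F i) * approx_rate CARD('N) (R r) d * (1 + 6 / q)"
              by (rule edmd_error[OF d0 n0 q cells[unfolded M_def] samples K[unfolded I] i c y])
            moreover have "6 / q = 6 * (16 * real N * real d ^ 3) ^ N"
              unfolding q_def M_def N_def by (simp add: power_divide mult.assoc)
            ultimately show ?thesis
            unfolding I rate_def comb_def N_def by (simp only: mult.assoc)
          qed
          show ?thesis by (rule boundI[OF r F x xC uniq]) (rule err)
        qed
        moreover have "E - Z \<in> D.events" "D.prob (E - Z) = D.prob E"
          using E(1) Z(1) by (auto intro: measure_Diff_null_set)
        ultimately show ?thesis using pE by (intro bexI[of _ "E - Z"]) auto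
      next
        case False
        then show ?thesis using E(1) pE by (intro bexI[of _ E]) blast+
      qed
    qed
    have "real_of_int (int (card (grid d :: (nat ^ 'N) set))) \<le> m"
      using d(3) by (simp add: card_grid N_def)
    also have "m \<le> of_int \<lceil>m\<rceil>" by (rule le_of_int_ceiling)
    finally have card: "\<forall>i<l. finite (grid d :: (nat ^ 'N) set) \<and> int (card (grid d :: (nat ^ 'N) set)) \<le> \<lceil>m\<rceil>"
      by (simp only: of_int_le_iff finite_grid simp_thms)
    show "\<exists>S :: nat \<Rightarrow> (nat ^ 'N) set.
        (\<forall>i<l. finite (S i) \<and> int (card (S i)) \<le> \<lceil>real n / ln (real n / \<epsilon>)\<rceil>) \<and>
        (\<exists>E \<in> sets (data_law n \<rho> \<kappa>).
          measure (data_law n \<rho> \<kappa>) E \<ge> 1 - real l * \<epsilon> \<and>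
          (\<forall>\<omega>\<in>E. \<forall>(r :: real ^ 'N) (F :: nat \<Rightarrow> complex ^ 'N \<Rightarrow> complex).
            (\<forall>k. 1 < r $ k) \<and> (\<forall>i<l. holomorphic_extension \<rho> r (koopman \<kappa> (\<phi> i)) (F i))
            \<longrightarrow> (\<exists>!K. edmd_matrix l n \<phi> (\<Union>i<l. S i) (tensor_poly P) \<omega> K) \<and>
                (\<forall>K. edmd_matrix l n \<phi> (\<Union>i<l. S i) (tensor_poly P) \<omega> K \<longrightarrow>
                  (\<forall>i<l.
                    (\<lambda>x. edmd_koopman l (\<Union>i<l. S i) (tensor_poly P) K (unit_coeff i) x
                         - koopman \<kappa> (\<phi> i) x) \<in> L2 \<rho> \<and>
                    L2_norm \<rho>
                      (\<lambda>x. edmd_koopman l (\<Union>i<l. S i) (tensor_poly P) K (unit_coeff i) x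
                           - koopman \<kappa> (\<phi> i) x)
                    \<le> C r p * polyellipse_sup_norm r (F i)
                      * (real n / ln (real n / \<epsilon>)) powr (1 / 2 - 1 / p)))))"
      unfolding m_def[symmetric]
      by (rule exI[of _ "\<lambda>_. grid d"]) (rule conjI[OF card event[unfolded bound_def I_def]])
  qed
qed

end
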